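(* For $n,r\ge1$, the Hilbert series of $\mathbb{C}[\mathbf{x}_{n\times n}]/I_{\mathfrak{S}_{n,r}}$ is $$\mathrm{Hilb}(\mathbb{C}[\mathbf{x}_{n\times n}]/I_{\mathfrak{S}_{n,r}};q)=\sum_{k=1}^{rn}c_{n,r,k}\,q^{rn-k}.$$
   Context: $\mathbb{C}[\mathbf{x}_{n\times n}]$ is the polynomial ring in variables $x_{i,j}$, $1\le i,j\le n$. $I_{\mathfrak{S}_{n,r}}$ is the homogeneous ideal generated by: $x_{i,j}^{r+1}$; $x_{i,j}x_{i,j'}$ for $j<j'$; $x_{i,j}x_{i',j}$ for $i<i'$; $\sum_{j} x_{i,j}^r$ for each $i$; $\sum_{i} x_{i,j}^r$ for each $j$. The Hilbert series of a graded quotient $A$ is $\sum_{d\ge0}\dim_{\mathbb{C}}A_d\,q^d$. $\mathfrak{S}_{n,r}$ is the set of pairs $w=(\sigma,\kappa)$, $\sigma\in\mathfrak{S}_n$, $\kappa:[n]\to\{0,\dots,r-1\}$; $C_l(w)=\{(i,\sigma(i)):\kappa(\sigma(i))=l\}$. $\mathrm{lis}(C_0(w))$ is the largest size of a subset $L\subseteq C_0(w)$ such that for $(i,j),(i',j')\in L$, $i<i'$ implies $j<j'$. For integers $n,r,k$, $c_{n,r,k}=\big|\{w\in\mathfrak{S}_{n,r}: r\cdot\mathrm{lis}(C_0(w))+\sum_{i=1}^{r-1}(r-i)|C_i(w)|=k\}\big|$. *)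

theory Defs
  imports
    Complex_Main
    "HOL-Library.Poly_Mapping"
    "HOL-Library.FuncSet"
    "HOL-Combinatorics.Permutations"
    "HOL-Computational_Algebra.Formal_Power_Series"
    "HOL-Algebra.QuotRing"
    "HOL-Algebra.Embedded_Algebras"
begin

text \<open>A monomial is a finitely supported exponent function on the variable indices
  \<open>(i, j)\<close>, and a polynomial is a finitely supported function from monomials to coefficients.
  Multiplication on this type is convolution, i.e. multiplication of polynomials.\<close>

type_synonym cpoly = "((nat \<times> nat) \<Rightarrow>\<^sub>0 nat) \<Rightarrow>\<^sub>0 complex"

definition xvar :: "nat \<Rightarrow> nat \<Rightarrow> cpoly" where
  "xvar i j = Poly_Mapping.single (Poly_Mapping.single (i, j) 1) 1"

definition matrix_polys :: "nat \<Rightarrow> cpoly set" where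
  "matrix_polys n = {p. \<forall>m \<in> Poly_Mapping.keys p. Poly_Mapping.keys m \<subseteq> {1..n} \<times> {1..n}}"

definition matrix_poly_ring :: "nat \<Rightarrow> cpoly ring" where
  "matrix_poly_ring n =
     \<lparr>carrier = matrix_polys n, mult = (*), one = 1, zero = 0, add = (+)\<rparr>"

definition constant_polys :: "cpoly set" where
  "constant_polys = {Poly_Mapping.single 0 c | c. True}"

definition monomial_degree :: "((nat \<times> nat) \<Rightarrow>\<^sub>0 nat) \<Rightarrow> nat" where
  "monomial_degree m = (\<Sum>v \<in> Poly_Mapping.keys m. Poly_Mapping.lookup m v)"

definition homogeneous_polys :: "nat \<Rightarrow> nat \<Rightarrow> cpoly set" where
  "homogeneous_polys n d =
     {p \<in> matrix_polys n. \<forall>m \<in> Poly_Mapping.keys p. monomial_degree m = d}"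

text \<open>For an ideal \<open>I\<close>, \<open>quot_image n I S\<close> is the image of \<open>S\<close> under the projection onto the
  quotient by \<open>I\<close>. The image of the constants is the copy of the complex numbers over which
  dimensions are taken, and for homogeneous \<open>I\<close> the image of the forms of degree \<open>d\<close> is the
  component of degree \<open>d\<close> of the quotient.\<close>

definition quot_image :: "nat \<Rightarrow> cpoly set \<Rightarrow> cpoly set \<Rightarrow> cpoly set set" where
  "quot_image n I S = (\<lambda>p. I +>\<^bsub>matrix_poly_ring n\<^esub> p) ` S"

definition quot_hilbert_series :: "nat \<Rightarrow> cpoly set \<Rightarrow> int fps" where
  "quot_hilbert_series n I =
     Abs_fps (\<lambda>d. int (ring.dim (matrix_poly_ring n Quot I)
                         (quot_image n I constant_polys)
                         (quot_image n I (homogeneous_polys n d))))"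

definition colored_perm_gens :: "nat \<Rightarrow> nat \<Rightarrow> cpoly set" where
  "colored_perm_gens n r =
     {xvar i j ^ (r + 1) | i j. i \<in> {1..n} \<and> j \<in> {1..n}}
   \<union> {xvar i j * xvar i j' | i j j'. i \<in> {1..n} \<and> j \<in> {1..n} \<and> j' \<in> {1..n} \<and> j < j'}
   \<union> {xvar i j * xvar i' j | i i' j. i \<in> {1..n} \<and> i' \<in> {1..n} \<and> j \<in> {1..n} \<and> i < i'}
   \<union> {(\<Sum>j = 1..n. xvar i j ^ r) | i. i \<in> {1..n}}
   \<union> {(\<Sum>i = 1..n. xvar i j ^ r) | j. j \<in> {1..n}}"

definition colored_perm_ideal :: "nat \<Rightarrow> nat \<Rightarrow> cpoly set" where
  "colored_perm_ideal n r = Idl\<^bsub>matrix_poly_ring n\<^esub> (colored_perm_gens n r)"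

text \<open>The colour function is taken in \<open>\<rightarrow>\<^sub>E\<close>, hence constant outside \<open>{1..n}\<close>, so that
  distinct elements are distinct colourings of \<open>{1..n}\<close> and can be counted.\<close>

definition colored_perms :: "nat \<Rightarrow> nat \<Rightarrow> ((nat \<Rightarrow> nat) \<times> (nat \<Rightarrow> nat)) set" where
  "colored_perms n r = {\<sigma>. \<sigma> permutes {1..n}} \<times> ({1..n} \<rightarrow>\<^sub>E {0..<r})"

definition color_class :: "nat \<Rightarrow> nat \<Rightarrow> (nat \<Rightarrow> nat) \<times> (nat \<Rightarrow> nat) \<Rightarrow> (nat \<times> nat) set" where
  "color_class n l w = {(i, fst w i) | i. i \<in> {1..n} \<and> snd w (fst w i) = l}"

definition lis :: "(nat \<times> nat) set \<Rightarrow> nat" where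
  "lis C = Max {card L | L. L \<subseteq> C \<and>
     (\<forall>(i, j) \<in> L. \<forall>(i', j') \<in> L. i < i' \<longrightarrow> j < j')}"

definition perm_count :: "nat \<Rightarrow> nat \<Rightarrow> nat \<Rightarrow> nat" where
  "perm_count n r k =
     card {w \<in> colored_perms n r.
       r * lis (color_class n 0 w) + (\<Sum>i = 1..r - 1. (r - i) * card (color_class n i w)) = k}"

end

theory Submission
  imports Defs
begin

text \<open>Modulo the ideal, a monomial is nonzero only if its support is a rook placement with exponents
  at most \<open>r\<close>. Fixing the cells with exponent below \<open>r\<close> splits the quotient into sectors, and each
  sector is a copy of the case \<open>r = 1\<close> on the remaining \<open>m\<close> rows and columns. There the dual of the
  component of degree \<open>k\<close> consists of the balanced functions on rook placements of size \<open>k\<close>, those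
  whose sum over all extensions of a smaller placement within a fixed row or column vanishes.

  For a permutation \<open>G\<close>, let the residual be the complement of a longest increasing subsequence.
  Colouring \<open>G\<close> by its decreasing level classes and antisymmetrising over each class gives a balanced
  function of degree \<open>m - lis G\<close>, by the pigeonhole principle. Evaluated on residuals these functions
  form a unitriangular matrix for the lexicographic order, so the dimension in degree \<open>k\<close> is at least
  the number of \<open>G\<close> with \<open>m - lis G = k\<close>. Conversely, summing a balanced function over the
  subplacements of a permutation is injective on the direct sum of all degrees: after exchanging rows
  and columns by balancedness, the associated quadratic form becomes a sum of squares. Hence the total
  dimension is at most \<open>m!\<close>, and all the inequalities are equalities. In particular the monomials of
  the residuals form a basis.\<close>

section \<open>Rook placements and balanced functions\<close>

text \<open>Straightening an arbitrary rook monomial into residual monomials is avoided by working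
  with functionals on the quotient. Sectors separate because the generators other than monomials
  involve only \<open>r\<close>-th powers: these change the set of cells with exponent
  \<open>r\<close> and leave the smaller exponents alone. The lower bound is explicit in each
  degree, while the upper bound exists only for all degrees at once, the lifts being functions on
  the \<open>m!\<close> perfect placements. The two meet because every perfect placement
  \<open>G\<close> is counted in exactly one degree. Injectivity of the lift rests on positivity
  over the complex numbers: conjugation yields squared moduli, and the weights are factorials. Level
  classes are chosen because there are at most \<open>lis G\<close> of them: a placement with fewer
  than \<open>m - lis G\<close> rooks leaves two empty rows in one class, and antisymmetry then
  cancels everything. The residual has just the critical size \<open>m - lis G\<close>. It nearly
  determines \<open>G\<close>, since the increasing filling of the remaining rows and columns is the
  lexicographically least one; this is the source of triangularity.\<close>

definition rooks :: "'a set \<Rightarrow> 'b set \<Rightarrow> nat \<Rightarrow> ('a \<times> 'b) set set" where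
  "rooks X Y a = {R. R \<subseteq> X \<times> Y \<and> finite R \<and> inj_on fst R \<and> inj_on snd R \<and> card R = a}"

text \<open>The condition for a functional on rook monomials to vanish on multiples of the row sums.
  Writing \<open>Suc t = k\<close> makes it vacuous in degree 0, where every function is
  balanced.\<close>

definition row_balanced :: "'a set \<Rightarrow> 'b set \<Rightarrow> nat \<Rightarrow> (('a \<times> 'b) set \<Rightarrow> 'c::comm_ring_1) \<Rightarrow> bool" where
  "row_balanced I J k f \<longleftrightarrow>
     (\<forall>t T i. T \<in> rooks I J t \<longrightarrow> Suc t = k \<longrightarrow> i \<in> I - fst ` T \<longrightarrow>
        (\<Sum>j\<in>J - snd ` T. f (insert (i, j) T)) = 0)"

definition col_balanced :: "'a set \<Rightarrow> 'b set \<Rightarrow> nat \<Rightarrow> (('a \<times> 'b) set \<Rightarrow> 'c::comm_ring_1) \<Rightarrow> bool" where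
  "col_balanced I J k f \<longleftrightarrow>
     (\<forall>t T j. T \<in> rooks I J t \<longrightarrow> Suc t = k \<longrightarrow> j \<in> J - snd ` T \<longrightarrow>
        (\<Sum>i\<in>I - fst ` T. f (insert (i, j) T)) = 0)"

lemma finite_rooks: "finite X \<Longrightarrow> finite Y \<Longrightarrow> finite (rooks X Y a)"
  by (rule finite_subset[of _ "Pow (X \<times> Y)"]) (auto simp: rooks_def)

lemma rooks_0 [simp]: "rooks X Y 0 = {{}}"
  by (auto simp: rooks_def)

lemma rooks_empty_left: "rooks {} Y (Suc a) = {}"
  by (auto simp: rooks_def)

lemma rooks_fst_card: "R \<in> rooks X Y a \<Longrightarrow> card (fst ` R) = a"
  by (auto simp: rooks_def card_image)

lemma rooks_snd_card: "R \<in> rooks X Y a \<Longrightarrow> card (snd ` R) = a"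
  by (auto simp: rooks_def card_image)

lemma rooks_fst_subset: "R \<in> rooks X Y a \<Longrightarrow> fst ` R \<subseteq> X"
  and rooks_snd_subset: "R \<in> rooks X Y a \<Longrightarrow> snd ` R \<subseteq> Y"
  by (auto simp: rooks_def)

lemma rooks_le_left: "finite X \<Longrightarrow> R \<in> rooks X Y a \<Longrightarrow> a \<le> card X"
  by (metis card_mono rooks_fst_card rooks_fst_subset)

lemma rooks_mono: "X \<subseteq> X' \<Longrightarrow> Y \<subseteq> Y' \<Longrightarrow> rooks X Y a \<subseteq> rooks X' Y' a"
  by (auto simp: rooks_def)

lemma rooks_union:
  assumes "T \<in> rooks I J t" "R \<in> rooks (I - fst ` T) (J - snd ` T) a"
  shows "T \<union> R \<in> rooks I J (t + a)" "T \<inter> R = {}"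
proof -
  have 1: "fst ` T \<inter> fst ` R = {}" and 2: "snd ` T \<inter> snd ` R = {}"
    using rooks_fst_subset[OF assms(2)] rooks_snd_subset[OF assms(2)] by auto
  show d: "T \<inter> R = {}" using 1 by auto
  have "inj_on fst (T \<union> R)" "inj_on snd (T \<union> R)"
    using assms 1 2 by (auto simp: rooks_def inj_on_Un Diff_Int_distrib2 intro: inj_on_subset)
  then show "T \<union> R \<in> rooks I J (t + a)"
    using assms d by (auto simp: rooks_def card_Un_disjoint)
qed

lemma rooks_insert:
  assumes "T \<in> rooks I J t" "i \<in> I - fst ` T" "j \<in> J - snd ` T"
  shows "insert (i, j) T \<in> rooks I J (Suc t)"
proof -
  have "{(i, j)} \<in> rooks (I - fst ` T) (J - snd ` T) 1"
    using assms by (auto simp: rooks_def)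
  from rooks_union(1)[OF assms(1) this] show ?thesis by simp
qed

lemma rooks_subset:
  assumes "R \<in> rooks I J k" "T \<subseteq> R"
  shows "T \<in> rooks I J (card T)" "R - T \<in> rooks (I - fst ` T) (J - snd ` T) (k - card T)"
proof -
  have fT: "finite T" and fR: "finite R" using assms finite_subset by (auto simp: rooks_def)
  show "T \<in> rooks I J (card T)"
    using assms fT by (auto simp: rooks_def intro: inj_on_subset)
  have "R - T \<subseteq> (I - fst ` T) \<times> (J - snd ` T)"
  proof
    fix p assume p: "p \<in> R - T"
    then have "fst p \<notin> fst ` T" "snd p \<notin> snd ` T"
      using assms by (auto simp: rooks_def dest: inj_onD)+
    then show "p \<in> (I - fst ` T) \<times> (J - snd ` T)"
      using p assms(1) by (auto simp: rooks_def mem_Times_iff)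
  qed
  then show "R - T \<in> rooks (I - fst ` T) (J - snd ` T) (k - card T)"
    using assms fT fR by (auto simp: rooks_def card_Diff_subset intro: inj_on_subset)
qed

lemma rooks_insert_left_split:
  assumes "i \<notin> X"
  shows "rooks (insert i X) Y (Suc a) =
     rooks X Y (Suc a) \<union> (\<Union>R\<in>rooks X Y a. \<Union>j\<in>Y - snd ` R. {insert (i, j) R})"
    (is "?L = ?A \<union> ?B")
proof
  show "?A \<union> ?B \<subseteq> ?L"
  proof
    fix R assume "R \<in> ?A \<union> ?B"
    then show "R \<in> ?L"
    proof
      assume "R \<in> ?A" then show ?thesis using rooks_mono[of X "insert i X" Y Y] by auto
    next
      assume "R \<in> ?B"
      then obtain R' j where *: "R' \<in> rooks X Y a" "j \<in> Y - snd ` R'" "R = insert (i, j) R'" by auto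
      have "R' \<in> rooks (insert i X) Y a" using rooks_mono[of X "insert i X" Y Y] * by auto
      moreover have "i \<notin> fst ` R'" using * assms by (auto simp: rooks_def)
      ultimately show ?thesis using * rooks_insert by fastforce
    qed
  qed
  show "?L \<subseteq> ?A \<union> ?B"
  proof
    fix R assume R: "R \<in> ?L"
    show "R \<in> ?A \<union> ?B"
    proof (cases "i \<in> fst ` R")
      case False
      then have "R \<in> ?A" using R by (force simp: rooks_def)
      then show ?thesis by simp
    next
      case True
      then obtain j where j: "(i, j) \<in> R" by force
      have *: "R - {(i, j)} \<in> rooks (insert i X - {i}) (Y - {j}) a"
        using rooks_subset(2)[OF R, of "{(i, j)}"] j by simp
      then have "R - {(i, j)} \<in> rooks X Y a" "j \<notin> snd ` (R - {(i, j)})"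
        using assms by (auto simp: rooks_def)
      moreover have "j \<in> Y" using R j by (auto simp: rooks_def)
      moreover have "R = insert (i, j) (R - {(i, j)})" using j by auto
      ultimately have "R \<in> ?B" by blast
      then show ?thesis by simp
    qed
  qed
qed

lemma sum_rooks_insert_left:
  fixes h :: "('a \<times> 'b) set \<Rightarrow> 'c::comm_monoid_add"
  assumes "finite X" "finite Y" "i \<notin> X"
  shows "(\<Sum>R\<in>rooks (insert i X) Y (Suc a). h R) =
     (\<Sum>R\<in>rooks X Y (Suc a). h R) + (\<Sum>R\<in>rooks X Y a. \<Sum>j\<in>Y - snd ` R. h (insert (i, j) R))"
proof -
  let ?B = "\<Union>R\<in>rooks X Y a. \<Union>j\<in>Y - snd ` R. {insert (i, j) R}"
  let ?S = "SIGMA R:rooks X Y a. Y - snd ` R"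
  have B: "?B = (\<lambda>(R, j). insert (i, j) R) ` ?S" by auto
  have inj: "inj_on (\<lambda>(R, j). insert (i, j) R) ?S"
  proof (rule inj_onI, clarify)
    fix R j R' j'
    assume a: "R \<in> rooks X Y a" "R' \<in> rooks X Y a" "insert (i, j) R = insert (i, j') R'"
    have n: "(i, y) \<notin> R" "(i, y) \<notin> R'" for y using a(1,2) assms(3) by (auto simp: rooks_def)
    then have "j = j'" using a(3) by (metis insertCI insertE prod.inject)
    moreover from this have "R = R'" using a(3) n by (metis insert_ident)
    ultimately show "R = R' \<and> j = j'" by simp
  qed
  have "(\<Sum>R\<in>?B. h R) = (\<Sum>R\<in>rooks X Y a. \<Sum>j\<in>Y - snd ` R. h (insert (i, j) R))"
    unfolding B sum.reindex[OF inj] comp_def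
    by (subst sum.Sigma) (auto simp: finite_rooks assms split_beta)
  moreover have "rooks X Y (Suc a) \<inter> ?B = {}" using assms(3) by (auto simp: rooks_def)
  moreover have "finite ?B" using assms by (auto simp: finite_rooks)
  ultimately show ?thesis
    unfolding rooks_insert_left_split[OF assms(3)]
    by (subst sum.union_disjoint) (auto simp: finite_rooks assms)
qed

lemma mem_rooks_remove_right:
  "R \<in> rooks X (Y - {j}) a \<longleftrightarrow> R \<in> rooks X Y a \<and> j \<notin> snd ` R"
  by (fastforce simp: rooks_def image_iff)

lemma sum_rooks_remove_right:
  fixes h :: "('a \<times> 'b) set \<Rightarrow> 'b \<Rightarrow> 'c::comm_monoid_add"
  assumes "finite X" "finite Y"
  shows "(\<Sum>R\<in>rooks X Y a. \<Sum>j\<in>Y - snd ` R. h R j) = (\<Sum>j\<in>Y. \<Sum>R\<in>rooks X (Y - {j}) a. h R j)"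
proof -
  have "(\<Sum>R\<in>rooks X Y a. \<Sum>j\<in>Y - snd ` R. h R j) =
      (\<Sum>(R, j)\<in>(SIGMA R:rooks X Y a. Y - snd ` R). h R j)"
    by (rule sum.Sigma) (auto simp: finite_rooks assms)
  also have "\<dots> = (\<Sum>(j, R)\<in>(SIGMA j:Y. rooks X (Y - {j}) a). h R j)"
    by (rule sum.reindex_bij_witness[of _ prod.swap prod.swap]) (auto simp: mem_rooks_remove_right)
  also have "\<dots> = (\<Sum>j\<in>Y. \<Sum>R\<in>rooks X (Y - {j}) a. h R j)"
    by (rule sum.Sigma[symmetric]) (auto simp: finite_rooks assms)
  finally show ?thesis .
qed

lemma card_perfect_rooks:
  assumes "finite X" "finite Y" "card X = card Y"
  shows "card (rooks X Y (card X)) = fact (card X)"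
  using assms
proof (induction X arbitrary: Y rule: finite_induct)
  case empty
  then show ?case by simp
next
  case (insert i X)
  have "rooks X Y (Suc (card X)) = {}" using rooks_le_left[OF insert(1)] by fastforce
  then have "card (rooks (insert i X) Y (Suc (card X))) =
      (\<Sum>R\<in>rooks X Y (card X). \<Sum>j\<in>Y - snd ` R. 1)"
    using sum_rooks_insert_left[OF insert(1,4,2), where a = "card X" and h = "\<lambda>_. 1::nat"] by simp
  also have "\<dots> = (\<Sum>j\<in>Y. card (rooks X (Y - {j}) (card X)))"
    by (subst sum_rooks_remove_right) (auto simp: insert)
  also have "\<dots> = (\<Sum>j\<in>Y. fact (card X))"
    by (rule sum.cong) (auto simp: insert.IH insert.prems(1) insert.prems(2)[symmetric] insert.hyps)
  also have "\<dots> = fact (Suc (card X))"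
    using insert.prems(2) insert.hyps by (metis card_insert_disjoint fact_Suc of_nat_id sum_constant)
  finally show ?case by (simp only: card_insert_disjoint[OF insert.hyps])
qed

section \<open>Exchanging free columns or rows for their complement\<close>

text \<open>Balancedness moves one rook from \<open>Y\<close> to \<open>Y'\<close> at the cost of a
  sign, and \<open>a\<close> rooks have to move. In the induction on the rows, a placement using the
  new row \<open>i\<close> first sends that rook to \<open>Y'\<close>, where its cell is absorbed
  into \<open>T\<close>; this is why \<open>T\<close>, \<open>t\<close> and both column sets are
  generalised.\<close>

lemma row_balanced_exchange:
  assumes "row_balanced I J k f" "finite J"
    and "finite X" "X \<subseteq> I - fst ` T" "T \<in> rooks I J t" "t + a = k"
    and "Y \<union> Y' = J - snd ` T" "Y \<inter> Y' = {}"
  shows "(\<Sum>R\<in>rooks X Y a. f (T \<union> R)) = (-1) ^ a * (\<Sum>R\<in>rooks X Y' a. f (T \<union> R))"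
  using assms(3-)
proof (induction X arbitrary: T t a Y Y' rule: finite_induct)
  case empty
  then show ?case by (cases a) (auto simp: rooks_empty_left)
next
  case (insert i X)
  show ?case
  proof (cases a)
    case 0
    then show ?thesis by simp
  next
    case (Suc b)
    have fin: "finite Y" "finite Y'" using insert.prems(4) assms(2)
      by (metis finite_Diff finite_Un)+
    have i: "i \<in> I - fst ` T" and X: "X \<subseteq> I - fst ` T" using insert.prems(1) by auto
    \<comment> \<open>Once \<open>(i, j)\<close> belongs to \<open>T\<close>, the free columns are
      \<open>(Y1 - {j}) \<union> Y2\<close>, again a disjoint union to which the induction
      hypothesis applies.\<close>
    have step: "(\<Sum>R\<in>rooks X (Y1 - {j}) b. f (T \<union> insert (i, j) R)) =
        (-1) ^ b * (\<Sum>R\<in>rooks X Y2 b. f (T \<union> insert (i, j) R))"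
      if j: "j \<in> Y1" and Y: "Y1 \<union> Y2 = J - snd ` T" "Y1 \<inter> Y2 = {}" for Y1 Y2 j
    proof -
      have T': "insert (i, j) T \<in> rooks I J (Suc t)"
        using rooks_insert[OF insert.prems(2) i] j Y by auto
      have "(\<Sum>R\<in>rooks X (Y1 - {j}) b. f (insert (i, j) T \<union> R)) =
          (-1) ^ b * (\<Sum>R\<in>rooks X Y2 b. f (insert (i, j) T \<union> R))"
        by (rule insert.IH[OF _ T']) (use insert.prems insert.hyps j Y Suc in auto)
      then show ?thesis by simp
    qed
    have bal: "(\<Sum>j\<in>Y - snd ` R. f (T \<union> insert (i, j) R)) = - (\<Sum>j\<in>Y'. f (T \<union> insert (i, j) R))"
      if R: "R \<in> rooks X Y b" for R
    proof -
      have "R \<in> rooks (I - fst ` T) (J - snd ` T) b"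
        using rooks_mono[OF X, of Y "J - snd ` T" b] R insert.prems(4) by auto
      from rooks_union[OF insert.prems(2) this] have TR: "T \<union> R \<in> rooks I J (t + b)" by simp
      moreover have "i \<in> I - fst ` (T \<union> R)"
        using i R insert.hyps by (auto simp: rooks_def)
      ultimately have "(\<Sum>j\<in>J - snd ` (T \<union> R). f (insert (i, j) (T \<union> R))) = 0"
        using assms(1) insert.prems(3) Suc unfolding row_balanced_def by fastforce
      moreover have "J - snd ` (T \<union> R) = (Y - snd ` R) \<union> Y'"
        using insert.prems(4,5) rooks_snd_subset[OF R] by auto
      ultimately have "(\<Sum>j\<in>(Y - snd ` R) \<union> Y'. f (T \<union> insert (i, j) R)) = 0" by simp
      then show ?thesis
        using fin insert.prems(5) by (subst (asm) sum.union_disjoint) (auto simp: eq_neg_iff_add_eq_0)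
    qed
    have "(\<Sum>R\<in>rooks (insert i X) Y a. f (T \<union> R)) = (\<Sum>R\<in>rooks X Y (Suc b). f (T \<union> R)) +
        (\<Sum>R\<in>rooks X Y b. \<Sum>j\<in>Y - snd ` R. f (T \<union> insert (i, j) R))"
      unfolding Suc by (rule sum_rooks_insert_left) (use insert.hyps fin in auto)
    also have "(\<Sum>R\<in>rooks X Y (Suc b). f (T \<union> R)) = (-1) ^ a * (\<Sum>R\<in>rooks X Y' (Suc b). f (T \<union> R))"
      using insert.IH[OF X insert.prems(2-5)] Suc by simp
    also have "(\<Sum>R\<in>rooks X Y b. \<Sum>j\<in>Y - snd ` R. f (T \<union> insert (i, j) R)) =
        - (\<Sum>R\<in>rooks X Y b. \<Sum>j\<in>Y'. f (T \<union> insert (i, j) R))"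
      using bal by (simp add: sum_negf)
    also have "(\<Sum>R\<in>rooks X Y b. \<Sum>j\<in>Y'. f (T \<union> insert (i, j) R)) =
        (\<Sum>j\<in>Y'. \<Sum>R\<in>rooks X Y b. f (T \<union> insert (i, j) R))"
      by (rule sum.swap)
    also have "\<dots> = (\<Sum>j\<in>Y'. (-1) ^ b * (\<Sum>R\<in>rooks X (Y' - {j}) b. f (T \<union> insert (i, j) R)))"
    proof (rule sum.cong)
      fix j assume "j \<in> Y'"
      \<comment> \<open>Here \<open>Y'\<close> takes the part of \<open>Y1\<close>, since the rook
        of row \<open>i\<close> now stands in \<open>Y'\<close>. The sign \<open>(-1) ^ b\<close> is
        its own inverse, so the equation can be read backwards.\<close>
      from step[OF this, of Y] insert.prems(4,5)
      have "(\<Sum>R\<in>rooks X (Y' - {j}) b. f (T \<union> insert (i, j) R)) =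
          (-1) ^ b * (\<Sum>R\<in>rooks X Y b. f (T \<union> insert (i, j) R))" by (auto simp: Un_commute Int_commute)
      then show "(\<Sum>R\<in>rooks X Y b. f (T \<union> insert (i, j) R)) =
          (-1) ^ b * (\<Sum>R\<in>rooks X (Y' - {j}) b. f (T \<union> insert (i, j) R))"
        by (simp add: mult.assoc[symmetric] power_add[symmetric])
    qed simp
    also have "\<dots> = (-1) ^ b * (\<Sum>R\<in>rooks X Y' b. \<Sum>j\<in>Y' - snd ` R. f (T \<union> insert (i, j) R))"
      by (subst sum_rooks_remove_right) (simp_all add: sum_distrib_left insert.hyps fin)
    also have "(-1) ^ a * (\<Sum>R\<in>rooks X Y' (Suc b). f (T \<union> R)) +
        - ((-1) ^ b * (\<Sum>R\<in>rooks X Y' b. \<Sum>j\<in>Y' - snd ` R. f (T \<union> insert (i, j) R))) =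
        (-1) ^ a * (\<Sum>R\<in>rooks (insert i X) Y' a. f (T \<union> R))"
      unfolding Suc
      by (subst sum_rooks_insert_left) (use insert.hyps fin in \<open>simp_all add: algebra_simps\<close>)
    finally show ?thesis .
  qed
qed

lemma rooks_swap: "R \<in> rooks X Y a \<Longrightarrow> prod.swap ` R \<in> rooks Y X a"
  by (auto simp: rooks_def inj_on_def card_image[OF inj_on_subset[OF inj_swap]])

lemma sum_rooks_swap: "(\<Sum>R\<in>rooks X Y a. h R) = (\<Sum>R\<in>rooks Y X a. h (prod.swap ` R))"
  by (rule sum.reindex_bij_witness[of _ "image prod.swap" "image prod.swap"])
     (auto simp: rooks_swap image_image)

lemma row_balanced_swap:
  "col_balanced I J k f \<Longrightarrow> row_balanced J I k (\<lambda>R. f (prod.swap ` R))"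
  unfolding col_balanced_def row_balanced_def
proof (intro allI impI)
  fix t T i
  assume *: "\<forall>t T j. T \<in> rooks I J t \<longrightarrow> Suc t = k \<longrightarrow> j \<in> J - snd ` T \<longrightarrow>
        (\<Sum>i\<in>I - fst ` T. f (insert (i, j) T)) = 0"
    and T: "T \<in> rooks J I t" "Suc t = k" "i \<in> J - fst ` T"
  have "(\<Sum>j\<in>I - fst ` (prod.swap ` T). f (insert (j, i) (prod.swap ` T))) = 0"
    using *[rule_format, OF rooks_swap[OF T(1)] T(2), of i] T(3) by (simp add: image_image)
  then show "(\<Sum>j\<in>I - snd ` T. f (prod.swap ` insert (i, j) T)) = 0"
    by (simp add: image_image)
qed

lemma col_balanced_exchange:
  assumes "col_balanced I J k f" "finite I"
    and "finite Y" "Y \<subseteq> J - snd ` T" "T \<in> rooks I J t" "t + a = k"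
    and "X \<union> X' = I - fst ` T" "X \<inter> X' = {}"
  shows "(\<Sum>R\<in>rooks X Y a. f (T \<union> R)) = (-1) ^ a * (\<Sum>R\<in>rooks X' Y a. f (T \<union> R))"
proof -
  have "(\<Sum>R\<in>rooks Y X a. f (prod.swap ` (prod.swap ` T \<union> R))) =
      (-1) ^ a * (\<Sum>R\<in>rooks Y X' a. f (prod.swap ` (prod.swap ` T \<union> R)))"
    using row_balanced_exchange[OF row_balanced_swap[OF assms(1)] assms(2,3) _ rooks_swap[OF assms(5)] assms(6), of X X']
      assms(4,7,8) by (simp add: image_image)
  then show ?thesis
    by (subst (1 2) sum_rooks_swap) (simp add: image_Un image_image)
qed

section \<open>Lifting balanced functions to perfect placements\<close>

text \<open>If \<open>f\<close> is read as the coefficients of a form of degree \<open>k\<close>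
  supported on rook monomials, this is the value of that form at the permutation matrix of
  \<open>G\<close>.\<close>

definition rook_lift :: "nat \<Rightarrow> (('a \<times> 'b) set \<Rightarrow> 'c::comm_monoid_add) \<Rightarrow> ('a \<times> 'b) set \<Rightarrow> 'c" where
  "rook_lift k f G = (\<Sum>R | R \<subseteq> G \<and> card R = k. f R)"

lemma card_perfect_extensions:
  assumes "finite I" "finite J" "card I = card J" "Z \<in> rooks I J z"
  shows "card {G \<in> rooks I J (card I). Z \<subseteq> G} = fact (card I - z)"
proof -
  have z: "z \<le> card I" using rooks_le_left assms by blast
  have cZ: "card Z = z" using assms(4) by (auto simp: rooks_def)
  have cI: "card (I - fst ` Z) = card I - z"
    using assms rooks_fst_card[OF assms(4)] rooks_fst_subset[OF assms(4)]
    by (simp add: card_Diff_subset finite_subset)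
  have cJ: "card (J - snd ` Z) = card I - z"
    using assms rooks_snd_card[OF assms(4)] rooks_snd_subset[OF assms(4)]
    by (simp add: card_Diff_subset finite_subset)
  have "bij_betw (\<lambda>G. G - Z) {G \<in> rooks I J (card I). Z \<subseteq> G}
      (rooks (I - fst ` Z) (J - snd ` Z) (card I - z))"
  proof (rule bij_betw_byWitness[of _ "\<lambda>R. Z \<union> R"])
    show "(\<lambda>G. G - Z) ` {G \<in> rooks I J (card I). Z \<subseteq> G} \<subseteq>
        rooks (I - fst ` Z) (J - snd ` Z) (card I - z)"
      using rooks_subset(2) cZ by blast
    show "(\<lambda>R. Z \<union> R) ` rooks (I - fst ` Z) (J - snd ` Z) (card I - z) \<subseteq>
        {G \<in> rooks I J (card I). Z \<subseteq> G}"
      using rooks_union(1)[OF assms(4)] z by fastforce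
    show "\<forall>R\<in>rooks (I - fst ` Z) (J - snd ` Z) (card I - z). (Z \<union> R) - Z = R"
      using rooks_union(2)[OF assms(4)] by blast
  qed auto
  from bij_betw_same_card[OF this] show ?thesis
    using card_perfect_rooks[of "I - fst ` Z" "J - snd ` Z"] cI cJ assms by simp
qed

text \<open>Double counting: \<open>f R\<close> occurs once for each perfect placement containing
  \<open>R \<union> R'\<close>, a factorial number of times if the union is a placement and never
  otherwise. Sorting by \<open>T = R \<inter> R'\<close> leaves the rest of \<open>R\<close> in the
  rows and columns that \<open>R'\<close> misses.\<close>

lemma sum_extensions_rook_lift:
  fixes f :: "('a \<times> 'b) set \<Rightarrow> 'c::comm_ring_1"
  assumes "finite I" "finite J" "card I = card J" "R' \<in> rooks I J j"
  shows "(\<Sum>G | G \<in> rooks I J (card I) \<and> R' \<subseteq> G. rook_lift k f G) =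
     (\<Sum>T | T \<subseteq> R' \<and> card T \<le> k. of_nat (fact (card I - j - (k - card T))) *
        (\<Sum>R\<in>rooks (I - fst ` R') (J - snd ` R') (k - card T). f (T \<union> R)))"
proof -
  let ?P = "{G. G \<in> rooks I J (card I) \<and> R' \<subseteq> G}"
  let ?w = "\<lambda>T. of_nat (fact (card I - j - (k - card T))) :: 'c"
  let ?S = "SIGMA T:{T. T \<subseteq> R' \<and> card T \<le> k}. rooks (I - fst ` R') (J - snd ` R') (k - card T)"
  let ?C = "{R \<in> rooks I J k. R \<union> R' \<in> rooks I J (card (R \<union> R'))}"
  have fP: "finite ?P" using finite_rooks[OF assms(1,2)] by simp
  have fR': "finite R'" and cR': "card R' = j" using assms(4) by (auto simp: rooks_def)
  have "(\<Sum>G\<in>?P. rook_lift k f G) = (\<Sum>G\<in>?P. \<Sum>R | R \<in> rooks I J k \<and> R \<subseteq> G. f R)"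
    unfolding rook_lift_def
  proof (rule sum.cong[OF refl], rule sum.cong)
    fix G assume "G \<in> ?P"
    then show "{R. R \<subseteq> G \<and> card R = k} = {R. R \<in> rooks I J k \<and> R \<subseteq> G}"
      using rooks_subset(1)[of G I J "card I"] by (auto simp: rooks_def)
  qed auto
  also have "\<dots> = (\<Sum>R\<in>rooks I J k. \<Sum>G | G \<in> ?P \<and> R \<subseteq> G. f R)"
    by (rule sum.swap_restrict) (use fP finite_rooks[OF assms(1,2)] in auto)
  also have "\<dots> = (\<Sum>R\<in>rooks I J k. of_nat (card {G \<in> ?P. R \<subseteq> G}) * f R)" by simp
  \<comment> \<open>Placements that clash with \<open>R'\<close> have no common extension with it
    and drop out.\<close>
  also have "\<dots> = (\<Sum>R\<in>?C. of_nat (fact (card I - card (R \<union> R'))) * f R)"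
  proof (rule sum.mono_neutral_cong_right)
    fix R assume "R \<in> ?C"
    then have "card {G \<in> rooks I J (card I). R \<union> R' \<subseteq> G} = fact (card I - card (R \<union> R'))"
      using card_perfect_extensions[OF assms(1-3)] by blast
    moreover have "{G \<in> ?P. R \<subseteq> G} = {G \<in> rooks I J (card I). R \<union> R' \<subseteq> G}" by auto
    ultimately show "of_nat (card {G \<in> ?P. R \<subseteq> G}) * f R = of_nat (fact (card I - card (R \<union> R'))) * f R"
      by simp
  next
    show "\<forall>R\<in>rooks I J k - ?C. of_nat (card {G \<in> ?P. R \<subseteq> G}) * f R = 0"
    proof
      fix R assume R: "R \<in> rooks I J k - ?C"
      have e: "{G \<in> ?P. R \<subseteq> G} = {}"
      proof (rule ccontr)
        assume "{G \<in> ?P. R \<subseteq> G} \<noteq> {}"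
        then obtain G where "G \<in> rooks I J (card I)" "R \<union> R' \<subseteq> G" by auto
        from rooks_subset(1)[OF this] R show False by auto
      qed
      show "of_nat (card {G \<in> ?P. R \<subseteq> G}) * f R = 0" by (simp only: e) simp
    qed
  qed (use finite_rooks[OF assms(1,2)] in auto)
  also have "\<dots> = (\<Sum>(T, R)\<in>?S. ?w T * f (T \<union> R))"
  proof (rule sum.reindex_bij_witness[of _ "\<lambda>(T, R). T \<union> R" "\<lambda>R. (R \<inter> R', R - R')"])
    fix R assume R: "R \<in> ?C"
    then have fR: "finite R" and cR: "card R = k" by (auto simp: rooks_def)
    have "(R \<union> R') - R' \<in> rooks (I - fst ` R') (J - snd ` R') (card (R \<union> R') - card R')"
      by (rule rooks_subset(2)) (use R in auto)
    moreover have c: "card (R - R') = k - card (R \<inter> R')"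
      using card_Diff_subset_Int[of R R'] fR cR by simp
    moreover have "(R \<union> R') - R' = R - R'" by auto
    ultimately have "R - R' \<in> rooks (I - fst ` R') (J - snd ` R') (k - card (R \<inter> R'))"
      by (auto simp: rooks_def)
    moreover have le: "card (R \<inter> R') \<le> k" using cR fR card_mono[of R "R \<inter> R'"] by auto
    ultimately show "(R \<inter> R', R - R') \<in> ?S" by auto
    have "card (R \<union> R') = card (R - R') + card R'"
      using fR fR' by (metis Diff_disjoint Int_commute Un_Diff_cancel2 card_Un_disjoint finite_Diff)
    then have "card I - j - (k - card (R \<inter> R')) = card I - card (R \<union> R')"
      using c cR' by simp
    moreover have "(R \<inter> R') \<union> (R - R') = R" by auto
    ultimately show "(case (R \<inter> R', R - R') of (T, R) \<Rightarrow> ?w T * f (T \<union> R)) =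
        of_nat (fact (card I - card (R \<union> R'))) * f R" by simp
    show "(case (R \<inter> R', R - R') of (T, R) \<Rightarrow> T \<union> R) = R" by auto
  next
    fix p assume "p \<in> ?S"
    then obtain T R where p: "p = (T, R)" and T: "T \<subseteq> R'" "card T \<le> k"
      and R: "R \<in> rooks (I - fst ` R') (J - snd ` R') (k - card T)" by auto
    have 1: "R' \<union> R \<in> rooks I J (j + (k - card T))" and 2: "R' \<inter> R = {}"
      using rooks_union[OF assms(4) R] by auto
    show "(\<lambda>R. (R \<inter> R', R - R')) (case p of (T, R) \<Rightarrow> T \<union> R) = p" using p T 2 by auto
    have "T \<union> R \<in> rooks I J (card T + (k - card T))"
    proof (rule rooks_union(1))
      show "T \<in> rooks I J (card T)" using rooks_subset(1)[OF assms(4) T(1)] .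
      show "R \<in> rooks (I - fst ` T) (J - snd ` T) (k - card T)"
        using R T(1) rooks_mono[of "I - fst ` R'" "I - fst ` T" "J - snd ` R'" "J - snd ` T"] by blast
    qed
    moreover have "T \<union> R \<union> R' = R' \<union> R" using T by auto
    ultimately show "(case p of (T, R) \<Rightarrow> T \<union> R) \<in> ?C"
      using p 1 T by (auto simp: rooks_def)
  qed
  also have "\<dots> = (\<Sum>T | T \<subseteq> R' \<and> card T \<le> k. \<Sum>R\<in>rooks (I - fst ` R') (J - snd ` R') (k - card T). ?w T * f (T \<union> R))"
    by (rule sum.Sigma[symmetric]) (simp_all add: fR' finite_rooks assms(1,2))
  finally show ?thesis by (simp add: sum_distrib_left)
qed

text \<open>Two exchanges, of columns and then of rows, carry the rest of \<open>R\<close> from the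
  complement of \<open>R'\<close> into the rows and columns of \<open>R' - T\<close>. The sign
  \<open>(-1) ^ (k - card T)\<close> arises twice and cancels. The point of the move is that
  \<open>R'\<close> now bounds the room left for \<open>R\<close>.\<close>

lemma sum_extensions_balanced:
  fixes f :: "('a \<times> 'b) set \<Rightarrow> 'c::comm_ring_1"
  assumes "finite I" "finite J" "card I = card J" "R' \<in> rooks I J j"
    and "row_balanced I J k f" "col_balanced I J k f"
  shows "(\<Sum>G | G \<in> rooks I J (card I) \<and> R' \<subseteq> G. rook_lift k f G) =
     (\<Sum>T | T \<subseteq> R' \<and> card T \<le> k. of_nat (fact (card I - j - (k - card T))) *
        (\<Sum>R\<in>rooks (fst ` (R' - T)) (snd ` (R' - T)) (k - card T). f (T \<union> R)))"
  unfolding sum_extensions_rook_lift[OF assms(1-4)]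
proof (rule sum.cong[OF refl], clarify)
  fix T assume T: "T \<subseteq> R'" "card T \<le> k"
  let ?X = "I - fst ` R'" and ?Y = "J - snd ` R'" and ?a = "k - card T"
  let ?X' = "fst ` (R' - T)" and ?Y' = "snd ` (R' - T)"
  have T': "T \<in> rooks I J (card T)" using rooks_subset(1)[OF assms(4) T(1)] .
  have d: "R' - T \<in> rooks (I - fst ` T) (J - snd ` T) (j - card T)"
    using rooks_subset(2)[OF assms(4) T(1)] .
  have R': "R' \<subseteq> I \<times> J" using assms(4) by (auto simp: rooks_def)
  have X: "?X \<union> ?X' = I - fst ` T" "?X \<inter> ?X' = {}"
    using rooks_fst_subset[OF d] T(1) R' by (blast, blast)
  have Y: "?Y \<union> ?Y' = J - snd ` T" "?Y \<inter> ?Y' = {}"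
    using rooks_snd_subset[OF d] T(1) R' by (blast, blast)
  have "(\<Sum>R\<in>rooks ?X ?Y ?a. f (T \<union> R)) = (-1) ^ ?a * (\<Sum>R\<in>rooks ?X ?Y' ?a. f (T \<union> R))"
    by (rule row_balanced_exchange[OF assms(5,2) _ _ T']) (use assms(1) X Y T in auto)
  also have "(\<Sum>R\<in>rooks ?X ?Y' ?a. f (T \<union> R)) = (-1) ^ ?a * (\<Sum>R\<in>rooks ?X' ?Y' ?a. f (T \<union> R))"
    by (rule col_balanced_exchange[OF assms(6,1) _ _ T'])
      (use assms(4) X Y T rooks_snd_subset[OF d] in \<open>auto simp: rooks_def\<close>)
  finally have "(\<Sum>R\<in>rooks ?X ?Y ?a. f (T \<union> R)) = (\<Sum>R\<in>rooks ?X' ?Y' ?a. f (T \<union> R))"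
    by (simp add: mult.assoc[symmetric] power_add[symmetric])
  then show "of_nat (fact (card I - j - (k - card T))) * (\<Sum>R\<in>rooks ?X ?Y ?a. f (T \<union> R)) =
      of_nat (fact (card I - j - (k - card T))) * (\<Sum>R\<in>rooks ?X' ?Y' ?a. f (T \<union> R))" by simp
qed

text \<open>There is no room: \<open>R' - T\<close> has \<open>j - card T\<close> rows, too few for
  \<open>k - card T\<close> rooks. Thus a lift of degree \<open>k\<close> is orthogonal to the
  indicator of the extensions of any smaller placement.\<close>

lemma sum_extensions_balanced_eq_0:
  fixes f :: "('a \<times> 'b) set \<Rightarrow> 'c::comm_ring_1"
  assumes "finite I" "finite J" "card I = card J" "R' \<in> rooks I J j"
    and "row_balanced I J k f" "col_balanced I J k f" "j < k"
  shows "(\<Sum>G | G \<in> rooks I J (card I) \<and> R' \<subseteq> G. rook_lift k f G) = 0"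
  unfolding sum_extensions_balanced[OF assms(1-6)]
proof (rule sum.neutral, clarify)
  fix T assume T: "T \<subseteq> R'" "card T \<le> k"
  have f: "finite R'" "card R' = j" using assms(4) by (auto simp: rooks_def)
  have "card (fst ` (R' - T)) < k - card T"
    using f T assms(7) card_image_le[of "R' - T" fst] card_mono[OF f(1) T(1)]
    by (simp add: card_Diff_subset finite_subset)
  then have "rooks (fst ` (R' - T)) (snd ` (R' - T)) (k - card T) = {}"
    using rooks_le_left[of "fst ` (R' - T)"] f by fastforce
  then show "of_nat (fact (card I - j - (k - card T))) *
      (\<Sum>R\<in>rooks (fst ` (R' - T)) (snd ` (R' - T)) (k - card T). f (T \<union> R)) = 0" by simp
qed

text \<open>Because the weight depends only on the fibre of \<open>g\<close>, each fibre contributes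
  a multiple of a Hermitian form of rank one.\<close>

lemma sum_fibres_cnj:
  fixes h :: "'a \<Rightarrow> complex" and w :: "'b \<Rightarrow> real"
  assumes "finite X"
  shows "(\<Sum>x\<in>X. \<Sum>y | y \<in> X \<and> g y = g x. of_real (w (g x)) * (cnj (h x) * h y)) =
     of_real (\<Sum>c\<in>g ` X. w c * (cmod (\<Sum>x | x \<in> X \<and> g x = c. h x))\<^sup>2)"
proof -
  have "(\<Sum>x\<in>X. \<Sum>y | y \<in> X \<and> g y = g x. of_real (w (g x)) * (cnj (h x) * h y)) =
      (\<Sum>c\<in>g ` X. \<Sum>x | x \<in> X \<and> g x = c. \<Sum>y | y \<in> X \<and> g y = g x. of_real (w (g x)) * (cnj (h x) * h y))"
    by (rule sum.image_gen[OF assms])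
  also have "\<dots> = (\<Sum>c\<in>g ` X. of_real (w c) * ((\<Sum>x | x \<in> X \<and> g x = c. cnj (h x)) * (\<Sum>y | y \<in> X \<and> g y = c. h y)))"
  proof (rule sum.cong[OF refl])
    fix c
    have "(\<Sum>x | x \<in> X \<and> g x = c. \<Sum>y | y \<in> X \<and> g y = g x. of_real (w (g x)) * (cnj (h x) * h y)) =
        (\<Sum>x | x \<in> X \<and> g x = c. \<Sum>y | y \<in> X \<and> g y = c. of_real (w c) * (cnj (h x) * h y))"
      by (rule sum.cong) auto
    then show "(\<Sum>x | x \<in> X \<and> g x = c. \<Sum>y | y \<in> X \<and> g y = g x. of_real (w (g x)) * (cnj (h x) * h y)) =
        of_real (w c) * ((\<Sum>x | x \<in> X \<and> g x = c. cnj (h x)) * (\<Sum>y | y \<in> X \<and> g y = c. h y))"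
      unfolding sum_product by (simp add: sum_distrib_left)
  qed
  also have "\<dots> = (\<Sum>c\<in>g ` X. of_real (w c * (cmod (\<Sum>x | x \<in> X \<and> g x = c. h x))\<^sup>2))"
  proof (rule sum.cong[OF refl])
    fix c
    show "of_real (w c) * ((\<Sum>x | x \<in> X \<and> g x = c. cnj (h x)) * (\<Sum>y | y \<in> X \<and> g y = c. h y)) =
        complex_of_real (w c * (cmod (\<Sum>x | x \<in> X \<and> g x = c. h x))\<^sup>2)"
      using complex_norm_square[of "\<Sum>x | x \<in> X \<and> g x = c. h x"]
      by (simp add: mult.commute)
  qed
  finally show ?thesis by simp
qed

text \<open>Pairing \<open>sum_extensions_balanced\<close> with the conjugate of \<open>f\<close> gives a sum of squares, one for each
  triple consisting of \<open>T\<close> and of the sets of rows and columns of \<open>R' - T\<close>.\<close>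

lemma balanced_eq_0:
  fixes f :: "('a \<times> 'b) set \<Rightarrow> complex"
  assumes "finite I" "finite J" "card I = card J"
    and "row_balanced I J k f" "col_balanced I J k f"
    and 0: "\<And>R. R \<in> rooks I J k \<Longrightarrow> (\<Sum>G | G \<in> rooks I J (card I) \<and> R \<subseteq> G. rook_lift k f G) = 0"
    and R0: "R0 \<in> rooks I J k"
  shows "f R0 = 0"
proof -
  define X where "X = {(T, Z). T \<inter> Z = {} \<and> T \<union> Z \<in> rooks I J k}"
  define g where "g = (\<lambda>(T :: ('a \<times> 'b) set, Z :: ('a \<times> 'b) set). (T, fst ` Z, snd ` Z))"
  define w where "w = (\<lambda>(T :: ('a \<times> 'b) set, A :: 'a set, C :: 'b set). fact (card I - k - (k - card T)) :: real)"
  define h where "h = (\<lambda>(T, Z). f (T \<union> Z))"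
  define F where "F = (\<lambda>x y. of_real (w (g x)) * (cnj (h x) * h y))"
  have fR: "finite (rooks I J k)" using finite_rooks assms by blast
  have fX: "finite X"
    by (rule finite_subset[of _ "Pow (I \<times> J) \<times> Pow (I \<times> J)"]) (use assms in \<open>auto simp: X_def rooks_def\<close>)
  have "0 = (\<Sum>R\<in>rooks I J k. cnj (f R) * (\<Sum>G | G \<in> rooks I J (card I) \<and> R \<subseteq> G. rook_lift k f G))"
    using 0 by simp
  also have "\<dots> = (\<Sum>R\<in>rooks I J k. \<Sum>T\<in>Pow R. \<Sum>y | y \<in> X \<and> g y = g (T, R - T). F (T, R - T) y)"
  proof (rule sum.cong[OF refl])
    fix R assume R: "R \<in> rooks I J k"
    then have finR: "finite R" and cR: "card R = k" by (auto simp: rooks_def)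
    have "cnj (f R) * (\<Sum>G | G \<in> rooks I J (card I) \<and> R \<subseteq> G. rook_lift k f G) =
       (\<Sum>T | T \<subseteq> R \<and> card T \<le> k. cnj (f R) * (of_nat (fact (card I - k - (k - card T))) *
        (\<Sum>Z\<in>rooks (fst ` (R - T)) (snd ` (R - T)) (k - card T). f (T \<union> Z))))"
      unfolding sum_extensions_balanced[OF assms(1-3) R assms(4,5)] sum_distrib_left ..
    also have "\<dots> = (\<Sum>T\<in>Pow R. \<Sum>y | y \<in> X \<and> g y = g (T, R - T). F (T, R - T) y)"
    proof (rule sum.cong)
      show "{T. T \<subseteq> R \<and> card T \<le> k} = Pow R" using card_mono[OF finR] cR by auto
    next
      fix T assume "T \<in> Pow R"
      then have T: "T \<subseteq> R" by simp
      have T': "T \<in> rooks I J (card T)" and d: "R - T \<in> rooks (I - fst ` T) (J - snd ` T) (k - card T)"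
        using rooks_subset[OF R T] by auto
      have cT: "card T \<le> k" using card_mono[OF finR T] cR by simp
      \<comment> \<open>The set \<open>R - T\<close> has exactly \<open>k - card T\<close> cells, so
        a placement of that size within its rows and columns uses all of them. Such \<open>Z\<close>
        therefore make up the whole fibre of \<open>g\<close> over
        \<open>(T, R - T)\<close>.\<close>
      have "(\<Sum>y | y \<in> X \<and> g y = g (T, R - T). F (T, R - T) y) =
          (\<Sum>Z\<in>rooks (fst ` (R - T)) (snd ` (R - T)) (k - card T). F (T, R - T) (T, Z))"
      proof (rule sum.reindex_bij_witness[of _ "\<lambda>Z. (T, Z)" snd])
        fix Z assume Z: "Z \<in> rooks (fst ` (R - T)) (snd ` (R - T)) (k - card T)"
        then have "Z \<in> rooks (I - fst ` T) (J - snd ` T) (k - card T)"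
          using rooks_mono[OF rooks_fst_subset[OF d] rooks_snd_subset[OF d]] by blast
        from rooks_union[OF T' this] cT have "(T, Z) \<in> X" by (simp add: X_def)
        moreover have "fst ` Z = fst ` (R - T)"
          using Z rooks_fst_subset[OF Z] rooks_fst_card[OF Z] rooks_fst_card[OF d] finR
          by (intro card_subset_eq) auto
        moreover have "snd ` Z = snd ` (R - T)"
          using Z rooks_snd_subset[OF Z] rooks_snd_card[OF Z] rooks_snd_card[OF d] finR
          by (intro card_subset_eq) auto
        ultimately show "(T, Z) \<in> {y. y \<in> X \<and> g y = g (T, R - T)}" by (simp add: g_def)
      next
        fix y assume y: "y \<in> {y. y \<in> X \<and> g y = g (T, R - T)}"
        then obtain Z where Z: "y = (T, Z)" "fst ` Z = fst ` (R - T)" "snd ` Z = snd ` (R - T)"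
          "T \<inter> Z = {}" "T \<union> Z \<in> rooks I J k" by (auto simp: g_def X_def split: prod.splits)
        have "(T \<union> Z) - T \<in> rooks (I - fst ` T) (J - snd ` T) (k - card T)"
          by (rule rooks_subset(2)[OF Z(5)]) auto
        moreover have "(T \<union> Z) - T = Z" using Z(4) by auto
        ultimately have "Z \<in> rooks (fst ` Z) (snd ` Z) (k - card T)"
          by (simp add: rooks_def subset_fst_snd)
        then show "snd y \<in> rooks (fst ` (R - T)) (snd ` (R - T)) (k - card T)" using Z by simp
        show "(T, snd y) = y" using Z by simp
        then show "F (T, R - T) (T, snd y) = F (T, R - T) y" by simp
      qed simp
      also have "\<dots> = cnj (f R) * (of_nat (fact (card I - k - (k - card T))) *
        (\<Sum>Z\<in>rooks (fst ` (R - T)) (snd ` (R - T)) (k - card T). f (T \<union> Z)))"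
        by (simp add: F_def w_def g_def h_def Un_absorb1[OF T] sum_distrib_left mult_ac)
      finally show "cnj (f R) * (of_nat (fact (card I - k - (k - card T))) *
        (\<Sum>Z\<in>rooks (fst ` (R - T)) (snd ` (R - T)) (k - card T). f (T \<union> Z))) =
        (\<Sum>y | y \<in> X \<and> g y = g (T, R - T). F (T, R - T) y)" ..
    qed
    finally show "cnj (f R) * (\<Sum>G | G \<in> rooks I J (card I) \<and> R \<subseteq> G. rook_lift k f G) =
      (\<Sum>T\<in>Pow R. \<Sum>y | y \<in> X \<and> g y = g (T, R - T). F (T, R - T) y)" .
  qed
  also have "\<dots> = (\<Sum>(R, T)\<in>(SIGMA R:rooks I J k. Pow R). \<Sum>y | y \<in> X \<and> g y = g (T, R - T). F (T, R - T) y)"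
    by (rule sum.Sigma) (use fR in \<open>auto simp: rooks_def\<close>)
  also have "\<dots> = (\<Sum>x\<in>X. \<Sum>y | y \<in> X \<and> g y = g x. F x y)"
    by (rule sum.reindex_bij_witness[of _ "\<lambda>(T, Z). (T \<union> Z, T)" "\<lambda>(R, T). (T, R - T)"])
      (auto simp: X_def Un_absorb1)
  also have "\<dots> = of_real (\<Sum>c\<in>g ` X. w c * (cmod (\<Sum>x | x \<in> X \<and> g x = c. h x))\<^sup>2)"
    unfolding F_def by (rule sum_fibres_cnj[OF fX])
  finally have "complex_of_real (\<Sum>c\<in>g ` X. w c * (cmod (\<Sum>x | x \<in> X \<and> g x = c. h x))\<^sup>2) = 0"
    by (rule sym)
  then have sum0: "(\<Sum>c\<in>g ` X. w c * (cmod (\<Sum>x | x \<in> X \<and> g x = c. h x))\<^sup>2) = 0"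
    by (simp only: of_real_eq_0_iff)
  have nonneg: "w c * (cmod (\<Sum>x | x \<in> X \<and> g x = c. h x))\<^sup>2 \<ge> 0" for c
    by (cases c) (simp add: w_def)
  \<comment> \<open>The choice \<open>T = R0\<close>, \<open>Z = {}\<close> has a fibre with one
    element, so its square is that of the modulus of \<open>f R0\<close>; its weight
    \<open>fact (card I - k)\<close> is positive.\<close>
  have in_X: "(R0, {}) \<in> X" using R0 by (simp add: X_def)
  have "w (g (R0, {})) * (cmod (\<Sum>x | x \<in> X \<and> g x = g (R0, {}). h x))\<^sup>2 = 0"
    by (rule sum_nonneg_0[OF finite_imageI[OF fX] nonneg sum0 imageI[OF in_X]])
  moreover have "{x. x \<in> X \<and> g x = g (R0, {})} = {(R0, {})}"
    using in_X by (auto simp: g_def)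
  moreover have "w (g (R0, {})) \<noteq> 0" by (simp add: w_def g_def)
  ultimately show ?thesis by (simp add: h_def)
qed

text \<open>Induction on the degree. Summing the relation over the extensions of a placement of size
  \<open>k\<close> kills the terms of larger degree for want of room, and those of smaller degree
  vanish by induction, so that \<open>balanced_eq_0\<close> applies to \<open>f k\<close>
  alone.\<close>

lemma balanced_lift_sum_eq_0:
  fixes f :: "nat \<Rightarrow> ('a \<times> 'b) set \<Rightarrow> complex"
  assumes "finite I" "finite J" "card I = card J" "finite D"
    and "\<And>k. k \<in> D \<Longrightarrow> row_balanced I J k (f k)" "\<And>k. k \<in> D \<Longrightarrow> col_balanced I J k (f k)"
    and 0: "\<And>G. G \<in> rooks I J (card I) \<Longrightarrow> (\<Sum>k\<in>D. rook_lift k (f k) G) = 0"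
  shows "k \<in> D \<Longrightarrow> R \<in> rooks I J k \<Longrightarrow> f k R = 0"
proof (induction k arbitrary: R rule: less_induct)
  case (less k)
  have "(\<Sum>G | G \<in> rooks I J (card I) \<and> S \<subseteq> G. rook_lift k (f k) G) = 0" if S: "S \<in> rooks I J k" for S
  proof -
    have "(\<Sum>G | G \<in> rooks I J (card I) \<and> S \<subseteq> G. rook_lift l (f l) G) = 0" if l: "l \<in> D" "l \<noteq> k" for l
    proof (cases "k < l")
      case True
      then show ?thesis using sum_extensions_balanced_eq_0[OF assms(1-3) S assms(5,6)] l by blast
    next
      case False
      then have "l < k" using l by simp
      have "rook_lift l (f l) G = 0" if "G \<in> rooks I J (card I)" for G
        unfolding rook_lift_def
        by (rule sum.neutral) (use rooks_subset(1)[OF that] less.IH[OF \<open>l < k\<close> l(1)] in auto)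
      then show ?thesis by (auto intro: sum.neutral)
    qed
    then have "(\<Sum>l\<in>D - {k}. \<Sum>G | G \<in> rooks I J (card I) \<and> S \<subseteq> G. rook_lift l (f l) G) = 0"
      by (auto intro: sum.neutral)
    moreover have "(\<Sum>l\<in>D. \<Sum>G | G \<in> rooks I J (card I) \<and> S \<subseteq> G. rook_lift l (f l) G) = 0"
      by (subst sum.swap) (auto intro: sum.neutral 0)
    ultimately show ?thesis using sum.remove[OF assms(4) less.prems(1), of "\<lambda>l. \<Sum>G | G \<in> rooks I J (card I) \<and> S \<subseteq> G. rook_lift l (f l) G"]
      by simp
  qed
  from balanced_eq_0[OF assms(1-3) assms(5)[OF less.prems(1)] assms(6)[OF less.prems(1)] this less.prems(2)]
  show ?case .
qed

section \<open>Increasing subsequences and alternants\<close>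

lemma homogeneous_system_nontrivial:
  fixes M :: "'i \<Rightarrow> 'e \<Rightarrow> 'f::field"
  assumes "finite E" "finite A" "card E < card A"
  shows "\<exists>x. (\<exists>a\<in>A. x a \<noteq> 0) \<and> (\<forall>e\<in>E. (\<Sum>a\<in>A. x a * M a e) = 0)"
  using assms
proof (induction E arbitrary: A M rule: finite_induct)
  case empty
  then obtain a where "a \<in> A" by (metis card.empty equals0I less_irrefl)
  then show ?case by (intro exI[of _ "\<lambda>_. 1"]) auto
next
  case (insert e E)
  show ?case
  proof (cases "\<forall>a\<in>A. M a e = 0")
    case True
    from insert.IH[of A M] insert.prems insert.hyps obtain x where
      "\<exists>a\<in>A. x a \<noteq> 0" "\<forall>e\<in>E. (\<Sum>a\<in>A. x a * M a e) = 0" by auto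
    then show ?thesis using True by (intro exI[of _ x]) auto
  next
    case False
    then obtain b where b: "b \<in> A" "M b e \<noteq> 0" by auto
    \<comment> \<open>The unknown \<open>b\<close> is eliminated by means of the equation
      \<open>e\<close>; the definition of \<open>y\<close> below restores its value.\<close>
    let ?N = "\<lambda>a d. M a d - M a e / M b e * M b d"
    have "card E < card (A - {b})" using insert.prems insert.hyps b by simp
    then obtain x where x: "\<exists>a\<in>A - {b}. x a \<noteq> 0" "\<And>d. d \<in> E \<Longrightarrow> (\<Sum>a\<in>A - {b}. x a * ?N a d) = 0"
      using insert.IH[of "A - {b}" ?N] insert.prems by auto
    define y where "y = x (b := - (\<Sum>a\<in>A - {b}. x a * M a e) / M b e)"
    have y: "(\<Sum>a\<in>A. y a * M a d) = (\<Sum>a\<in>A - {b}. x a * M a d) -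
        (\<Sum>a\<in>A - {b}. x a * M a e) / M b e * M b d" for d
    proof -
      have "(\<Sum>a\<in>A. y a * M a d) = y b * M b d + (\<Sum>a\<in>A - {b}. y a * M a d)"
        by (rule sum.remove) (use insert.prems b in auto)
      also have "(\<Sum>a\<in>A - {b}. y a * M a d) = (\<Sum>a\<in>A - {b}. x a * M a d)"
        by (rule sum.cong) (auto simp: y_def)
      finally show ?thesis by (simp add: y_def)
    qed
    have "(\<Sum>a\<in>A. y a * M a d) = 0" if "d \<in> insert e E" for d
    proof (cases "d = e")
      case True
      then show ?thesis using y[of e] b by simp
    next
      case False
      have "(\<Sum>a\<in>A - {b}. x a * ?N a d) = (\<Sum>a\<in>A. y a * M a d)"
        unfolding y by (simp add: right_diff_distrib sum_subtractf sum_distrib_right sum_divide_distrib mult.assoc)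
      then show ?thesis using x(2)[of d] that False by simp
    qed
    moreover have "\<exists>a\<in>A. y a \<noteq> 0" using x(1) by (auto simp: y_def)
    ultimately show ?thesis by blast
  qed
qed

text \<open>Among the indices with nonzero coefficient take a maximal one \<open>m\<close>. In the
  equation of \<open>m\<close> every other term vanishes, since its index would have to lie above
  \<open>m\<close>.\<close>

lemma triangular_trivial_kernel:
  fixes M :: "'i \<Rightarrow> 'i \<Rightarrow> 'f::idom" and lt :: "'i \<Rightarrow> 'i \<Rightarrow> bool"
  assumes "finite A" "asymp_on A lt" "transp_on A lt"
    and diag: "\<And>a. a \<in> A \<Longrightarrow> M a a \<noteq> 0"
    and tri: "\<And>a b. a \<in> A \<Longrightarrow> b \<in> A \<Longrightarrow> M a b \<noteq> 0 \<Longrightarrow> a = b \<or> lt b a"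
    and 0: "\<And>b. b \<in> A \<Longrightarrow> (\<Sum>a\<in>A. x a * M a b) = 0"
    and "a \<in> A"
  shows "x a = 0"
proof (rule ccontr)
  assume "x a \<noteq> 0"
  let ?B = "{a \<in> A. x a \<noteq> 0}"
  have fB: "finite ?B" "?B \<noteq> {}" using assms(1,7) \<open>x a \<noteq> 0\<close> by auto
  have "asymp_on ?B lt" "transp_on ?B lt"
    using assms(2,3) by (auto intro: asymp_on_subset transp_on_subset)
  then obtain m where m: "m \<in> ?B" "\<forall>c\<in>?B. c \<noteq> m \<longrightarrow> \<not> lt m c"
    using Finite_Set.bex_max_element[of ?B lt] fB by auto
  have "(\<Sum>a\<in>A. x a * M a m) = (\<Sum>a\<in>{m}. x a * M a m)"
  proof (rule sum.mono_neutral_right)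
    show "\<forall>c\<in>A - {m}. x c * M c m = 0"
    proof
      fix c assume c: "c \<in> A - {m}"
      then have "x c = 0 \<or> \<not> lt m c" using m(2) by auto
      then show "x c * M c m = 0" using tri[of c m] c m(1) by auto
    qed
  qed (use assms(1) m in auto)
  moreover have "(\<Sum>a\<in>A. x a * M a m) = 0" using 0 m(1) by blast
  ultimately show False using diag[of m] m(1) by simp
qed

section \<open>Increasing subsequences and the lexicographic order\<close>

definition increasing :: "(nat \<times> nat) set \<Rightarrow> bool" where
  "increasing L \<longleftrightarrow> (\<forall>(i, j)\<in>L. \<forall>(i', j')\<in>L. i < i' \<longrightarrow> j < j')"

lemma lis_eq: "lis C = Max {card L | L. L \<subseteq> C \<and> increasing L}"
  unfolding lis_def increasing_def ..

lemma lis_cards: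
  assumes "finite C"
  shows "finite {card L | L. L \<subseteq> C \<and> increasing L}" "{card L | L. L \<subseteq> C \<and> increasing L} \<noteq> {}"
proof -
  show "finite {card L | L. L \<subseteq> C \<and> increasing L}"
    by (rule finite_subset[of _ "card ` Pow C"]) (use assms in auto)
  have "increasing {}" by (simp add: increasing_def)
  then show "{card L | L. L \<subseteq> C \<and> increasing L} \<noteq> {}" by blast
qed

lemma lis_ge: "finite C \<Longrightarrow> L \<subseteq> C \<Longrightarrow> increasing L \<Longrightarrow> card L \<le> lis C"
  unfolding lis_eq by (rule Max_ge[OF lis_cards(1)]) auto

lemma lis_attained: "finite C \<Longrightarrow> \<exists>L\<subseteq>C. increasing L \<and> card L = lis C"
  unfolding lis_eq using Max_in[OF lis_cards, of C] by auto

text \<open>A fixed choice among possibly several longest increasing subsequences; the monomial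
  basis depends on it, the degrees of its elements do not.\<close>

definition longest_increasing :: "(nat \<times> nat) set \<Rightarrow> (nat \<times> nat) set" where
  "longest_increasing C = (SOME L. L \<subseteq> C \<and> increasing L \<and> card L = lis C)"

definition residual :: "(nat \<times> nat) set \<Rightarrow> (nat \<times> nat) set" where
  "residual C = C - longest_increasing C"

lemma longest_increasing:
  assumes "finite C"
  shows "longest_increasing C \<subseteq> C" "increasing (longest_increasing C)" "card (longest_increasing C) = lis C"
  using someI_ex[of "\<lambda>L. L \<subseteq> C \<and> increasing L \<and> card L = lis C"] lis_attained[OF assms]
  unfolding longest_increasing_def by auto

lemma lis_le_card: "finite C \<Longrightarrow> lis C \<le> card C"
  using longest_increasing(1,3)[of C] card_mono[of C "longest_increasing C"] by simp

lemma lis_pos: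
  assumes "finite C" "C \<noteq> {}"
  shows "lis C > 0"
proof -
  obtain c where "c \<in> C" using assms by auto
  moreover have "increasing {c}" by (cases c) (simp add: increasing_def)
  ultimately have "card {c} \<le> lis C" using assms by (intro lis_ge) auto
  then show ?thesis by simp
qed

lemma residual_rooks:
  assumes "G \<in> rooks I J m"
  shows "residual G \<in> rooks I J (m - lis G)"
proof -
  have f: "finite G" "card G = m" using assms by (auto simp: rooks_def)
  have "card (residual G) = m - lis G"
    using longest_increasing[OF f(1)] f by (simp add: residual_def card_Diff_subset finite_subset)
  then show ?thesis using rooks_subset(1)[OF assms, of "residual G"] by (simp add: residual_def)
qed

text \<open>For perfect placements, read as the words of their columns from row to row, this is the
  lexicographic order: the words are compared in the first row where they differ.\<close>

definition lex_less :: "(nat \<times> nat) set \<Rightarrow> (nat \<times> nat) set \<Rightarrow> bool" where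
  "lex_less G H \<longleftrightarrow> (\<exists>i j j'. (i, j) \<in> G \<and> (i, j') \<in> H \<and> j < j' \<and>
     (\<forall>i'<i. \<forall>l. (i', l) \<in> G \<longleftrightarrow> (i', l) \<in> H))"

lemma rooks_unique_col: "G \<in> rooks I J m \<Longrightarrow> (i, j) \<in> G \<Longrightarrow> (i, j') \<in> G \<Longrightarrow> j = j'"
  by (force simp: rooks_def inj_on_def)

lemma rooks_unique_row: "G \<in> rooks I J m \<Longrightarrow> (i, j) \<in> G \<Longrightarrow> (i', j) \<in> G \<Longrightarrow> i = i'"
  by (force simp: rooks_def inj_on_def)

lemma lex_less_trans:
  assumes "H \<in> rooks I J m" "lex_less G H" "lex_less H K"
  shows "lex_less G K"
proof -
  obtain i j j' where G: "(i, j) \<in> G" "(i, j') \<in> H" "j < j'"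
    and GH: "\<And>i' l. i' < i \<Longrightarrow> (i', l) \<in> G \<longleftrightarrow> (i', l) \<in> H"
    using assms(2) unfolding lex_less_def by blast
  obtain u v v' where H: "(u, v) \<in> H" "(u, v') \<in> K" "v < v'"
    and HK: "\<And>i' l. i' < u \<Longrightarrow> (i', l) \<in> H \<longleftrightarrow> (i', l) \<in> K"
    using assms(3) unfolding lex_less_def by blast
  consider (lt) "i < u" | (eq) "i = u" | (gt) "u < i" by linarith
  then show ?thesis
  proof cases
    case lt
    then show ?thesis unfolding lex_less_def
      by (intro exI[of _ i] exI[of _ j] exI[of _ j']) (simp add: G HK[symmetric] GH)
  next
    case eq
    then have "j' = v" using rooks_unique_col[OF assms(1)] G(2) H(1) by simp
    then show ?thesis unfolding lex_less_def using G H eq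
      by (intro exI[of _ i] exI[of _ j] exI[of _ v']) (simp add: HK[symmetric] GH)
  next
    case gt
    then show ?thesis unfolding lex_less_def using H
      by (intro exI[of _ u] exI[of _ v] exI[of _ v']) (simp add: HK[symmetric] GH)
  qed
qed

lemma lex_less_irrefl: "G \<in> rooks I J m \<Longrightarrow> \<not> lex_less G G"
  unfolding lex_less_def by (auto dest: rooks_unique_col)

lemma perfect_rooks_images:
  assumes "finite I" "finite J" "card I = card J" "G \<in> rooks I J (card I)"
  shows "fst ` G = I" "snd ` G = J"
  using card_subset_eq[OF assms(1) rooks_fst_subset[OF assms(4)]] rooks_fst_card[OF assms(4)]
    card_subset_eq[OF assms(2) rooks_snd_subset[OF assms(4)]] rooks_snd_card[OF assms(4)] assms(3) by auto

text \<open>\<open>H\<close> keeps the cells outside \<open>L\<close> and refills the rows and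
  columns of \<open>L\<close>, and the increasing filling is the least. In the first row where the
  two differ, the column used by \<open>H\<close> belongs in \<open>G\<close> to a later cell of
  \<open>L\<close>, hence lies further to the right.\<close>

lemma lex_less_of_increasing:
  assumes fin: "finite I" "finite J" "card I = card J"
    and G: "G \<in> rooks I J (card I)" and H: "H \<in> rooks I J (card I)"
    and L: "L \<subseteq> G" "increasing L" "G - L \<subseteq> H" "H \<noteq> G"
  shows "lex_less G H"
proof -
  note rowG = perfect_rooks_images(1)[OF fin G] and rowH = perfect_rooks_images(1)[OF fin H]
  note colG = perfect_rooks_images(2)[OF fin G]
  have "\<not> G \<subseteq> H"
    using G H L(4) card_subset_eq[of H G] by (auto simp: rooks_def)
  then have "\<exists>i. \<exists>j. (i, j) \<in> G \<and> (i, j) \<notin> H" by auto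
  then obtain i where i: "\<exists>j. (i, j) \<in> G \<and> (i, j) \<notin> H"
    and min: "\<And>i'. i' < i \<Longrightarrow> \<not> (\<exists>j. (i', j) \<in> G \<and> (i', j) \<notin> H)"
    using exists_least_iff[of "\<lambda>i. \<exists>j. (i, j) \<in> G \<and> (i, j) \<notin> H"] by auto
  from i obtain j where j: "(i, j) \<in> G" "(i, j) \<notin> H" by auto
  have same: "(i', l) \<in> G \<longleftrightarrow> (i', l) \<in> H" if "i' < i" for i' l
  proof
    assume "(i', l) \<in> H"
    moreover from this obtain l' where "(i', l') \<in> G" using rowG rowH by force
    ultimately show "(i', l) \<in> G" using min[OF that] rooks_unique_col[OF H] by metis
  qed (use min[OF that] in auto)
  have "i \<in> I" using j rowG by force
  then obtain j' where j': "(i, j') \<in> H" using rowH by force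
  have "j' \<in> J" using j' H by (auto simp: rooks_def)
  \<comment> \<open>Row \<open>i'\<close> is where \<open>G\<close> uses the column
    \<open>j'\<close>. It cannot precede \<open>i\<close>, because \<open>G\<close> and
    \<open>H\<close> agree there while \<open>H\<close> uses \<open>j'\<close> in row
    \<open>i\<close>.\<close>
  then obtain i' where i': "(i', j') \<in> G" using colG by force
  have "i' \<noteq> i" using i' j j' rooks_unique_col[OF G] by metis
  moreover have "\<not> i' < i"
    using same i' j' rooks_unique_row[OF H] by (metis less_irrefl)
  ultimately have "i < i'" by simp
  moreover have "(i', j') \<in> L"
    using L(3) i' j' \<open>i' \<noteq> i\<close> rooks_unique_row[OF H] by blast
  moreover have "(i, j) \<in> L" using L(3) j by blast
  ultimately have "j < j'" using L(2) by (auto simp: increasing_def)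
  then show ?thesis unfolding lex_less_def using j j' same by blast
qed

section \<open>Levels of rows and alternating sums\<close>

text \<open>For a rook placement this is the length of a longest increasing subsequence ending at
  the rook of row \<open>i\<close>, the pile number of patience sorting. A row without a rook has
  level 0.\<close>

definition row_level :: "(nat \<times> nat) set \<Rightarrow> nat \<Rightarrow> nat" where
  "row_level G i = lis {(a, b) \<in> G. \<exists>j. (i, j) \<in> G \<and> a \<le> i \<and> b \<le> j}"

lemma row_level_le: "finite G \<Longrightarrow> row_level G i \<le> lis G"
proof -
  assume f: "finite G"
  let ?D = "{(a, b) \<in> G. \<exists>j. (i, j) \<in> G \<and> a \<le> i \<and> b \<le> j}"
  have "finite ?D" using f by (rule rev_finite_subset) auto
  then obtain L where "L \<subseteq> ?D" "increasing L" "card L = lis ?D" using lis_attained by blast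
  moreover from this have "L \<subseteq> G" by auto
  ultimately show ?thesis using lis_ge[OF f, of L] by (simp add: row_level_def)
qed

lemma row_level_pos: "finite G \<Longrightarrow> i \<in> fst ` G \<Longrightarrow> 0 < row_level G i"
proof -
  assume f: "finite G" and "i \<in> fst ` G"
  then obtain j where "(i, j) \<in> G" by force
  then have "(i, j) \<in> {(a, b) \<in> G. \<exists>j. (i, j) \<in> G \<and> a \<le> i \<and> b \<le> j}" by auto
  moreover have "finite {(a, b) \<in> G. \<exists>j. (i, j) \<in> G \<and> a \<le> i \<and> b \<le> j}"
    using f by (rule rev_finite_subset) auto
  ultimately show "0 < row_level G i" unfolding row_level_def by (intro lis_pos) auto
qed

text \<open>A longest subsequence up to \<open>(i, j)\<close> can be prolonged by
  \<open>(i', j')\<close>. Hence the cells of one level form a decreasing sequence.\<close>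

lemma row_level_less:
  assumes G: "G \<in> rooks I J m" and p: "(i, j) \<in> G" "(i', j') \<in> G" "i < i'" "j < j'"
  shows "row_level G i < row_level G i'"
proof -
  have f: "finite G" using G by (auto simp: rooks_def)
  let ?D = "\<lambda>i. {(a, b) \<in> G. \<exists>j. (i, j) \<in> G \<and> a \<le> i \<and> b \<le> j}"
  have fD: "finite (?D i)" for i using f by (rule rev_finite_subset) auto
  obtain L where L: "L \<subseteq> ?D i" "increasing L" "card L = lis (?D i)" using lis_attained[OF fD] by blast
  have bd: "a \<le> i \<and> b \<le> j" if "(a, b) \<in> L" for a b
    using L(1) that rooks_unique_col[OF G p(1)] by auto
  have "insert (i', j') L \<subseteq> ?D i'"
    using L(1) bd p by fastforce
  moreover have "increasing (insert (i', j') L)"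
    using L(2) bd p unfolding increasing_def by fastforce
  ultimately have "card (insert (i', j') L) \<le> lis (?D i')" by (rule lis_ge[OF fD])
  moreover have "(i', j') \<notin> L" using bd p by fastforce
  moreover have "finite L" using L(1) fD finite_subset by blast
  ultimately show ?thesis using L(3) by (simp add: row_level_def)
qed

definition level_perms :: "(nat \<times> nat) set \<Rightarrow> (nat \<Rightarrow> nat) set" where
  "level_perms G = {\<pi>. \<pi> permutes fst ` G \<and> (\<forall>i. row_level G (\<pi> i) = row_level G i)}"

text \<open>For perfect \<open>R\<close> these are, up to ordering conventions, the coefficients of
  the product of the minors on the rows and columns of the level classes of \<open>G\<close>; for
  smaller \<open>R\<close> the coefficients of all perfect completions are added up.\<close>

definition alternant :: "(nat \<times> nat) set \<Rightarrow> (nat \<times> nat) set \<Rightarrow> complex" where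
  "alternant G R = (\<Sum>\<pi>\<in>level_perms G. of_int (sign \<pi>) * of_bool (\<forall>(i, j)\<in>R. (\<pi> i, j) \<in> G))"

lemma finite_level_perms: "finite G \<Longrightarrow> finite (level_perms G)"
  unfolding level_perms_def by (rule finite_subset[OF _ finite_permutations[of "fst ` G"]]) auto

text \<open>Composing with the transposition of two rows of one level that \<open>T\<close> does not
  meet reverses every sign and leaves the condition on \<open>T\<close> unchanged.\<close>

lemma alternant_eq_0:
  assumes "finite G" "a \<in> fst ` G" "b \<in> fst ` G" "a \<noteq> b" "row_level G a = row_level G b"
    and "a \<notin> fst ` T" "b \<notin> fst ` T"
  shows "alternant G T = 0"
proof -
  let ?t = "transpose a b"
  let ?f = "\<lambda>\<pi>. of_int (sign \<pi>) * of_bool (\<forall>(i, j)\<in>T. (\<pi> i, j) \<in> G) :: complex"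
  have t: "?t permutes fst ` G" using assms by (intro permutes_swap_id) auto
  have lev: "row_level G (?t i) = row_level G i" for i
    using assms(5) by (auto simp: transpose_def)
  have fix_T: "?t i = i" if "(i, j) \<in> T" for i j
    using that assms(6,7) by (force simp: transpose_def)
  have in_perms: "\<pi> \<circ> ?t \<in> level_perms G" if "\<pi> \<in> level_perms G" for \<pi>
    using that permutes_compose[OF t] lev by (auto simp: level_perms_def)
  have "?f (\<pi> \<circ> ?t) = - ?f \<pi>" if "\<pi> \<in> level_perms G" for \<pi>
  proof -
    have "permutation \<pi>" using that assms(1) by (auto simp: level_perms_def intro: permutes_imp_permutation)
    then have "sign (\<pi> \<circ> ?t) = - sign \<pi>"
      using assms(4) by (simp add: sign_compose permutation_swap_id sign_swap_id)
    moreover have "(\<forall>(i, j)\<in>T. ((\<pi> \<circ> ?t) i, j) \<in> G) \<longleftrightarrow> (\<forall>(i, j)\<in>T. (\<pi> i, j) \<in> G)"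
      using fix_T by fastforce
    ultimately show ?thesis by simp
  qed
  moreover have "(\<Sum>\<pi>\<in>level_perms G. ?f (\<pi> \<circ> ?t)) = (\<Sum>\<pi>\<in>level_perms G. ?f \<pi>)"
    by (rule sum.reindex_bij_witness[of _ "\<lambda>\<pi>. \<pi> \<circ> ?t" "\<lambda>\<pi>. \<pi> \<circ> ?t"])
      (auto simp: in_perms comp_assoc)
  ultimately have "alternant G T = - alternant G T"
    unfolding alternant_def by (simp add: sum_negf)
  then show ?thesis by simp
qed

text \<open>The rows missed by \<open>T\<close> outnumber the levels, which lie in
  \<open>{1..lis G}\<close>, so two of them share a level.\<close>

lemma alternant_eq_0_of_card:
  assumes G: "G \<in> rooks I J (card I)" and fin: "finite I" "finite J" "card I = card J"
    and T: "T \<in> rooks I J t" "t + lis G < card I"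
  shows "alternant G T = 0"
proof -
  have f: "finite G" using G by (auto simp: rooks_def)
  have I: "fst ` G = I" using perfect_rooks_images[OF fin G] by simp
  have "card (I - fst ` T) = card I - t"
    using rooks_fst_card[OF T(1)] rooks_fst_subset[OF T(1)] fin(1)
    by (simp add: card_Diff_subset finite_subset)
  moreover have "row_level G ` (I - fst ` T) \<subseteq> {1..lis G}"
    using row_level_le[OF f] row_level_pos[OF f] I by (fastforce simp: Suc_le_eq)
  then have "card (row_level G ` (I - fst ` T)) \<le> lis G"
    using card_mono[of "{1..lis G}"] by fastforce
  ultimately have "\<not> inj_on (row_level G) (I - fst ` T)"
    using T(2) by (intro pigeonhole) simp
  then show ?thesis
    using alternant_eq_0[OF f] I unfolding inj_on_def by blast
qed

text \<open>For each \<open>\<pi>\<close> carrying \<open>T\<close> into \<open>G\<close> exactly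
  one column completes row \<open>i\<close>, and \<open>T\<close> does not yet use it; the row sum
  collapses to \<open>alternant G T\<close>. With only \<open>k - 1\<close> rooks, \<open>T\<close>
  is too small for this to be nonzero.\<close>

lemma alternant_row_balanced:
  assumes G: "G \<in> rooks I J (card I)" and fin: "finite I" "finite J" "card I = card J"
    and k: "k + lis G = card I"
  shows "row_balanced I J k (alternant G)"
  unfolding row_balanced_def
proof (intro allI impI)
  fix t T i assume T: "T \<in> rooks I J t" "Suc t = k" "i \<in> I - fst ` T"
  have I: "fst ` G = I" using perfect_rooks_images[OF fin G] by simp
  have "(\<Sum>j\<in>J - snd ` T. alternant G (insert (i, j) T)) =
      (\<Sum>\<pi>\<in>level_perms G. \<Sum>j\<in>J - snd ` T. of_int (sign \<pi>) * of_bool (\<forall>(i, j)\<in>insert (i, j) T. (\<pi> i, j) \<in> G))"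
    unfolding alternant_def by (rule sum.swap)
  also have "\<dots> = alternant G T"
    unfolding alternant_def
  proof (rule sum.cong[OF refl])
    fix \<pi> assume "\<pi> \<in> level_perms G"
    then have pi: "\<pi> permutes I" by (simp add: level_perms_def I)
    then have "\<pi> i \<in> I" using T(3) permutes_in_image by fastforce
    then obtain j0 where j0: "(\<pi> i, j0) \<in> G" using I by force
    show "(\<Sum>j\<in>J - snd ` T. of_int (sign \<pi>) * of_bool (\<forall>(i, j)\<in>insert (i, j) T. (\<pi> i, j) \<in> G)) =
        (of_int (sign \<pi>) * of_bool (\<forall>(i, j)\<in>T. (\<pi> i, j) \<in> G) :: complex)"
    proof (cases "\<forall>(i, j)\<in>T. (\<pi> i, j) \<in> G")
      case True
      have "j0 \<notin> snd ` T"
      proof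
        assume "j0 \<in> snd ` T"
        then obtain i' where i': "(i', j0) \<in> T" by force
        then have "(\<pi> i', j0) \<in> G" using True by auto
        then have "\<pi> i' = \<pi> i" using rooks_unique_row[OF G _ j0] by blast
        then have "i' = i" using permutes_inj[OF pi] by (simp add: inj_eq)
        then show False using i' T(3) by force
      qed
      then have j0_mem: "j0 \<in> J - snd ` T" using j0 G by (auto simp: rooks_def)
      have iff: "(\<pi> i, j) \<in> G \<longleftrightarrow> j = j0" for j
        using j0 by (auto intro: rooks_unique_col[OF G _ j0])
      have e: "(\<forall>(i, j)\<in>insert (i, j) T. (\<pi> i, j) \<in> G) \<longleftrightarrow> j = j0" for j
      proof
        assume "\<forall>(i, j)\<in>insert (i, j) T. (\<pi> i, j) \<in> G"
        then have "(\<pi> i, j) \<in> G" by simp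
        then show "j = j0" by (simp only: iff)
      next
        assume "j = j0"
        then have "(\<pi> i, j) \<in> G" by (simp only: iff)
        then show "\<forall>(i, j)\<in>insert (i, j) T. (\<pi> i, j) \<in> G" using True by simp
      qed
      have "(\<Sum>j\<in>J - snd ` T. of_int (sign \<pi>) * of_bool (\<forall>(i, j)\<in>insert (i, j) T. (\<pi> i, j) \<in> G)) =
          (\<Sum>j\<in>J - snd ` T. if j = j0 then of_int (sign \<pi>) else (0 :: complex))"
        by (rule sum.cong[OF refl]) (simp only: e, simp)
      also have "\<dots> = of_int (sign \<pi>) * of_bool (\<forall>(i, j)\<in>T. (\<pi> i, j) \<in> G)"
        using j0_mem fin(2) True by (simp add: sum.delta)
      finally show ?thesis .
    next
      case False
      then have "(\<forall>(i, j)\<in>insert (i, j) T. (\<pi> i, j) \<in> G) = False" for i j by auto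
      then show ?thesis using False by (simp only: of_bool_eq mult_zero_right sum.neutral_const)
    qed
  qed
  also have "\<dots> = 0"
    by (rule alternant_eq_0_of_card[OF G fin T(1)]) (use T(2) k in simp)
  finally show "(\<Sum>j\<in>J - snd ` T. alternant G (insert (i, j) T)) = 0" .
qed

text \<open>Since alternants permute rows only, this is not the row case with the coordinates
  swapped. The unique completing row is the preimage under \<open>\<pi>\<close> of the row in which
  \<open>G\<close> meets column \<open>j\<close>.\<close>

lemma alternant_col_balanced:
  assumes G: "G \<in> rooks I J (card I)" and fin: "finite I" "finite J" "card I = card J"
    and k: "k + lis G = card I"
  shows "col_balanced I J k (alternant G)"
  unfolding col_balanced_def
proof (intro allI impI)
  fix t T j assume T: "T \<in> rooks I J t" "Suc t = k" "j \<in> J - snd ` T"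
  have I: "fst ` G = I" and J: "snd ` G = J" using perfect_rooks_images[OF fin G] by auto
  have "(\<Sum>i\<in>I - fst ` T. alternant G (insert (i, j) T)) =
      (\<Sum>\<pi>\<in>level_perms G. \<Sum>i\<in>I - fst ` T. of_int (sign \<pi>) * of_bool (\<forall>(i, j)\<in>insert (i, j) T. (\<pi> i, j) \<in> G))"
    unfolding alternant_def by (rule sum.swap)
  also have "\<dots> = alternant G T"
    unfolding alternant_def
  proof (rule sum.cong[OF refl])
    fix \<pi> assume "\<pi> \<in> level_perms G"
    then have pi: "\<pi> permutes I" by (simp add: level_perms_def I)
    obtain i1 where i1: "(i1, j) \<in> G" using J T(3) by force
    then have "i1 \<in> I" using I by force
    then have "i1 \<in> \<pi> ` I" by (simp only: permutes_image[OF pi])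
    then obtain i0 where i0: "i0 \<in> I" "\<pi> i0 = i1" by auto
    show "(\<Sum>i\<in>I - fst ` T. of_int (sign \<pi>) * of_bool (\<forall>(i, j)\<in>insert (i, j) T. (\<pi> i, j) \<in> G)) =
        (of_int (sign \<pi>) * of_bool (\<forall>(i, j)\<in>T. (\<pi> i, j) \<in> G) :: complex)"
    proof (cases "\<forall>(i, j)\<in>T. (\<pi> i, j) \<in> G")
      case True
      have "i0 \<notin> fst ` T"
      proof
        assume "i0 \<in> fst ` T"
        then obtain j' where j': "(i0, j') \<in> T" by force
        then have "(i1, j') \<in> G" using True i0 by auto
        then have "j' = j" using rooks_unique_col[OF G _ i1] by blast
        then show False using j' T(3) by force
      qed
      then have i0_mem: "i0 \<in> I - fst ` T" using i0 by simp
      have iff: "(\<pi> i, j) \<in> G \<longleftrightarrow> i = i0" for i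
      proof
        assume "(\<pi> i, j) \<in> G"
        then have "\<pi> i = \<pi> i0" using rooks_unique_row[OF G _ i1] i0(2) by simp
        then show "i = i0" using permutes_inj[OF pi] by (simp add: inj_eq)
      qed (use i1 i0 in simp)
      have e: "(\<forall>(i, j)\<in>insert (i, j) T. (\<pi> i, j) \<in> G) \<longleftrightarrow> i = i0" for i
      proof
        assume "\<forall>(i, j)\<in>insert (i, j) T. (\<pi> i, j) \<in> G"
        then have "(\<pi> i, j) \<in> G" by simp
        then show "i = i0" by (simp only: iff)
      next
        assume "i = i0"
        then have "(\<pi> i, j) \<in> G" by (simp only: iff)
        then show "\<forall>(i, j)\<in>insert (i, j) T. (\<pi> i, j) \<in> G" using True by simp
      qed
      have "(\<Sum>i\<in>I - fst ` T. of_int (sign \<pi>) * of_bool (\<forall>(i, j)\<in>insert (i, j) T. (\<pi> i, j) \<in> G)) =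
          (\<Sum>i\<in>I - fst ` T. if i = i0 then of_int (sign \<pi>) else (0 :: complex))"
        by (rule sum.cong[OF refl]) (simp only: e, simp)
      also have "\<dots> = of_int (sign \<pi>) * of_bool (\<forall>(i, j)\<in>T. (\<pi> i, j) \<in> G)"
        using i0_mem fin(1) True by (simp add: sum.delta)
      finally show ?thesis .
    next
      case False
      then have "(\<forall>(i, j)\<in>insert (i, j) T. (\<pi> i, j) \<in> G) = False" for i j by auto
      then show ?thesis using False by (simp only: of_bool_eq mult_zero_right sum.neutral_const)
    qed
  qed
  also have "\<dots> = 0"
    by (rule alternant_eq_0_of_card[OF G fin T(1)]) (use T(2) k in simp)
  finally show "(\<Sum>i\<in>I - fst ` T. alternant G (insert (i, j) T)) = 0" .
qed

lemma permuted_rook: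
  fixes G :: "(nat \<times> nat) set"
  assumes G: "G \<in> rooks I J (card I)" and pi: "\<pi> permutes I"
  shows "{(i, j). (\<pi> i, j) \<in> G} \<in> rooks I J (card I)"
proof -
  let ?p = "map_prod (inv_into UNIV \<pi>) (id :: nat \<Rightarrow> nat)"
  have bij: "bij \<pi>" using pi permutes_bij by blast
  then have inj: "inj (inv_into UNIV \<pi>)" by (simp add: bij_imp_bij_inv bij_is_inj)
  have eq: "{(i, j). (\<pi> i, j) \<in> G} = ?p ` G"
  proof (intro equalityI subsetI)
    fix q assume "q \<in> {(i, j). (\<pi> i, j) \<in> G}"
    then show "q \<in> ?p ` G" using bij
      by (intro image_eqI[of _ _ "(\<pi> (fst q), snd q)"]) (auto simp: bij_is_inj inv_f_f)
  next
    fix q assume "q \<in> ?p ` G"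
    then show "q \<in> {(i, j). (\<pi> i, j) \<in> G}" using bij by (auto simp: bij_is_surj surj_f_inv_f)
  qed
  have injp: "inj ?p" using inj by (intro prod.inj_map) auto
  have "?p ` G \<subseteq> I \<times> J"
    using G permutes_in_image[OF permutes_inv[OF pi]] by (auto simp: rooks_def)
  moreover have "inj_on fst (?p ` G)"
    unfolding eq[symmetric] by (rule inj_onI) (auto dest: rooks_unique_col[OF G])
  moreover have "inj_on snd (?p ` G)"
    unfolding eq[symmetric]
    by (rule inj_onI) (use bij in \<open>auto dest: rooks_unique_row[OF G] simp: bij_is_inj inj_eq\<close>)
  moreover have "card (?p ` G) = card G" by (rule card_image[OF inj_on_subset[OF injp]]) auto
  ultimately show ?thesis unfolding eq using G by (auto simp: rooks_def)
qed

text \<open>The first row \<open>i\<close> moved by \<open>\<pi>\<close> is sent to a later row of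
  the same level. Equal levels are decreasing, so the column found there is smaller than the one
  \<open>G\<close> has in row \<open>i\<close>.\<close>

lemma permuted_rook_lex_less:
  assumes G: "G \<in> rooks I J (card I)" and fin: "finite I" "finite J" "card I = card J"
    and pi: "\<pi> \<in> level_perms G" "\<pi> \<noteq> id"
  shows "lex_less {(i, j). (\<pi> i, j) \<in> G} G"
proof -
  have I: "fst ` G = I" using perfect_rooks_images[OF fin G] by simp
  have p: "\<pi> permutes I" and lev: "\<And>i. row_level G (\<pi> i) = row_level G i"
    using pi(1) by (auto simp: level_perms_def I)
  obtain i where i: "\<pi> i \<noteq> i" and min: "\<And>i'. i' < i \<Longrightarrow> \<pi> i' = i'"
    using pi(2) exists_least_iff[of "\<lambda>i. \<pi> i \<noteq> i"] by (auto simp: fun_eq_iff)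
  have "i \<in> I" using i p by (meson permutes_not_in)
  then have "\<pi> i \<in> I" using permutes_in_image[OF p] by simp
  obtain j where j: "(\<pi> i, j) \<in> G" using \<open>\<pi> i \<in> I\<close> I by force
  obtain j' where j': "(i, j') \<in> G" using \<open>i \<in> I\<close> I by force
  have "\<not> \<pi> i < i"
  proof
    assume "\<pi> i < i"
    from min[OF this] i show False using permutes_inj[OF p] by (simp add: inj_eq)
  qed
  then have lt: "i < \<pi> i" using i by simp
  have "\<not> j' < j" using row_level_less[OF G j' j lt] lev[of i] by auto
  moreover have "j \<noteq> j'" using rooks_unique_row[OF G j] j' i by blast
  ultimately have "j < j'" by simp
  then show ?thesis unfolding lex_less_def using j j' min by (intro exI[of _ i] exI[of _ j] exI[of _ j']) auto
qed

section \<open>Triangularity of alternants on residuals\<close>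

text \<open>A nonzero term for \<open>\<pi>\<close> means that the permuted copy \<open>u\<close> of
  \<open>G\<close> contains the residual of \<open>H\<close>. Then \<open>H\<close> is at most
  \<open>u\<close>, because only the increasing part of \<open>H\<close> is refilled, and
  \<open>u\<close> is at most \<open>G\<close>, because levels are decreasing. Equality throughout
  forces \<open>\<pi> = id\<close>, so the diagonal entry is a single sign.\<close>

lemma alternant_residual:
  assumes fin: "finite I" "finite J" "card I = card J"
    and G: "G \<in> rooks I J (card I)" and H: "H \<in> rooks I J (card I)"
  shows alternant_residual_tri: "alternant G (residual H) \<noteq> 0 \<Longrightarrow> G = H \<or> lex_less H G"
    and alternant_residual_diag: "alternant G (residual G) = 1"
proof -
  have I: "fst ` G = I" using perfect_rooks_images[OF fin G] by simp
  have key: "(H = G \<and> \<pi> = id) \<or> lex_less H G"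
    if pi: "\<pi> \<in> level_perms G" and sub: "\<forall>(i, j)\<in>residual H. (\<pi> i, j) \<in> G" and H: "H \<in> rooks I J (card I)" for \<pi> H
  proof -
    let ?u = "{(i, j). (\<pi> i, j) \<in> G}"
    have p: "\<pi> permutes I" using pi by (simp add: level_perms_def I)
    have u: "?u \<in> rooks I J (card I)" by (rule permuted_rook[OF G p])
    have fH: "finite H" using H by (auto simp: rooks_def)
    have "H - longest_increasing H \<subseteq> ?u" using sub by (auto simp: residual_def)
    then have "?u = H \<or> lex_less H ?u"
      using lex_less_of_increasing[OF fin H u longest_increasing(1,2)[OF fH]] by blast
    moreover have "\<pi> = id \<or> lex_less ?u G" using permuted_rook_lex_less[OF G fin pi] by blast
    moreover have "\<pi> = id \<Longrightarrow> ?u = G" by auto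
    ultimately show ?thesis using lex_less_trans[OF u] by metis
  qed
  show "G = H \<or> lex_less H G" if ne: "alternant G (residual H) \<noteq> 0"
  proof -
    obtain \<pi> where "\<pi> \<in> level_perms G"
      "of_int (sign \<pi>) * of_bool (\<forall>(i, j)\<in>residual H. (\<pi> i, j) \<in> G) \<noteq> (0 :: complex)"
      using ne unfolding alternant_def by (meson sum.neutral)
    then show ?thesis using key[OF _ _ H] by (auto simp: of_bool_def split: if_splits)
  qed
  show "alternant G (residual G) = 1"
  proof -
    let ?f = "\<lambda>\<pi>. of_int (sign \<pi>) * of_bool (\<forall>(i, j)\<in>residual G. (\<pi> i, j) \<in> G) :: complex"
    have fG: "finite G" using G by (auto simp: rooks_def)
    have "id \<in> level_perms G" by (simp add: level_perms_def permutes_id)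
    moreover have "?f \<pi> = 0" if "\<pi> \<in> level_perms G" "\<pi> \<noteq> id" for \<pi>
      using key[OF that(1) _ G] that(2) lex_less_irrefl[OF G] by (auto simp: of_bool_def)
    ultimately have "(\<Sum>\<pi>\<in>level_perms G. ?f \<pi>) = (\<Sum>\<pi>\<in>{id}. ?f \<pi>)"
      by (intro sum.mono_neutral_right) (auto simp: finite_level_perms[OF fG])
    also have "\<dots> = 1" by (auto simp: residual_def sign_id)
    finally show ?thesis by (simp add: alternant_def)
  qed
qed

definition perfect_rooks_lis :: "nat set \<Rightarrow> nat set \<Rightarrow> nat \<Rightarrow> (nat \<times> nat) set set" where
  "perfect_rooks_lis I J k = {G \<in> rooks I J (card I). lis G + k = card I}"

lemma lex_less_order:
  assumes "A \<subseteq> rooks I J m"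
  shows "asymp_on A lex_less" "transp_on A lex_less"
proof -
  show "transp_on A lex_less"
    using assms by (intro transp_onI) (metis lex_less_trans subsetD)
  show "asymp_on A lex_less"
  proof (intro asymp_onI notI)
    fix G H assume "G \<in> A" "H \<in> A" "lex_less G H" "lex_less H G"
    then show False using assms lex_less_trans[of H I J m G G] lex_less_irrefl[of G I J m] by auto
  qed
qed

text \<open>The lower bound: evaluations at residuals are independent already on alternants. The
  system uses the transpose of the alternant matrix, hence the reversed order.\<close>

lemma perfect_rooks_lis_independent:
  fixes a :: "(nat \<times> nat) set \<Rightarrow> complex"
  assumes fin: "finite I" "finite J" "card I = card J"
    and 0: "\<And>f. row_balanced I J k f \<Longrightarrow> col_balanced I J k f \<Longrightarrow>
        (\<Sum>G\<in>perfect_rooks_lis I J k. a G * f (residual G)) = 0"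
    and G: "G \<in> perfect_rooks_lis I J k"
  shows "a G = 0"
proof -
  let ?P = "perfect_rooks_lis I J k"
  have sub: "?P \<subseteq> rooks I J (card I)" by (auto simp: perfect_rooks_lis_def)
  have ord: "asymp_on ?P (\<lambda>G H. lex_less H G)" "transp_on ?P (\<lambda>G H. lex_less H G)"
    using lex_less_order[OF sub] by (blast intro: asymp_onI transp_onI dest: asymp_onD transp_onD)+
  show ?thesis
  proof (rule triangular_trivial_kernel[of ?P "\<lambda>G H. lex_less H G" "\<lambda>G H. alternant H (residual G)"])
    show "finite ?P" using finite_subset[OF sub finite_rooks] fin by blast
    fix G assume G: "G \<in> ?P"
    then have Gr: "G \<in> rooks I J (card I)" using sub by auto
    show "alternant G (residual G) \<noteq> 0" using alternant_residual_diag[OF fin Gr Gr] by simp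
    show "G = H \<or> lex_less G H" if "H \<in> ?P" "alternant H (residual G) \<noteq> 0" for H
      using alternant_residual_tri[OF fin subsetD[OF sub that(1)] Gr that(2)] by auto
    have "k + lis G = card I" using G by (simp add: perfect_rooks_lis_def)
    then show "(\<Sum>H\<in>?P. a H * alternant G (residual H)) = 0"
      by (intro 0 alternant_row_balanced[OF Gr fin] alternant_col_balanced[OF Gr fin])
  qed (use ord G in auto)
qed

lemma row_balanced_sum:
  assumes "\<And>a. a \<in> A \<Longrightarrow> row_balanced I J k (f a)"
  shows "row_balanced I J k (\<lambda>R. \<Sum>a\<in>A. x a * f a R)"
  unfolding row_balanced_def
proof (intro allI impI)
  fix t T i assume *: "T \<in> rooks I J t" "Suc t = k" "i \<in> I - fst ` T"
  have "(\<Sum>j\<in>J - snd ` T. \<Sum>a\<in>A. x a * f a (insert (i, j) T)) =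
      (\<Sum>a\<in>A. x a * (\<Sum>j\<in>J - snd ` T. f a (insert (i, j) T)))"
    by (subst sum.swap) (simp add: sum_distrib_left)
  also have "\<dots> = 0"
  proof (rule sum.neutral, rule ballI)
    fix a assume "a \<in> A"
    then have "(\<Sum>j\<in>J - snd ` T. f a (insert (i, j) T)) = 0"
      using assms * unfolding row_balanced_def by blast
    then show "x a * (\<Sum>j\<in>J - snd ` T. f a (insert (i, j) T)) = 0" by simp
  qed
  finally show "(\<Sum>j\<in>J - snd ` T. \<Sum>a\<in>A. x a * f a (insert (i, j) T)) = 0" .
qed

lemma col_balanced_sum:
  assumes "\<And>a. a \<in> A \<Longrightarrow> col_balanced I J k (f a)"
  shows "col_balanced I J k (\<lambda>R. \<Sum>a\<in>A. x a * f a R)"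
  unfolding col_balanced_def
proof (intro allI impI)
  fix t T j assume *: "T \<in> rooks I J t" "Suc t = k" "j \<in> J - snd ` T"
  have "(\<Sum>i\<in>I - fst ` T. \<Sum>a\<in>A. x a * f a (insert (i, j) T)) =
      (\<Sum>a\<in>A. x a * (\<Sum>i\<in>I - fst ` T. f a (insert (i, j) T)))"
    by (subst sum.swap) (simp add: sum_distrib_left)
  also have "\<dots> = 0"
  proof (rule sum.neutral, rule ballI)
    fix a assume "a \<in> A"
    then have "(\<Sum>i\<in>I - fst ` T. f a (insert (i, j) T)) = 0"
      using assms * unfolding col_balanced_def by blast
    then show "x a * (\<Sum>i\<in>I - fst ` T. f a (insert (i, j) T)) = 0" by simp
  qed
  finally show "(\<Sum>i\<in>I - fst ` T. \<Sum>a\<in>A. x a * f a (insert (i, j) T)) = 0" .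
qed

text \<open>Together with \<open>f\<close>, the functions \<open>alternant G\<close> have \<open>m! + 1\<close> lifts to the \<open>m!\<close> perfect
  rook placements; a linear relation between the lifts splits by degree and must be trivial on the
  \<open>alternant G\<close>, because \<open>f\<close> vanishes on all residuals.\<close>

lemma balanced_eq_0_of_residuals:
  fixes f :: "(nat \<times> nat) set \<Rightarrow> complex"
  assumes fin: "finite I" "finite J" "card I = card J"
    and bal: "row_balanced I J k f" "col_balanced I J k f"
    and 0: "\<And>G. G \<in> perfect_rooks_lis I J k \<Longrightarrow> f (residual G) = 0"
    and R: "R \<in> rooks I J k"
  shows "f R = 0"
proof -
  let ?m = "card I"
  let ?P = "rooks I J ?m"
  have fP: "finite ?P" using finite_rooks fin by blast
  have km: "k \<le> ?m" using rooks_le_left fin R by blast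
  define F where "F = (\<lambda>s. case s of None \<Rightarrow> f | Some G \<Rightarrow> alternant G)"
  define deg where "deg = (\<lambda>s. case s of None \<Rightarrow> k | Some G \<Rightarrow> ?m - lis G)"
  define A where "A = insert None (Some ` ?P)"
  have fA: "finite A" and cA: "card ?P < card A"
    using fP by (auto simp: A_def card_image)
  have lis_le: "lis G \<le> ?m" if "G \<in> ?P" for G
    using lis_le_card[of G] that by (auto simp: rooks_def)
  have degA: "deg s \<le> ?m" for s using km by (auto simp: deg_def split: option.split)
  have balF: "row_balanced I J (deg s) (F s)" "col_balanced I J (deg s) (F s)" if "s \<in> A" for s
    using that bal alternant_row_balanced[OF _ fin] alternant_col_balanced[OF _ fin] lis_le
    by (auto simp: A_def F_def deg_def)
  obtain x where x: "\<exists>s\<in>A. x s \<noteq> 0"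
    and rel: "\<And>G. G \<in> ?P \<Longrightarrow> (\<Sum>s\<in>A. x s * rook_lift (deg s) (F s) G) = 0"
    using homogeneous_system_nontrivial[OF fP fA cA, of "\<lambda>s. rook_lift (deg s) (F s)"] by auto
  define g where "g = (\<lambda>d R. \<Sum>s | s \<in> A \<and> deg s = d. x s * F s R)"
  have g0: "g d S = 0" if "d \<le> ?m" "S \<in> rooks I J d" for d S
  proof (rule balanced_lift_sum_eq_0[OF fin, of "{..?m}" g])
    fix d
    show "row_balanced I J d (g d)" unfolding g_def by (rule row_balanced_sum) (use balF in auto)
    show "col_balanced I J d (g d)" unfolding g_def by (rule col_balanced_sum) (use balF in auto)
  next
    fix G assume G: "G \<in> ?P"
    have "(\<Sum>d\<in>{..?m}. rook_lift d (g d) G) =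
        (\<Sum>d\<in>{..?m}. \<Sum>s | s \<in> A \<and> deg s = d. x s * rook_lift (deg s) (F s) G)"
    proof (rule sum.cong[OF refl])
      fix d
      have "rook_lift d (g d) G = (\<Sum>s | s \<in> A \<and> deg s = d. x s * rook_lift d (F s) G)"
        unfolding rook_lift_def g_def by (subst sum.swap) (simp add: sum_distrib_left)
      also have "\<dots> = (\<Sum>s | s \<in> A \<and> deg s = d. x s * rook_lift (deg s) (F s) G)"
        by (rule sum.cong) auto
      finally show "rook_lift d (g d) G = (\<Sum>s | s \<in> A \<and> deg s = d. x s * rook_lift (deg s) (F s) G)" .
    qed
    also have "\<dots> = (\<Sum>s\<in>A. x s * rook_lift (deg s) (F s) G)"
      by (rule sum.group) (use fA degA in auto)
    finally show "(\<Sum>d\<in>{..?m}. rook_lift d (g d) G) = 0" using rel[OF G] by simp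
  qed (use that in auto)
  have g_split: "g d S = (\<Sum>G\<in>perfect_rooks_lis I J d. x (Some G) * alternant G S) +
      (if d = k then x None * f S else 0)" for d S
  proof -
    have set: "{s \<in> A. deg s = d} =
        Some ` perfect_rooks_lis I J d \<union> (if d = k then {None} else {})"
      using lis_le by (force simp: A_def deg_def perfect_rooks_lis_def)
    have "g d S = (\<Sum>s\<in>Some ` perfect_rooks_lis I J d. x s * F s S) +
        (\<Sum>s\<in>(if d = k then {None} else {}). x s * F s S)"
      unfolding g_def set
      by (rule sum.union_disjoint) (use fP in \<open>auto simp: perfect_rooks_lis_def\<close>)
    then show ?thesis by (simp add: sum.reindex F_def)
  qed
  have xS: "x (Some G) = 0" if G: "G \<in> ?P" for G
  proof -
    let ?d = "?m - lis G"
    let ?Q = "perfect_rooks_lis I J ?d"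
    have sub: "?Q \<subseteq> ?P" by (auto simp: perfect_rooks_lis_def)
    show ?thesis
    proof (rule triangular_trivial_kernel[of ?Q lex_less "\<lambda>G H. alternant G (residual H)" "\<lambda>G. x (Some G)"])
      show "finite ?Q" using finite_subset[OF sub fP] .
      fix H assume H: "H \<in> ?Q"
      then have Hr: "H \<in> ?P" using sub by auto
      show "alternant H (residual H) \<noteq> 0" using alternant_residual_diag[OF fin Hr Hr] by simp
      show "H = K \<or> lex_less K H" if "K \<in> ?Q" "alternant H (residual K) \<noteq> 0" for K
        using alternant_residual_tri[OF fin Hr subsetD[OF sub that(1)] that(2)] by auto
      have "?m - lis H = ?d" using H by (auto simp: perfect_rooks_lis_def)
      then have "residual H \<in> rooks I J ?d" using residual_rooks[OF Hr] by simp
      then have "g ?d (residual H) = 0" by (intro g0) auto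
      moreover have "?d = k \<Longrightarrow> f (residual H) = 0" using 0 H by simp
      ultimately show "(\<Sum>G\<in>?Q. x (Some G) * alternant G (residual H)) = 0"
        unfolding g_split by (auto split: if_splits)
    next
      show "G \<in> ?Q" using G lis_le[OF G] by (simp add: perfect_rooks_lis_def)
    qed (use lex_less_order[OF sub] in auto)
  qed
  \<comment> \<open>The coefficients of all alternants vanish, so the nontrivial relation must
    involve \<open>f\<close>, and its part of degree \<open>k\<close> is a nonzero multiple of
    \<open>f\<close>.\<close>
  then have "x None \<noteq> 0" using x by (auto simp: A_def)
  moreover have "g k R = x None * f R"
    unfolding g_split using xS by (auto simp: perfect_rooks_lis_def intro!: sum.neutral)
  ultimately show ?thesis using g0[OF km R] by simp
qed

section \<open>Dimensions in quotients of the polynomial ring\<close>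

text \<open>A basis of \<open>S\<close> stays independent when \<open>p\<close> is added, so values
  may be prescribed on it freely. This turns the spanning question below into one about
  functionals.\<close>

lemma (in vector_space) separating_functional:
  assumes "subspace S" "p \<notin> S"
  shows "\<exists>g. Vector_Spaces.linear scale (*) g \<and> (\<forall>x\<in>S. g x = 0) \<and> g p = 1"
proof -
  interpret pair: vector_space_pair scale "(*) :: 'a \<Rightarrow> 'a \<Rightarrow> 'a"
    by unfold_locales (auto simp: algebra_simps)
  obtain B where B: "B \<subseteq> S" "independent B" "S \<subseteq> span B" by (rule maximal_independent_subset)
  have "span B = S" using B span_minimal[OF B(1) assms(1)] by auto
  then have "independent (insert p B)" using B(2) assms(2) by (intro independent_insertI) auto
  then obtain g where g: "Vector_Spaces.linear scale (*) g" "\<forall>x\<in>insert p B. g x = (if x = p then 1 else 0)"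
    using pair.linear_independent_extend[of "insert p B" "\<lambda>x. if x = p then 1 else 0"] by auto
  have "p \<notin> B" using assms(2) B(1) by auto
  then have "g x = 0" if "x \<in> B" for x using g(2) that by auto
  then have "g x = 0" if "x \<in> S" for x
    using pair.linear_eq_0_on_span[OF g(1)] that \<open>span B = S\<close> by blast
  then show ?thesis using g by auto
qed

text \<open>Scaling is multiplication by a constant polynomial, so linear algebra on polynomials
  uses the same constants over which the dimension of the quotient is taken.\<close>

lemma vector_space_poly_mapping:
  "vector_space (\<lambda>(c :: 'k::field) (p :: 'm::comm_monoid_add \<Rightarrow>\<^sub>0 'k). Poly_Mapping.single 0 c * p)"
proof
  fix a b :: 'k and x y :: "'m \<Rightarrow>\<^sub>0 'k"
  show "Poly_Mapping.single 0 a * (x + y) = Poly_Mapping.single 0 a * x + Poly_Mapping.single 0 a * y"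
    by (rule distrib_left)
  show "Poly_Mapping.single 0 (a + b) * x = Poly_Mapping.single 0 a * x + Poly_Mapping.single 0 b * x"
    by (simp add: single_add distrib_right)
  show "Poly_Mapping.single 0 a * (Poly_Mapping.single 0 b * x) = Poly_Mapping.single 0 (a * b) * x"
    by (simp add: mult.assoc[symmetric] mult_single)
  show "Poly_Mapping.single 0 1 * x = x" by simp
qed

lemma lookup_const_mult [simp]:
  fixes p :: "'m::comm_monoid_add \<Rightarrow>\<^sub>0 'k::field"
  shows "Poly_Mapping.lookup (Poly_Mapping.single 0 c * p) m = c * Poly_Mapping.lookup p m"
  unfolding mult_map_scale_conv_mult[symmetric]
  by (subst map.rep_eq) (auto simp: when_def)

lemma poly_mapping_sum_monomials:
  fixes p :: "'m::comm_monoid_add \<Rightarrow>\<^sub>0 'k::field"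
  shows "p = (\<Sum>m\<in>Poly_Mapping.keys p. Poly_Mapping.single 0 (Poly_Mapping.lookup p m) * Poly_Mapping.single m 1)"
proof (rule poly_mapping_eqI)
  fix k
  have "Poly_Mapping.lookup (\<Sum>m\<in>Poly_Mapping.keys p. Poly_Mapping.single 0 (Poly_Mapping.lookup p m) * Poly_Mapping.single m 1) k =
      (\<Sum>m\<in>Poly_Mapping.keys p. if m = k then Poly_Mapping.lookup p m else 0)"
    by (simp add: lookup_sum lookup_single when_def if_distrib cong: if_cong)
  also have "\<dots> = Poly_Mapping.lookup p k"
    by (simp add: sum.delta in_keys_iff)
  finally show "Poly_Mapping.lookup p k = Poly_Mapping.lookup (\<Sum>m\<in>Poly_Mapping.keys p. Poly_Mapping.single 0 (Poly_Mapping.lookup p m) * Poly_Mapping.single m 1) k" ..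
qed

lemma keys_add_nat: "Poly_Mapping.keys (m + m' :: 'a \<Rightarrow>\<^sub>0 nat) = Poly_Mapping.keys m \<union> Poly_Mapping.keys m'"
  by (auto simp: in_keys_iff lookup_add)

lemma matrix_polys_closed:
  shows matrix_polys_0: "0 \<in> matrix_polys n"
    and matrix_polys_1: "1 \<in> matrix_polys n"
    and matrix_polys_add: "p \<in> matrix_polys n \<Longrightarrow> q \<in> matrix_polys n \<Longrightarrow> p + q \<in> matrix_polys n"
    and matrix_polys_uminus: "p \<in> matrix_polys n \<Longrightarrow> - p \<in> matrix_polys n"
    and matrix_polys_mult: "p \<in> matrix_polys n \<Longrightarrow> q \<in> matrix_polys n \<Longrightarrow> p * q \<in> matrix_polys n"
    and matrix_polys_const: "Poly_Mapping.single 0 c \<in> matrix_polys n"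
proof -
  show "p + q \<in> matrix_polys n" if "p \<in> matrix_polys n" "q \<in> matrix_polys n"
    using that keys_add[of p q] unfolding matrix_polys_def by blast
  show "p * q \<in> matrix_polys n" if "p \<in> matrix_polys n" "q \<in> matrix_polys n"
    unfolding matrix_polys_def
  proof (rule CollectI, rule ballI)
    fix m assume "m \<in> Poly_Mapping.keys (p * q)"
    then obtain a b where "m = a + b" "a \<in> Poly_Mapping.keys p" "b \<in> Poly_Mapping.keys q"
      using keys_mult[of p q] by blast
    then show "Poly_Mapping.keys m \<subseteq> {1..n} \<times> {1..n}"
      using that by (auto simp: keys_add_nat matrix_polys_def)
  qed
qed (auto simp: matrix_polys_def in_keys_iff lookup_single when_def)

lemma matrix_poly_ring_simps [simp]:
  "carrier (matrix_poly_ring n) = matrix_polys n"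
  "x \<otimes>\<^bsub>matrix_poly_ring n\<^esub> y = x * y"
  "x \<oplus>\<^bsub>matrix_poly_ring n\<^esub> y = x + y"
  "\<one>\<^bsub>matrix_poly_ring n\<^esub> = 1"
  "\<zero>\<^bsub>matrix_poly_ring n\<^esub> = 0"
  by (auto simp: matrix_poly_ring_def)

lemma cring_matrix_poly_ring: "cring (matrix_poly_ring n)"
proof (rule cringI)
  show "abelian_group (matrix_poly_ring n)"
  proof (rule abelian_groupI)
    fix x assume "x \<in> carrier (matrix_poly_ring n)"
    then show "\<exists>y\<in>carrier (matrix_poly_ring n). y \<oplus>\<^bsub>matrix_poly_ring n\<^esub> x = \<zero>\<^bsub>matrix_poly_ring n\<^esub>"
      by (intro bexI[of _ "- x"]) (auto simp: matrix_polys_uminus)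
  qed (auto simp: matrix_polys_closed add_ac)
  show "Group.comm_monoid (matrix_poly_ring n)"
    by (rule comm_monoidI) (auto simp: matrix_polys_closed mult_ac)
qed (auto simp: distrib_right)

lemma subfield_constant_polys: "subfield constant_polys (matrix_poly_ring n)"
proof -
  interpret R: cring "matrix_poly_ring n" by (rule cring_matrix_poly_ring)
  have neg: "\<ominus>\<^bsub>matrix_poly_ring n\<^esub> x = - x" if "x \<in> matrix_polys n" for x
    using that by (intro R.minus_equality) (auto simp: matrix_polys_uminus)
  have "subcring constant_polys (matrix_poly_ring n)"
  proof (intro R.subcringI' R.subringI)
    fix h assume "h \<in> constant_polys"
    then obtain c where c: "h = Poly_Mapping.single 0 c" by (auto simp: constant_polys_def)
    then have "\<ominus>\<^bsub>matrix_poly_ring n\<^esub> h = Poly_Mapping.single 0 (- c)"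
      by (simp add: neg matrix_polys_const single_uminus)
    then show "\<ominus>\<^bsub>matrix_poly_ring n\<^esub> h \<in> constant_polys" by (auto simp: constant_polys_def)
  qed (auto simp: constant_polys_def matrix_polys_const mult_single single_add[symmetric] intro: exI[of _ 1] simp flip: single_one)
  then show ?thesis
  proof (rule R.subfieldI)
    show "Units (matrix_poly_ring n \<lparr>carrier := constant_polys\<rparr>) = constant_polys - {\<zero>\<^bsub>matrix_poly_ring n\<^esub>}"
    proof (intro equalityI subsetI)
      fix x assume "x \<in> Units (matrix_poly_ring n \<lparr>carrier := constant_polys\<rparr>)"
      then obtain y where "x \<in> constant_polys" "y * x = 1" by (auto simp: Units_def)
      then show "x \<in> constant_polys - {\<zero>\<^bsub>matrix_poly_ring n\<^esub>}" by auto
    next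
      fix x assume "x \<in> constant_polys - {\<zero>\<^bsub>matrix_poly_ring n\<^esub>}"
      then obtain c where c: "x = Poly_Mapping.single 0 c" "x \<noteq> 0" by (auto simp: constant_polys_def)
      then have "c \<noteq> 0" by auto
      then have "Poly_Mapping.single 0 (inverse c) * x = 1" "x * Poly_Mapping.single 0 (inverse c) = 1"
        using c by (auto simp: mult_single)
      then show "x \<in> Units (matrix_poly_ring n \<lparr>carrier := constant_polys\<rparr>)"
        using c by (auto simp: Units_def constant_polys_def)
    qed
  qed
qed

text \<open>Translates the dimension of a piece of the quotient into independence and spanning
  modulo \<open>I\<close> among polynomials. Properness of \<open>I\<close> makes the image of the
  constants a subfield.\<close>

lemma dim_quot_image:
  fixes I :: "cpoly set" and b :: "'w \<Rightarrow> cpoly"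
  assumes I: "ideal I (matrix_poly_ring n)" "1 \<notin> I"
    and W: "finite W" "\<And>w. w \<in> W \<Longrightarrow> b w \<in> matrix_polys n"
    and indep: "\<And>a w. (\<Sum>w\<in>W. Poly_Mapping.single 0 (a w) * b w) \<in> I \<Longrightarrow> w \<in> W \<Longrightarrow> a w = 0"
    and closed: "\<And>a. (\<Sum>w\<in>W. Poly_Mapping.single 0 (a w) * b w) \<in> S"
    and span: "\<And>p. p \<in> S \<Longrightarrow> \<exists>a. \<exists>x\<in>I. p = x + (\<Sum>w\<in>W. Poly_Mapping.single 0 (a w) * b w)"
  shows "ring.dim (matrix_poly_ring n Quot I) (quot_image n I constant_polys) (quot_image n I S) = card W"
proof -
  let ?R = "matrix_poly_ring n"
  let ?Q = "?R Quot I"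
  let ?h = "\<lambda>p. I +>\<^bsub>?R\<^esub> p"
  let ?K = "quot_image n I constant_polys"
  interpret R: cring ?R by (rule cring_matrix_poly_ring)
  interpret I: ideal I ?R by (rule I(1))
  interpret Q: ring ?Q by (rule I.quotient_is_ring)
  interpret h: ring_hom_ring ?R ?Q ?h by (rule I.rcos_ring_hom_ring)
  have I_sub: "I \<subseteq> matrix_polys n" using I.a_subset by simp
  have zero: "\<zero>\<^bsub>?Q\<^esub> = I" by (simp add: FactRing_def)
  have h0: "?h p = \<zero>\<^bsub>?Q\<^esub> \<longleftrightarrow> p \<in> I" if "p \<in> matrix_polys n" for p
    using that I.rcos_const_imp_mem R.a_rcos_zero[OF I(1)] zero by auto
  have "\<one>\<^bsub>?Q\<^esub> \<noteq> \<zero>\<^bsub>?Q\<^esub>"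
    using h0[OF matrix_polys_1] I(2) h.hom_one by simp
  then have K: "subfield ?K ?Q"
    unfolding quot_image_def using h.img_is_subfield(2)[OF subfield_constant_polys] by simp
  obtain ws where ws: "set ws = W" "distinct ws" using finite_distinct_list[OF W(1)] by blast
  let ?Us = "map (\<lambda>w. ?h (b w)) ws"
  let ?lin = "\<lambda>a vs. (\<Sum>w\<in>set vs. Poly_Mapping.single 0 (a w) * b w)"
  have lin_closed: "?lin a vs \<in> matrix_polys n" if "set vs \<subseteq> W" for a vs
    using that
    by (induction vs) (auto simp: sum.insert_if intro!: matrix_polys_closed W(2))
  have comb: "Q.combine (map (\<lambda>w. ?h (Poly_Mapping.single 0 (a w))) vs) (map (\<lambda>w. ?h (b w)) vs) = ?h (?lin a vs)"
    if "distinct vs" "set vs \<subseteq> W" for a vs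
    using that
  proof (induction vs)
    case Nil
    then show ?case using h.hom_zero by simp
  next
    case (Cons v vs)
    have "?h (?lin a (v # vs)) = ?h (Poly_Mapping.single 0 (a v) * b v + ?lin a vs)"
      using Cons.prems by simp
    also have "\<dots> = (?h (Poly_Mapping.single 0 (a v)) \<otimes>\<^bsub>?Q\<^esub> ?h (b v)) \<oplus>\<^bsub>?Q\<^esub> ?h (?lin a vs)"
      using h.hom_add[of "Poly_Mapping.single 0 (a v) * b v" "?lin a vs"]
        h.hom_mult[of "Poly_Mapping.single 0 (a v)" "b v"] lin_closed[of vs a] Cons.prems W(2)
      by (simp add: matrix_polys_mult matrix_polys_const)
    finally show ?case using Cons by simp
  qed
  \<comment> \<open>Lists of scalars are replaced by functions on \<open>W\<close>, which is
    possible because \<open>ws\<close> has no repetitions.\<close>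
  have coeffs: "\<exists>a. Ks = map (\<lambda>w. ?h (Poly_Mapping.single 0 (a w))) ws"
    if Ks: "set Ks \<subseteq> ?K" "length Ks = length ws" for Ks
  proof -
    have "\<exists>c. k = ?h (Poly_Mapping.single 0 c)" if "k \<in> set Ks" for k
      using that Ks(1) by (auto simp: quot_image_def constant_polys_def)
    then obtain c where c: "\<And>k. k \<in> set Ks \<Longrightarrow> k = ?h (Poly_Mapping.single 0 (c k))" by metis
    have "Ks = map (\<lambda>w. ?h (Poly_Mapping.single 0 (c (the (map_of (zip ws Ks) w))))) ws"
    proof (rule nth_equalityI)
      fix i assume i: "i < length Ks"
      then have "map_of (zip ws Ks) (ws ! i) = Some (Ks ! i)"
        using Ks(2) ws(2) by (simp add: map_of_zip_nth)
      then show "Ks ! i = map (\<lambda>w. ?h (Poly_Mapping.single 0 (c (the (map_of (zip ws Ks) w))))) ws ! i"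
        using i Ks(2) c[of "Ks ! i"] by simp
    qed (use Ks in simp)
    then show ?thesis by (rule exI[of _ "\<lambda>w. c (the (map_of (zip ws Ks) w))"])
  qed
  have Us: "set ?Us \<subseteq> carrier ?Q" using W(2) ws(1) h.hom_closed by auto
  have "Q.independent ?K ?Us"
  proof (rule Q.trivial_combine_imp_independent[OF K Us])
    fix Ks assume Ks: "set Ks \<subseteq> ?K" "Q.combine Ks ?Us = \<zero>\<^bsub>?Q\<^esub>"
    show "set (take (length ?Us) Ks) \<subseteq> {\<zero>\<^bsub>?Q\<^esub>}"
    proof -
      let ?z = "\<zero>\<^bsub>?Q\<^esub>"
      \<comment> \<open>The coefficient list \<open>Ks\<close> may have any length; padding with
        zeros and cutting brings it to the length of \<open>ws\<close> without changing the
        combination.\<close>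
      define Ls where "Ls = take (length ws) (Ks @ replicate (length ws) ?z)"
      have zK: "?z \<in> ?K" using Q.subring_props(2)[OF K] by simp
      have Ls: "set Ls \<subseteq> ?K" "length Ls = length ws"
        using Ks(1) zK set_take_subset[of "length ws" "Ks @ replicate (length ws) ?z"]
        by (auto simp: Ls_def dest!: subsetD[OF set_take_subset])
      have "Q.combine Ls ?Us = Q.combine (Ks @ replicate (length ws) ?z) ?Us"
        using Q.combine_take[of ?Us "Ks @ replicate (length ws) ?z"] by (simp add: Ls_def)
      also have "\<dots> = ?z" using Q.combine_append_replicate[OF Us] Ks(2) by simp
      finally have Lz: "Q.combine Ls ?Us = ?z" .
      obtain a where a: "Ls = map (\<lambda>w. ?h (Poly_Mapping.single 0 (a w))) ws" using coeffs[OF Ls] by blast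
      have "?h (?lin a ws) = ?z" using Lz comb[OF ws(2), of a] ws(1) a by simp
      then have "(\<Sum>w\<in>W. Poly_Mapping.single 0 (a w) * b w) \<in> I"
        using h0[OF lin_closed[of ws a]] ws(1) by simp
      then have "\<And>w. w \<in> W \<Longrightarrow> a w = 0" by (rule indep)
      then have "set Ls \<subseteq> {?z}" using a ws(1) h.hom_zero by auto
      moreover have "set (take (length ?Us) Ks) \<subseteq> set Ls" by (auto simp: Ls_def)
      ultimately show ?thesis by blast
    qed
  qed
  then have "Q.dimension (length ?Us) ?K (Q.Span ?K ?Us)" by (rule Q.dimension_independent)
  moreover have "Q.Span ?K ?Us = quot_image n I S"
    unfolding Q.Span_eq_combine_set_length_version[OF K Us]
  proof (intro equalityI subsetI)
    fix u assume "u \<in> {Q.combine Ks ?Us | Ks. length Ks = length ?Us \<and> set Ks \<subseteq> ?K}"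
    then obtain Ks where Ks: "u = Q.combine Ks ?Us" "set Ks \<subseteq> ?K" "length Ks = length ws" by auto
    obtain a where a: "Ks = map (\<lambda>w. ?h (Poly_Mapping.single 0 (a w))) ws" using coeffs[OF Ks(2,3)] by blast
    then have "u = ?h (?lin a ws)" using comb[OF ws(2), of a] ws(1) Ks(1) by simp
    then show "u \<in> quot_image n I S" using closed[of a] ws(1) by (auto simp: quot_image_def)
  next
    fix u assume "u \<in> quot_image n I S"
    then obtain p where p: "p \<in> S" "u = ?h p" by (auto simp: quot_image_def)
    obtain a x where x: "x \<in> I" "p = x + ?lin a ws" using span[OF p(1)] ws(1) by blast
    have "?h p = ?h x \<oplus>\<^bsub>?Q\<^esub> ?h (?lin a ws)"
      using h.hom_add[of x "?lin a ws"] x I_sub lin_closed[of ws a] ws(1) by auto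
    also have "\<dots> = ?h (?lin a ws)"
      using h0[of x] x(1) I_sub h.hom_closed[of "?lin a ws"] lin_closed[of ws a] ws(1) by auto
    also have "\<dots> = Q.combine (map (\<lambda>w. ?h (Poly_Mapping.single 0 (a w))) ws) ?Us"
      using comb[OF ws(2), of a] ws(1) by simp
    finally have "u = Q.combine (map (\<lambda>w. ?h (Poly_Mapping.single 0 (a w))) ws) ?Us" using p(2) by simp
    moreover have "set (map (\<lambda>w. ?h (Poly_Mapping.single 0 (a w))) ws) \<subseteq> ?K"
      unfolding quot_image_def constant_polys_def by fastforce
    ultimately show "u \<in> {Q.combine Ks ?Us | Ks. length Ks = length ?Us \<and> set Ks \<subseteq> ?K}"
      by (intro CollectI exI[of _ "map (\<lambda>w. ?h (Poly_Mapping.single 0 (a w))) ws"]) auto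
  qed
  ultimately have "Q.dimension (card W) ?K (quot_image n I S)"
    using ws distinct_card[OF ws(2)] by simp
  from Q.dimI[OF K this] show ?thesis by (simp add: over_def)
qed

section \<open>Sectors of the quotient\<close>

abbreviation monomial :: "((nat \<times> nat) \<Rightarrow>\<^sub>0 nat) \<Rightarrow> cpoly" where
  "monomial m \<equiv> Poly_Mapping.single m 1"

definition rook_monom :: "nat \<Rightarrow> (nat \<times> nat) set \<Rightarrow> (nat \<times> nat) \<Rightarrow>\<^sub>0 nat" where
  "rook_monom r R = (\<Sum>c\<in>R. Poly_Mapping.single c r)"

lemma lookup_rook_monom: "finite R \<Longrightarrow> Poly_Mapping.lookup (rook_monom r R) c = (if c \<in> R then r else 0)"
  unfolding rook_monom_def by (simp add: lookup_sum lookup_single when_def)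

lemma rook_monom_insert:
  "finite R \<Longrightarrow> c \<notin> R \<Longrightarrow> rook_monom r (insert c R) = rook_monom r R + Poly_Mapping.single c r"
  by (simp add: rook_monom_def add.commute)

lemma rook_monom_inj: "finite R \<Longrightarrow> finite R' \<Longrightarrow> 0 < r \<Longrightarrow> rook_monom r R = rook_monom r R' \<Longrightarrow> R = R'"
  by (metis (no_types, lifting) ext less_irrefl lookup_rook_monom subsetI subset_antisym)

lemma keys_rook_monom: "finite R \<Longrightarrow> 0 < r \<Longrightarrow> Poly_Mapping.keys (rook_monom r R) = R"
  by (auto simp: in_keys_iff lookup_rook_monom split: if_splits)

lemma monomial_mult: "monomial m * monomial m' = monomial (m + m')"
  by (simp add: mult_single)

lemma xvar_power: "xvar i j ^ k = monomial (Poly_Mapping.single (i, j) k)"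
  by (induction k) (auto simp: xvar_def mult_single single_add[symmetric] add.commute)

lemma monomial_degree_eq:
  "finite A \<Longrightarrow> Poly_Mapping.keys m \<subseteq> A \<Longrightarrow> monomial_degree m = (\<Sum>v\<in>A. Poly_Mapping.lookup m v)"
  unfolding monomial_degree_def by (rule sum.mono_neutral_left) (auto simp: in_keys_iff)

lemma monomial_degree_add: "monomial_degree (m + m') = monomial_degree m + monomial_degree m'"
proof -
  let ?A = "Poly_Mapping.keys m \<union> Poly_Mapping.keys m'"
  have "monomial_degree (m + m') = (\<Sum>v\<in>?A. Poly_Mapping.lookup (m + m') v)"
    by (rule monomial_degree_eq) (auto simp: keys_add_nat)
  also have "\<dots> = (\<Sum>v\<in>?A. Poly_Mapping.lookup m v) + (\<Sum>v\<in>?A. Poly_Mapping.lookup m' v)"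
    by (simp add: lookup_add sum.distrib)
  also have "\<dots> = monomial_degree m + monomial_degree m'"
    using monomial_degree_eq[of ?A m] monomial_degree_eq[of ?A m'] by simp
  finally show ?thesis .
qed

lemma monomial_degree_rook_monom: "finite R \<Longrightarrow> monomial_degree (rook_monom r R) = r * card R"
  by (subst monomial_degree_eq[of R])
    (auto simp: in_keys_iff lookup_rook_monom split: if_splits)

text \<open>A sector collects the part of a monomial with exponents strictly between \<open>0\<close> and \<open>r\<close>; within a
  sector only the powers \<open>x\<^sub>i\<^sub>j\<^sup>r\<close> in the remaining rows and columns vary.\<close>

definition sector :: "nat \<Rightarrow> nat \<Rightarrow> ((nat \<times> nat) \<Rightarrow>\<^sub>0 nat) \<Rightarrow> bool" where
  "sector n r q \<longleftrightarrow> (\<exists>k. Poly_Mapping.keys q \<in> rooks {1..n} {1..n} k) \<and> (\<forall>c. Poly_Mapping.lookup q c < r)"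

lemma sector_lookup_less: "sector n r q \<Longrightarrow> \<not> r \<le> Poly_Mapping.lookup q c"
  unfolding sector_def not_le by blast

definition free_rows :: "nat \<Rightarrow> ((nat \<times> nat) \<Rightarrow>\<^sub>0 nat) \<Rightarrow> nat set" where
  "free_rows n q = {1..n} - fst ` Poly_Mapping.keys q"

definition free_cols :: "nat \<Rightarrow> ((nat \<times> nat) \<Rightarrow>\<^sub>0 nat) \<Rightarrow> nat set" where
  "free_cols n q = {1..n} - snd ` Poly_Mapping.keys q"

lemma finite_free [simp]: "finite (free_rows n q)" "finite (free_cols n q)"
  by (auto simp: free_rows_def free_cols_def)

lemma card_free:
  assumes "sector n r q"
  shows "card (free_rows n q) = card (free_cols n q)"
    and "card (free_rows n q) + card (Poly_Mapping.keys q) = n"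
proof -
  obtain k where k: "Poly_Mapping.keys q \<in> rooks {1..n} {1..n} k" using assms by (auto simp: sector_def)
  have le: "k \<le> n" using rooks_le_left[OF _ k] by simp
  have "card (free_rows n q) = n - k" "card (free_cols n q) = n - k"
    unfolding free_rows_def free_cols_def
    using rooks_fst_subset[OF k] rooks_snd_subset[OF k] rooks_fst_card[OF k] rooks_snd_card[OF k]
    by (simp_all add: card_Diff_subset)
  moreover have "card (Poly_Mapping.keys q) = k" using k by (simp add: rooks_def)
  ultimately show "card (free_rows n q) = card (free_cols n q)"
    "card (free_rows n q) + card (Poly_Mapping.keys q) = n" using le by auto
qed

lemma sector_rooks_union:
  assumes "sector n r q" "R \<in> rooks (free_rows n q) (free_cols n q) k"
  shows "Poly_Mapping.keys q \<union> R \<in> rooks {1..n} {1..n} (card (Poly_Mapping.keys q) + k)"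
    and "Poly_Mapping.keys q \<inter> R = {}"
proof -
  obtain l where "Poly_Mapping.keys q \<in> rooks {1..n} {1..n} l" using assms by (auto simp: sector_def)
  then have "Poly_Mapping.keys q \<in> rooks {1..n} {1..n} (card (Poly_Mapping.keys q))"
    by (simp add: rooks_def)
  from rooks_union[OF this] assms(2)
  show "Poly_Mapping.keys q \<union> R \<in> rooks {1..n} {1..n} (card (Poly_Mapping.keys q) + k)"
    "Poly_Mapping.keys q \<inter> R = {}" by (auto simp: free_rows_def free_cols_def)
qed

lemma lookup_sector_add:
  assumes "sector n r q" "R \<in> rooks (free_rows n q) (free_cols n q) k"
  shows "Poly_Mapping.lookup (q + rook_monom r R) c = (if c \<in> R then r else Poly_Mapping.lookup q c)"
proof -
  have "finite R" using assms(2) by (simp add: rooks_def)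
  moreover have "c \<in> R \<Longrightarrow> Poly_Mapping.lookup q c = 0"
    using sector_rooks_union(2)[OF assms] by (auto simp: in_keys_iff)
  ultimately show ?thesis by (simp add: lookup_add lookup_rook_monom)
qed

text \<open>The cells of \<open>R\<close> are those whose exponent reaches \<open>r\<close>, as the
  exponents of a sector stay below \<open>r\<close>.\<close>

lemma sector_decomposition_unique:
  assumes "sector n r q" "R \<in> rooks (free_rows n q) (free_cols n q) k"
    and "sector n r q'" "R' \<in> rooks (free_rows n q') (free_cols n q') k'"
    and eq: "q + rook_monom r R = q' + rook_monom r R'"
  shows "q = q'" "R = R'"
proof -
  have "R = {c. r \<le> Poly_Mapping.lookup (q + rook_monom r R) c}"
    unfolding lookup_sector_add[OF assms(1,2)] using sector_lookup_less[OF assms(1)] by auto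
  moreover have "R' = {c. r \<le> Poly_Mapping.lookup (q' + rook_monom r R') c}"
    unfolding lookup_sector_add[OF assms(3,4)] using sector_lookup_less[OF assms(3)] by auto
  ultimately show "R = R'" using eq by simp
  then show "q = q'" using eq by simp
qed

section \<open>Functionals supported on one sector\<close>

text \<open>All monomials outside one sector and one size of placement are sent to 0. Balancedness
  of \<open>f\<close> is what makes the functional descend to the quotient.\<close>

definition sector_functional ::
    "nat \<Rightarrow> nat \<Rightarrow> ((nat \<times> nat) \<Rightarrow>\<^sub>0 nat) \<Rightarrow> nat \<Rightarrow> ((nat \<times> nat) set \<Rightarrow> complex) \<Rightarrow> cpoly \<Rightarrow> complex" where
  "sector_functional n r q k f p =
     (\<Sum>R\<in>rooks (free_rows n q) (free_cols n q) k. f R * Poly_Mapping.lookup p (q + rook_monom r R))"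

lemma sector_functional_add:
  "sector_functional n r q k f (x + y) = sector_functional n r q k f x + sector_functional n r q k f y"
  by (simp add: sector_functional_def lookup_add distrib_left sum.distrib)

lemma sector_functional_0 [simp]: "sector_functional n r q k f 0 = 0"
  by (simp add: sector_functional_def)

lemma sector_functional_sum:
  "sector_functional n r q k f (\<Sum>a\<in>A. g a) = (\<Sum>a\<in>A. sector_functional n r q k f (g a))"
  by (induction A rule: infinite_finite_induct) (auto simp: sector_functional_add)

lemma sector_functional_scale:
  "sector_functional n r q k f (Poly_Mapping.single 0 c * x) = c * sector_functional n r q k f x"
  by (simp add: sector_functional_def sum_distrib_left mult.left_commute)

lemma sector_functional_monomial:
  "sector_functional n r q k f (monomial m) =
     (\<Sum>R | R \<in> rooks (free_rows n q) (free_cols n q) k \<and> m = q + rook_monom r R. f R)"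
proof -
  have "sector_functional n r q k f (monomial m) =
      (\<Sum>R\<in>rooks (free_rows n q) (free_cols n q) k. if m = q + rook_monom r R then f R else 0)"
    unfolding sector_functional_def by (rule sum.cong) (auto simp: lookup_single when_def)
  then show ?thesis
    using finite_rooks[OF finite_free[of n q]] by (simp add: sum.inter_filter)
qed

lemma sector_functional_monomial_eq_0:
  "(\<And>R. R \<in> rooks (free_rows n q) (free_cols n q) k \<Longrightarrow> m \<noteq> q + rook_monom r R) \<Longrightarrow>
     sector_functional n r q k f (monomial m) = 0"
  unfolding sector_functional_monomial by (rule sum.neutral) auto

lemma sector_functional_monomial_eq:
  assumes "0 < r" "R \<in> rooks (free_rows n q) (free_cols n q) k"
  shows "sector_functional n r q k f (monomial (q + rook_monom r R)) = f R"
proof -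
  have "R' = R" if "R' \<in> rooks (free_rows n q) (free_cols n q) k" "q + rook_monom r R = q + rook_monom r R'" for R'
    using rook_monom_inj[of R' R r] that assms by (auto simp: rooks_def)
  then have "{R'. R' \<in> rooks (free_rows n q) (free_cols n q) k \<and> q + rook_monom r R = q + rook_monom r R'} = {R}"
    using assms by auto
  then show ?thesis unfolding sector_functional_monomial by simp
qed

text \<open>Serves rows and columns alike, with \<open>X\<close> the cells of the line. If one
  product of \<open>m\<close> with an \<open>r\<close>-th power lies in the sector, then
  \<open>m\<close> is \<open>q\<close> times the rook monomial of some \<open>T\<close> with one
  rook less, and the sum is the balancing sum at \<open>T\<close>; otherwise every term is
  0.\<close>

lemma sector_functional_line:
  assumes q: "sector n r q" and r: "0 < r" and X: "finite X"
    and bal: "\<And>t T. T \<in> rooks (free_rows n q) (free_cols n q) t \<Longrightarrow> Suc t = k \<Longrightarrow>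
      (\<Sum>c | c \<in> X \<and> c \<notin> T \<and> insert c T \<in> rooks (free_rows n q) (free_cols n q) k. f (insert c T)) = 0"
  shows "(\<Sum>c\<in>X. sector_functional n r q k f (monomial (m + Poly_Mapping.single c r))) = 0"
proof (cases "\<exists>c\<in>X. \<exists>R\<in>rooks (free_rows n q) (free_cols n q) k. m + Poly_Mapping.single c r = q + rook_monom r R")
  case False
  then show ?thesis by (intro sum.neutral ballI sector_functional_monomial_eq_0) auto
next
  case True
  let ?A = "rooks (free_rows n q) (free_cols n q)"
  obtain c0 R0 where c0: "c0 \<in> X" and R0: "R0 \<in> ?A k"
    and eq: "m + Poly_Mapping.single c0 r = q + rook_monom r R0" using True by blast
  have fR0: "finite R0" and cR0: "card R0 = k" using R0 by (auto simp: rooks_def)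
  have "r \<le> Poly_Mapping.lookup (q + rook_monom r R0) c0"
    unfolding eq[symmetric] by (simp add: lookup_add)
  then have c0R: "c0 \<in> R0"
    unfolding lookup_sector_add[OF q R0] using sector_lookup_less[OF q] by (auto split: if_splits)
  define T where "T = R0 - {c0}"
  have fT: "finite T" and c0T: "c0 \<notin> T" and R0T: "R0 = insert c0 T" using fR0 c0R by (auto simp: T_def)
  have T: "T \<in> ?A (card T)" by (rule rooks_subset(1)[OF R0]) (auto simp: T_def)
  have k: "Suc (card T) = k" using cR0 fT c0T by (simp add: R0T)
  have m: "m = q + rook_monom r T"
    using eq unfolding R0T rook_monom_insert[OF fT c0T] by (simp add: add.assoc[symmetric])
  have val: "sector_functional n r q k f (monomial (m + Poly_Mapping.single c r)) =
      (if c \<notin> T \<and> insert c T \<in> ?A k then f (insert c T) else 0)" for c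
  proof (cases "c \<in> T")
    case True
    \<comment> \<open>A cell of \<open>T\<close> would receive \<open>2 * r\<close> from the
      \<open>r\<close>-th powers, while a rook monomial gives at most \<open>r\<close>.\<close>
    have "m + Poly_Mapping.single c r \<noteq> q + rook_monom r R" if "R \<in> ?A k" for R
    proof
      assume "m + Poly_Mapping.single c r = q + rook_monom r R"
      then have "Poly_Mapping.lookup (rook_monom r T + Poly_Mapping.single c r) c =
          Poly_Mapping.lookup (rook_monom r R) c" unfolding m by (simp add: add.assoc)
      then show False using True fT that r by (auto simp: lookup_add lookup_rook_monom rooks_def split: if_splits)
    qed
    then show ?thesis using True by (simp add: sector_functional_monomial_eq_0)
  next
    case False
    have mc: "m + Poly_Mapping.single c r = q + rook_monom r (insert c T)"
      unfolding m rook_monom_insert[OF fT False] by (simp add: add.assoc)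
    show ?thesis
    proof (cases "insert c T \<in> ?A k")
      case True
      then show ?thesis unfolding mc using False by (simp add: sector_functional_monomial_eq[OF r])
    next
      case nA: False
      have "q + rook_monom r (insert c T) \<noteq> q + rook_monom r R" if "R \<in> ?A k" for R
        using rook_monom_inj[of "insert c T" R r] that nA r fT by (auto simp: rooks_def)
      then show ?thesis unfolding mc using nA by (simp add: sector_functional_monomial_eq_0)
    qed
  qed
  show ?thesis unfolding val using bal[OF T k] X by (simp add: sum.inter_filter)
qed

text \<open>The cells of row \<open>i\<close> that extend \<open>T\<close> are those in unoccupied
  columns; if the row is already taken, by \<open>q\<close> or by \<open>T\<close>, no cell extends
  it and the balancing sum is empty.\<close>

lemma sector_functional_row:
  assumes q: "sector n r q" and r: "0 < r" and i: "i \<in> {1..n}"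
    and bal: "row_balanced (free_rows n q) (free_cols n q) k f"
  shows "(\<Sum>j = 1..n. sector_functional n r q k f (monomial (m + Poly_Mapping.single (i, j) r))) = 0"
proof -
  let ?X = "Pair i ` {1..n}"
  have "(\<Sum>c\<in>?X. sector_functional n r q k f (monomial (m + Poly_Mapping.single c r))) = 0"
  proof (rule sector_functional_line[OF q r])
    fix t T assume T: "T \<in> rooks (free_rows n q) (free_cols n q) t" "Suc t = k"
    let ?S = "{c. c \<in> ?X \<and> c \<notin> T \<and> insert c T \<in> rooks (free_rows n q) (free_cols n q) k}"
    show "(\<Sum>c\<in>?S. f (insert c T)) = 0"
    proof (cases "i \<in> free_rows n q - fst ` T")
      case True
      have "?S = Pair i ` (free_cols n q - snd ` T)"
      proof (intro equalityI subsetI)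
        fix c assume "c \<in> ?S"
        then obtain j where c: "c = (i, j)" "c \<notin> T" and R: "insert c T \<in> rooks (free_rows n q) (free_cols n q) k" by auto
        have "insert c T - T \<in> rooks (free_rows n q - fst ` T) (free_cols n q - snd ` T) (k - card T)"
          by (rule rooks_subset(2)[OF R]) auto
        moreover have "insert c T - T = {(i, j)}" using c by auto
        ultimately show "c \<in> Pair i ` (free_cols n q - snd ` T)" using c by (auto simp: rooks_def)
      next
        fix c assume "c \<in> Pair i ` (free_cols n q - snd ` T)"
        then obtain j where c: "c = (i, j)" "j \<in> free_cols n q - snd ` T" by auto
        have "insert c T \<in> rooks (free_rows n q) (free_cols n q) k"
          using rooks_insert[OF T(1) True c(2)] c(1) T(2) by simp
        moreover have "c \<notin> T" using c True by force
        moreover have "j \<in> {1..n}" using c(2) by (auto simp: free_cols_def)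
        ultimately show "c \<in> ?S" using c(1) by auto
      qed
      then have "(\<Sum>c\<in>?S. f (insert c T)) = (\<Sum>j\<in>free_cols n q - snd ` T. f (insert (i, j) T))"
        by (simp add: sum.reindex inj_on_def)
      then show ?thesis using bal T True unfolding row_balanced_def by simp
    next
      case False
      have "?S = {}"
      proof (rule ccontr)
        assume "?S \<noteq> {}"
        then obtain j where c: "(i, j) \<notin> T" and R: "insert (i, j) T \<in> rooks (free_rows n q) (free_cols n q) k" by auto
        have "insert (i, j) T - T \<in> rooks (free_rows n q - fst ` T) (free_cols n q - snd ` T) (k - card T)"
          by (rule rooks_subset(2)[OF R]) auto
        moreover have "insert (i, j) T - T = {(i, j)}" using c by auto
        ultimately show False using False by (auto simp: rooks_def)
      qed
      then show ?thesis by (simp only: sum.empty)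
    qed
  qed simp
  then show ?thesis by (simp add: sum.reindex inj_on_def)
qed

lemma sector_functional_col:
  assumes q: "sector n r q" and r: "0 < r" and j: "j \<in> {1..n}"
    and bal: "col_balanced (free_rows n q) (free_cols n q) k f"
  shows "(\<Sum>i = 1..n. sector_functional n r q k f (monomial (m + Poly_Mapping.single (i, j) r))) = 0"
proof -
  let ?X = "(\<lambda>i. (i, j)) ` {1..n}"
  have "(\<Sum>c\<in>?X. sector_functional n r q k f (monomial (m + Poly_Mapping.single c r))) = 0"
  proof (rule sector_functional_line[OF q r])
    fix t T assume T: "T \<in> rooks (free_rows n q) (free_cols n q) t" "Suc t = k"
    let ?S = "{c. c \<in> ?X \<and> c \<notin> T \<and> insert c T \<in> rooks (free_rows n q) (free_cols n q) k}"
    show "(\<Sum>c\<in>?S. f (insert c T)) = 0"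
    proof (cases "j \<in> free_cols n q - snd ` T")
      case True
      have "?S = (\<lambda>i. (i, j)) ` (free_rows n q - fst ` T)"
      proof (intro equalityI subsetI)
        fix c assume "c \<in> ?S"
        then obtain i where c: "c = (i, j)" "c \<notin> T" and R: "insert c T \<in> rooks (free_rows n q) (free_cols n q) k" by auto
        have "insert c T - T \<in> rooks (free_rows n q - fst ` T) (free_cols n q - snd ` T) (k - card T)"
          by (rule rooks_subset(2)[OF R]) auto
        moreover have "insert c T - T = {(i, j)}" using c by auto
        ultimately show "c \<in> (\<lambda>i. (i, j)) ` (free_rows n q - fst ` T)" using c by (auto simp: rooks_def)
      next
        fix c assume "c \<in> (\<lambda>i. (i, j)) ` (free_rows n q - fst ` T)"
        then obtain i where c: "c = (i, j)" "i \<in> free_rows n q - fst ` T" by auto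
        have "insert c T \<in> rooks (free_rows n q) (free_cols n q) k"
          using rooks_insert[OF T(1) c(2) True] c(1) T(2) by simp
        moreover have "c \<notin> T" using c True by force
        moreover have "i \<in> {1..n}" using c(2) by (auto simp: free_rows_def)
        ultimately show "c \<in> ?S" using c(1) by auto
      qed
      then have "(\<Sum>c\<in>?S. f (insert c T)) = (\<Sum>i\<in>free_rows n q - fst ` T. f (insert (i, j) T))"
        by (simp add: sum.reindex inj_on_def)
      then show ?thesis using bal T True unfolding col_balanced_def by simp
    next
      case False
      have "?S = {}"
      proof (rule ccontr)
        assume "?S \<noteq> {}"
        then obtain i where c: "(i, j) \<notin> T" and R: "insert (i, j) T \<in> rooks (free_rows n q) (free_cols n q) k" by auto
        have "insert (i, j) T - T \<in> rooks (free_rows n q - fst ` T) (free_cols n q - snd ` T) (k - card T)"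
          by (rule rooks_subset(2)[OF R]) auto
        moreover have "insert (i, j) T - T = {(i, j)}" using c by auto
        ultimately show False using False by (auto simp: rooks_def)
      qed
      then show ?thesis by (simp only: sum.empty)
    qed
  qed simp
  then show ?thesis by (simp add: sum.reindex inj_on_def)
qed

section \<open>The ideal and the functionals that annihilate it\<close>

lemma monomial_matrix_polys: "monomial m \<in> matrix_polys n \<longleftrightarrow> Poly_Mapping.keys m \<subseteq> {1..n} \<times> {1..n}"
  by (simp add: matrix_polys_def)

lemma xvar_matrix_polys: "i \<in> {1..n} \<Longrightarrow> j \<in> {1..n} \<Longrightarrow> xvar i j ^ k \<in> matrix_polys n"
  by (auto simp: xvar_power monomial_matrix_polys in_keys_iff lookup_single when_def split: if_splits)

lemma matrix_polys_sum: "(\<And>a. a \<in> A \<Longrightarrow> g a \<in> matrix_polys n) \<Longrightarrow> (\<Sum>a\<in>A. g a) \<in> matrix_polys n"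
  by (induction A rule: infinite_finite_induct) (auto simp: matrix_polys_0 matrix_polys_add)

lemma colored_perm_gens_subset: "colored_perm_gens n r \<subseteq> matrix_polys n"
proof -
  have x: "xvar i j \<in> matrix_polys n" if "i \<in> {1..n}" "j \<in> {1..n}" for i j
    using xvar_matrix_polys[OF that, of 1] by simp
  show ?thesis
    unfolding colored_perm_gens_def
    by (auto intro!: matrix_polys_mult matrix_polys_sum xvar_matrix_polys x simp del: power_Suc)
qed

lemma colored_perm_gensI:
  assumes "i \<in> {1..n}" "j \<in> {1..n}"
  shows "xvar i j ^ (r + 1) \<in> colored_perm_gens n r"
    and "j' \<in> {1..n} \<Longrightarrow> j < j' \<Longrightarrow> xvar i j * xvar i j' \<in> colored_perm_gens n r"
    and "i' \<in> {1..n} \<Longrightarrow> i < i' \<Longrightarrow> xvar i j * xvar i' j \<in> colored_perm_gens n r"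
    and "(\<Sum>j = 1..n. xvar i j ^ r) \<in> colored_perm_gens n r"
    and "(\<Sum>i = 1..n. xvar i j ^ r) \<in> colored_perm_gens n r"
  unfolding colored_perm_gens_def using assms by blast+

lemma ideal_colored_perm_ideal: "ideal (colored_perm_ideal n r) (matrix_poly_ring n)"
proof -
  interpret R: cring "matrix_poly_ring n" by (rule cring_matrix_poly_ring)
  show ?thesis
    unfolding colored_perm_ideal_def by (rule R.genideal_ideal) (simp add: colored_perm_gens_subset)
qed

lemma colored_perm_ideal_closed:
  shows colored_perm_ideal_0: "0 \<in> colored_perm_ideal n r"
    and colored_perm_ideal_add: "x \<in> colored_perm_ideal n r \<Longrightarrow> y \<in> colored_perm_ideal n r \<Longrightarrow> x + y \<in> colored_perm_ideal n r"
    and colored_perm_ideal_mult: "p \<in> matrix_polys n \<Longrightarrow> x \<in> colored_perm_ideal n r \<Longrightarrow> p * x \<in> colored_perm_ideal n r"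
    and colored_perm_ideal_gens: "g \<in> colored_perm_gens n r \<Longrightarrow> g \<in> colored_perm_ideal n r"
proof -
  interpret R: cring "matrix_poly_ring n" by (rule cring_matrix_poly_ring)
  interpret I: ideal "colored_perm_ideal n r" "matrix_poly_ring n" by (rule ideal_colored_perm_ideal)
  show "0 \<in> colored_perm_ideal n r" using I.zero_closed by simp
  show "x + y \<in> colored_perm_ideal n r" if "x \<in> colored_perm_ideal n r" "y \<in> colored_perm_ideal n r"
    using I.a_closed[OF that] by simp
  show "p * x \<in> colored_perm_ideal n r" if "p \<in> matrix_polys n" "x \<in> colored_perm_ideal n r"
    using I.I_l_closed[of x p] that by simp
  show "g \<in> colored_perm_ideal n r" if "g \<in> colored_perm_gens n r"
    using R.genideal_self[of "colored_perm_gens n r"] colored_perm_gens_subset that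
    unfolding colored_perm_ideal_def by auto
qed

lemma colored_perm_ideal_minimal:
  assumes sub: "N \<subseteq> matrix_polys n" and zero: "0 \<in> N"
    and add: "\<And>x y. x \<in> N \<Longrightarrow> y \<in> N \<Longrightarrow> x + y \<in> N"
    and mult: "\<And>p x. p \<in> matrix_polys n \<Longrightarrow> x \<in> N \<Longrightarrow> p * x \<in> N"
    and gens: "colored_perm_gens n r \<subseteq> N"
  shows "colored_perm_ideal n r \<subseteq> N"
proof -
  interpret R: cring "matrix_poly_ring n" by (rule cring_matrix_poly_ring)
  have uminus: "- x \<in> N" if "x \<in> N" for x
    using mult[OF matrix_polys_uminus[OF matrix_polys_1] that] by simp
  have inv: "inv\<^bsub>add_monoid (matrix_poly_ring n)\<^esub> x = - x" if "x \<in> N" for x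
    using R.minus_equality[of "- x" x] that sub by (auto simp: a_inv_def matrix_polys_uminus)
  have "ideal N (matrix_poly_ring n)"
  proof (rule idealI[OF R.ring_axioms])
    show "subgroup N (add_monoid (matrix_poly_ring n))"
      by unfold_locales (use sub zero add uminus inv in auto)
    fix a x assume "a \<in> N" "x \<in> carrier (matrix_poly_ring n)"
    then have "x * a \<in> N" by (intro mult) auto
    then show "x \<otimes>\<^bsub>matrix_poly_ring n\<^esub> a \<in> N" "a \<otimes>\<^bsub>matrix_poly_ring n\<^esub> x \<in> N"
      by (simp_all add: mult.commute)
  qed
  then show ?thesis unfolding colored_perm_ideal_def by (rule R.genideal_minimal[OF _ gens])
qed

text \<open>Serves to show that no monomial generator of the ideal divides a monomial of a
  sector.\<close>

lemma sector_monomial_not_multiple: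
  assumes q: "sector n r q" and R: "R \<in> rooks (free_rows n q) (free_cols n q) k"
    and m: "m = q + rook_monom r R"
  shows "Poly_Mapping.lookup m c \<le> r"
    and "(i, j) \<in> Poly_Mapping.keys m \<Longrightarrow> (i, j') \<in> Poly_Mapping.keys m \<Longrightarrow> j = j'"
    and "(i, j) \<in> Poly_Mapping.keys m \<Longrightarrow> (i', j) \<in> Poly_Mapping.keys m \<Longrightarrow> i = i'"
proof -
  show "Poly_Mapping.lookup m c \<le> r"
    unfolding m lookup_sector_add[OF q R] using sector_lookup_less[OF q, of c] by simp
  have sub: "Poly_Mapping.keys m \<subseteq> Poly_Mapping.keys q \<union> R"
    unfolding m using lookup_sector_add[OF q R] by (auto simp: in_keys_iff)
  note U = sector_rooks_union(1)[OF q R]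
  show "(i, j) \<in> Poly_Mapping.keys m \<Longrightarrow> (i, j') \<in> Poly_Mapping.keys m \<Longrightarrow> j = j'"
    using sub rooks_unique_col[OF U] by blast
  show "(i, j) \<in> Poly_Mapping.keys m \<Longrightarrow> (i', j) \<in> Poly_Mapping.keys m \<Longrightarrow> i = i'"
    using sub rooks_unique_row[OF U] by blast
qed

text \<open>The kernel of a functional need not be an ideal, so the larger requirement is imposed
  that all monomial multiples of \<open>p\<close> be killed. Multiples of the monomial generators
  miss the sector; multiples of the line sums are killed by balancedness.\<close>

lemma sector_functional_ideal:
  assumes q: "sector n r q" and r: "0 < r"
    and bal: "row_balanced (free_rows n q) (free_cols n q) k f" "col_balanced (free_rows n q) (free_cols n q) k f"
    and p: "p \<in> colored_perm_ideal n r"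
  shows "sector_functional n r q k f p = 0"
proof -
  let ?\<psi> = "sector_functional n r q k f"
  let ?N = "{p \<in> matrix_polys n. \<forall>m. ?\<psi> (monomial m * p) = 0}"
  have "colored_perm_ideal n r \<subseteq> ?N"
  proof (rule colored_perm_ideal_minimal)
    show "x + y \<in> ?N" if "x \<in> ?N" "y \<in> ?N" for x y
      using that by (auto simp: matrix_polys_add distrib_left sector_functional_add)
    show "p * x \<in> ?N" if p: "p \<in> matrix_polys n" and x: "x \<in> ?N" for p x
    proof -
      have "?\<psi> (monomial m * (p * x)) = 0" for m
      proof -
        have "monomial m * (p * x) = (\<Sum>a\<in>Poly_Mapping.keys p.
            Poly_Mapping.single 0 (Poly_Mapping.lookup p a) * (monomial (m + a) * x))"
          by (subst poly_mapping_sum_monomials[of p])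
            (simp add: sum_distrib_left sum_distrib_right monomial_mult[symmetric] mult_ac)
        then show ?thesis
          using x by (simp only: sector_functional_sum sector_functional_scale) auto
      qed
      then show ?thesis using p x by (auto simp: matrix_polys_mult)
    qed
    show "colored_perm_gens n r \<subseteq> ?N"
    proof
      fix g assume g: "g \<in> colored_perm_gens n r"
      have "?\<psi> (monomial m * g) = 0" for m
        using g unfolding colored_perm_gens_def
      proof (elim UnE)
        assume "g \<in> {xvar i j ^ (r + 1) | i j. i \<in> {1..n} \<and> j \<in> {1..n}}"
        then obtain i j where g: "g = monomial (Poly_Mapping.single (i, j) (r + 1))"
          using xvar_power by blast
        show ?thesis
          unfolding g monomial_mult
        proof (rule sector_functional_monomial_eq_0, rule notI)
          fix R assume R: "R \<in> rooks (free_rows n q) (free_cols n q) k"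
            "m + Poly_Mapping.single (i, j) (r + 1) = q + rook_monom r R"
          from sector_monomial_not_multiple(1)[OF q R, of "(i, j)"]
          show False by (simp add: lookup_add)
        qed
      next
        assume "g \<in> {xvar i j * xvar i j' | i j j'. i \<in> {1..n} \<and> j \<in> {1..n} \<and> j' \<in> {1..n} \<and> j < j'}"
        then obtain i j j' where g: "g = monomial (Poly_Mapping.single (i, j) 1 + Poly_Mapping.single (i, j') 1)" "j < j'"
          using monomial_mult unfolding xvar_def by blast
        show ?thesis
          unfolding g monomial_mult
        proof (rule sector_functional_monomial_eq_0, rule notI)
          fix R assume R: "R \<in> rooks (free_rows n q) (free_cols n q) k"
            "m + (Poly_Mapping.single (i, j) 1 + Poly_Mapping.single (i, j') 1) = q + rook_monom r R"
          from sector_monomial_not_multiple(2)[OF q R, of i j j'] g(2)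
          show False by (simp add: in_keys_iff lookup_add)
        qed
      next
        assume "g \<in> {xvar i j * xvar i' j | i i' j. i \<in> {1..n} \<and> i' \<in> {1..n} \<and> j \<in> {1..n} \<and> i < i'}"
        then obtain i i' j where g: "g = monomial (Poly_Mapping.single (i, j) 1 + Poly_Mapping.single (i', j) 1)" "i < i'"
          using monomial_mult unfolding xvar_def by blast
        show ?thesis
          unfolding g monomial_mult
        proof (rule sector_functional_monomial_eq_0, rule notI)
          fix R assume R: "R \<in> rooks (free_rows n q) (free_cols n q) k"
            "m + (Poly_Mapping.single (i, j) 1 + Poly_Mapping.single (i', j) 1) = q + rook_monom r R"
          from sector_monomial_not_multiple(3)[OF q R, of i j i'] g(2)
          show False by (simp add: in_keys_iff lookup_add)
        qed
      next
        assume "g \<in> {\<Sum>j = 1..n. xvar i j ^ r | i. i \<in> {1..n}}"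
        then obtain i where i: "i \<in> {1..n}" "g = (\<Sum>j = 1..n. xvar i j ^ r)" by blast
        have "monomial m * g = (\<Sum>j = 1..n. monomial (m + Poly_Mapping.single (i, j) r))"
          unfolding i(2) xvar_power sum_distrib_left monomial_mult ..
        then show ?thesis
          using sector_functional_row[OF q r i(1) bal(1)] by (simp add: sector_functional_sum)
      next
        assume "g \<in> {\<Sum>i = 1..n. xvar i j ^ r | j. j \<in> {1..n}}"
        then obtain j where j: "j \<in> {1..n}" "g = (\<Sum>i = 1..n. xvar i j ^ r)" by blast
        have "monomial m * g = (\<Sum>i = 1..n. monomial (m + Poly_Mapping.single (i, j) r))"
          unfolding j(2) xvar_power sum_distrib_left monomial_mult ..
        then show ?thesis
          using sector_functional_col[OF q r j(1) bal(2)] by (simp add: sector_functional_sum)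
      qed
      then show "g \<in> ?N" using g colored_perm_gens_subset by auto
    qed
  qed (auto simp: matrix_polys_0)
  then have "?\<psi> (monomial 0 * p) = 0" using p by blast
  then show ?thesis by simp
qed

text \<open>The constant coefficient is a sector functional of degree 0, where balancedness is
  vacuous, and it takes the value 1 at 1.\<close>

lemma colored_perm_ideal_proper:
  assumes "0 < r"
  shows "1 \<notin> colored_perm_ideal n r"
proof
  assume 1: "1 \<in> colored_perm_ideal n r"
  have q: "sector n r 0" using assms by (auto simp: sector_def intro!: exI[of _ 0])
  have bal: "row_balanced (free_rows n 0) (free_cols n 0) 0 (\<lambda>_. 1 :: complex)"
    "col_balanced (free_rows n 0) (free_cols n 0) 0 (\<lambda>_. 1 :: complex)"
    by (auto simp: row_balanced_def col_balanced_def)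
  have "sector_functional n r 0 0 (\<lambda>_. 1) 1 = 1"
    by (simp add: sector_functional_def rook_monom_def)
  then show False using sector_functional_ideal[OF q assms bal 1] by simp
qed

lemma monomial_ideal:
  assumes m: "Poly_Mapping.keys m \<subseteq> {1..n} \<times> {1..n}"
    and g: "monomial g \<in> colored_perm_ideal n r" "\<And>c. Poly_Mapping.lookup g c \<le> Poly_Mapping.lookup m c"
  shows "monomial m \<in> colored_perm_ideal n r"
proof -
  have "m = (m - g) + g"
    by (rule poly_mapping_eqI) (use g(2) in \<open>simp add: lookup_add lookup_minus\<close>)
  moreover have "Poly_Mapping.keys (m - g) \<subseteq> Poly_Mapping.keys m"
    by (auto simp: in_keys_iff lookup_minus)
  then have "Poly_Mapping.keys (m - g) \<subseteq> {1..n} \<times> {1..n}" using m by (rule subset_trans)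
  ultimately show ?thesis
    using colored_perm_ideal_mult[OF _ g(1), of "monomial (m - g)"] monomial_matrix_polys
    by (metis monomial_mult)
qed

text \<open>The generators \<open>xvar i j ^ (r + 1)\<close> bound the exponents, and the products
  of two variables force the support to be a rook placement. The surviving monomials split into the
  cells with exponent below \<open>r\<close> and those with exponent equal to
  \<open>r\<close>.\<close>

lemma monomial_ideal_cases:
  assumes m: "Poly_Mapping.keys m \<subseteq> {1..n} \<times> {1..n}" and r: "0 < r"
    and not: "monomial m \<notin> colored_perm_ideal n r"
  obtains q R where "sector n r q" "R \<in> rooks (free_rows n q) (free_cols n q) (card R)"
    "m = q + rook_monom r R"
proof -
  let ?I = "colored_perm_ideal n r"
  let ?K = "Poly_Mapping.keys m"
  have fK: "finite ?K" by simp
  have le: "Poly_Mapping.lookup m c \<le> r" for c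
  proof (rule ccontr)
    assume "\<not> Poly_Mapping.lookup m c \<le> r"
    then have gt: "r + 1 \<le> Poly_Mapping.lookup m c" by simp
    then have "c \<in> ?K" by (simp add: in_keys_iff)
    then have "fst c \<in> {1..n}" "snd c \<in> {1..n}" using m by auto
    then have "xvar (fst c) (snd c) ^ (r + 1) \<in> ?I"
      by (intro colored_perm_ideal_gens colored_perm_gensI(1))
    then have "monomial (Poly_Mapping.single c (r + 1)) \<in> ?I" unfolding xvar_power by simp
    moreover have "Poly_Mapping.lookup (Poly_Mapping.single c (r + 1)) d \<le> Poly_Mapping.lookup m d" for d
      using gt by (auto simp: lookup_single when_def)
    ultimately show False using monomial_ideal[OF m] not by blast
  qed
  have pair: "False" if "c \<in> ?K" "c' \<in> ?K" "c \<noteq> c'" "fst c = fst c' \<or> snd c = snd c'" for c c'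
  proof -
    have one: "monomial (Poly_Mapping.single d 1 + Poly_Mapping.single d' 1) \<in> ?I"
      if d: "d \<in> ?K" "d' \<in> ?K" "fst d = fst d' \<and> snd d < snd d' \<or> snd d = snd d' \<and> fst d < fst d'" for d d'
    proof -
      obtain i j i' j' where dd: "d = (i, j)" "d' = (i', j')" by (cases d, cases d')
      have rng: "i \<in> {1..n}" "j \<in> {1..n}" "i' \<in> {1..n}" "j' \<in> {1..n}" using d(1,2) m dd by auto
      have "xvar i j * xvar i' j' \<in> colored_perm_gens n r"
        using d(3) colored_perm_gensI(2)[OF rng(1,2,4)] colored_perm_gensI(3)[OF rng(1,2,3)]
        by (auto simp: dd)
      then show ?thesis using colored_perm_ideal_gens[of _ n r] by (simp add: xvar_def monomial_mult dd)
    qed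
    have "fst c = fst c' \<and> snd c < snd c' \<or> snd c = snd c' \<and> fst c < fst c' \<or>
        fst c' = fst c \<and> snd c' < snd c \<or> snd c' = snd c \<and> fst c' < fst c"
      using that(3,4) by (cases c, cases c') auto
    then have "monomial (Poly_Mapping.single c 1 + Poly_Mapping.single c' 1) \<in> ?I"
      using one[OF that(1,2)] one[OF that(2,1)] by (auto simp: add.commute)
    moreover have "Poly_Mapping.lookup (Poly_Mapping.single c 1 + Poly_Mapping.single c' 1) d \<le> Poly_Mapping.lookup m d" for d
      using that(1-3) by (auto simp: lookup_add lookup_single when_def in_keys_iff)
    ultimately show False using monomial_ideal[OF m] not by blast
  qed
  have rook: "?K \<in> rooks {1..n} {1..n} (card ?K)"
    using m pair by (simp add: rooks_def inj_on_def) blast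
  define R where "R = {c \<in> ?K. Poly_Mapping.lookup m c = r}"
  define q where "q = m - rook_monom r R"
  have RK: "R \<subseteq> ?K" and fR: "finite R" using fK by (auto simp: R_def)
  have lq: "Poly_Mapping.lookup q c = (if c \<in> R then 0 else Poly_Mapping.lookup m c)" for c
    unfolding q_def by (auto simp: lookup_minus lookup_rook_monom fR R_def)
  have Kq: "Poly_Mapping.keys q = ?K - R" by (auto simp: in_keys_iff lq split: if_splits)
  have "Poly_Mapping.lookup q c < r" for c
    using le[of c] r by (cases "c \<in> ?K") (auto simp: lq R_def in_keys_iff le_less)
  then have "sector n r q"
    using rooks_subset(1)[OF rook, of "?K - R"] unfolding sector_def Kq by auto
  moreover have "R \<in> rooks (free_rows n q) (free_cols n q) (card R)"
  proof -
    have "?K - (?K - R) \<in> rooks ({1..n} - fst ` (?K - R)) ({1..n} - snd ` (?K - R)) (card ?K - card (?K - R))"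
      by (rule rooks_subset(2)[OF rook]) auto
    moreover have "?K - (?K - R) = R" using RK by auto
    ultimately show ?thesis unfolding free_rows_def free_cols_def Kq by (simp add: rooks_def)
  qed
  moreover have "m = q + rook_monom r R"
    by (rule poly_mapping_eqI) (auto simp: lookup_add lq lookup_rook_monom fR, auto simp: R_def)
  ultimately show ?thesis by (rule that)
qed

section \<open>The monomial basis\<close>

text \<open>Cells of colour 0 get exponent 0 and leave the support, so their rows and columns are
  the free ones of the sector.\<close>

definition color_part :: "nat \<Rightarrow> (nat \<Rightarrow> nat) \<times> (nat \<Rightarrow> nat) \<Rightarrow> (nat \<times> nat) \<Rightarrow>\<^sub>0 nat" where
  "color_part n w = (\<Sum>i = 1..n. Poly_Mapping.single (i, fst w i) (snd w (fst w i)))"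

definition perm_monom :: "nat \<Rightarrow> nat \<Rightarrow> (nat \<Rightarrow> nat) \<times> (nat \<Rightarrow> nat) \<Rightarrow> (nat \<times> nat) \<Rightarrow>\<^sub>0 nat" where
  "perm_monom n r w = color_part n w + rook_monom r (residual (color_class n 0 w))"

lemma finite_colored_perms: "finite (colored_perms n r)"
  unfolding colored_perms_def by (intro finite_cartesian_product finite_permutations finite_PiE) auto

lemma colored_permsD:
  assumes "w \<in> colored_perms n r"
  shows "fst w permutes {1..n}" "i \<in> {1..n} \<Longrightarrow> snd w (fst w i) < r"
    "snd w \<in> extensional {1..n}"
proof -
  show 1: "fst w permutes {1..n}" using assms by (auto simp: colored_perms_def)
  show "i \<in> {1..n} \<Longrightarrow> snd w (fst w i) < r"
    using assms permutes_in_image[OF 1, of i] by (auto simp: colored_perms_def dest: PiE_mem)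
  show "snd w \<in> extensional {1..n}" using assms by (auto simp: colored_perms_def PiE_def)
qed

lemma lookup_color_part:
  "Poly_Mapping.lookup (color_part n w) (i, j) = (if i \<in> {1..n} \<and> j = fst w i then snd w j else 0)"
proof -
  have "Poly_Mapping.lookup (color_part n w) (i, j) =
      (\<Sum>i' = 1..n. if i' = i then (if j = fst w i then snd w j else 0) else 0)"
    unfolding color_part_def lookup_sum by (rule sum.cong) (auto simp: lookup_single when_def)
  then show ?thesis by (simp add: sum.delta)
qed

lemma keys_color_part: "Poly_Mapping.keys (color_part n w) = {(i, fst w i) | i. i \<in> {1..n} \<and> snd w (fst w i) \<noteq> 0}"
  by (auto simp: in_keys_iff lookup_color_part split: if_splits)

lemma graph_rooks:
  assumes "\<sigma> permutes X" "finite X" "A \<subseteq> X"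
  shows "{(i, \<sigma> i) | i. i \<in> A} \<in> rooks X X (card A)"
proof -
  let ?g = "\<lambda>i. (i, \<sigma> i)"
  have eq: "{(i, \<sigma> i) | i. i \<in> A} = ?g ` A" by auto
  have "inj_on ?g A" by (auto simp: inj_on_def)
  then have c: "card (?g ` A) = card A" by (rule card_image)
  have inj: "inj_on fst (?g ` A)" "inj_on snd (?g ` A)"
    using permutes_inj_on[OF assms(1), of A] by (auto simp: inj_on_def)
  have fin: "finite (?g ` A)" using assms(2,3) finite_subset by blast
  have "\<sigma> ` A \<subseteq> X" using permutes_image[OF assms(1)] assms(3) by blast
  then have "?g ` A \<subseteq> X \<times> X" using assms(3) by auto
  then show ?thesis unfolding eq rooks_def using c inj fin by (intro CollectI conjI)
qed

lemma color_class_0_eq: "color_class n 0 w = {(i, fst w i) | i. i \<in> {1..n}} - Poly_Mapping.keys (color_part n w)"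
  unfolding keys_color_part color_class_def by auto

lemma colored_perm_sector:
  assumes w: "w \<in> colored_perms n r" and r: "0 < r"
  shows sector_color_part: "sector n r (color_part n w)"
    and color_class_perfect: "color_class n 0 w \<in> rooks (free_rows n (color_part n w)) (free_cols n (color_part n w))
      (card (free_rows n (color_part n w)))"
proof -
  note p = colored_permsD[OF w]
  let ?q = "color_part n w"
  let ?A = "{i \<in> {1..n}. snd w (fst w i) \<noteq> 0}"
  have K: "Poly_Mapping.keys ?q = {(i, fst w i) | i. i \<in> ?A}" unfolding keys_color_part by auto
  have rK: "Poly_Mapping.keys ?q \<in> rooks {1..n} {1..n} (card ?A)"
    unfolding K by (rule graph_rooks[OF p(1)]) auto
  have lt: "Poly_Mapping.lookup ?q c < r" for c
    using p(2) r by (cases c) (auto simp: lookup_color_part)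
  show s: "sector n r ?q" unfolding sector_def using rK lt by blast
  have "{(i, fst w i) | i. i \<in> {1..n}} \<in> rooks {1..n} {1..n} (card {1..n})"
    by (rule graph_rooks[OF p(1)]) auto
  then have "{(i, fst w i) | i. i \<in> {1..n}} - Poly_Mapping.keys ?q \<in>
      rooks (free_rows n ?q) (free_cols n ?q) (card {1..n} - card (Poly_Mapping.keys ?q))"
    unfolding free_rows_def free_cols_def by (rule rooks_subset(2)) (auto simp: K)
  moreover have "card {1..n} - card (Poly_Mapping.keys ?q) = card (free_rows n ?q)"
    using card_free(2)[OF s] by simp
  ultimately show "color_class n 0 w \<in> rooks (free_rows n ?q) (free_cols n ?q) (card (free_rows n ?q))"
    unfolding color_class_0_eq by simp
qed

text \<open>The support of the colour part and the class of colour 0 together form the graph of the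
  permutation; the exponents then give the colours.\<close>

lemma colored_perm_unique:
  assumes w: "w \<in> colored_perms n r" and w': "w' \<in> colored_perms n r"
    and eq: "color_part n w = color_part n w'" "color_class n 0 w = color_class n 0 w'"
  shows "w = w'"
proof -
  note p = colored_permsD[OF w] and p' = colored_permsD[OF w']
  have graph: "{(i, fst v i) | i. i \<in> {1..n}} = Poly_Mapping.keys (color_part n v) \<union> color_class n 0 v" for v
    unfolding color_class_0_eq by (auto simp: keys_color_part)
  have "{(i, fst w i) | i. i \<in> {1..n}} = {(i, fst w' i) | i. i \<in> {1..n}}"
    unfolding graph eq ..
  then have "fst w i = fst w' i" if "i \<in> {1..n}" for i using that by blast
  moreover have "fst w i = fst w' i" if "i \<notin> {1..n}" for i
    using that permutes_not_in[OF p(1)] permutes_not_in[OF p'(1)] by simp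
  ultimately have f: "fst w = fst w'" by blast
  have "snd w = snd w'"
  proof (rule extensionalityI[OF p(3) p'(3)])
    fix j assume "j \<in> {1..n}"
    then have "j \<in> fst w ` {1..n}" by (simp only: permutes_image[OF p(1)])
    then obtain i where i: "i \<in> {1..n}" "j = fst w i" by blast
    have "Poly_Mapping.lookup (color_part n w) (i, j) = Poly_Mapping.lookup (color_part n w') (i, j)"
      using eq(1) by simp
    then show "snd w j = snd w' j" using i f by (simp add: lookup_color_part)
  qed
  then show ?thesis using f by (simp add: prod_eq_iff)
qed

text \<open>The support of \<open>q\<close> and the perfect placement \<open>G\<close> of the free
  rows and columns join to the graph of a permutation, whose colours are the exponents of
  \<open>q\<close>.\<close>

lemma colored_perm_exists:
  assumes q: "sector n r q"
    and G: "G \<in> rooks (free_rows n q) (free_cols n q) (card (free_rows n q))"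
  shows "\<exists>w\<in>colored_perms n r. color_part n w = q \<and> color_class n 0 w = G"
proof -
  define H where "H = Poly_Mapping.keys q \<union> G"
  have H: "H \<in> rooks {1..n} {1..n} (card {1..n})" and dis: "Poly_Mapping.keys q \<inter> G = {}"
    using sector_rooks_union[OF q G] card_free(2)[OF q] by (simp_all add: H_def add.commute)
  have im: "fst ` H = {1..n}" using perfect_rooks_images(1)[OF _ _ _ H] by simp
  have "\<exists>j. (i, j) \<in> H" if "i \<in> {1..n}" for i using that im by force
  then obtain s where s: "\<And>i. i \<in> {1..n} \<Longrightarrow> (i, s i) \<in> H" by metis
  define \<sigma> where "\<sigma> = (\<lambda>i. if i \<in> {1..n} then s i else i)"
  have \<sigma>H: "(i, j) \<in> H \<longleftrightarrow> i \<in> {1..n} \<and> j = \<sigma> i" for i j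
  proof
    assume ij: "(i, j) \<in> H"
    then have "i \<in> {1..n}" using im by force
    then show "i \<in> {1..n} \<and> j = \<sigma> i" using rooks_unique_col[OF H ij] s by (simp add: \<sigma>_def)
  qed (use s in \<open>simp add: \<sigma>_def\<close>)
  have \<sigma>_range: "\<sigma> i \<in> {1..n}" if "i \<in> {1..n}" for i
    using \<sigma>H[of i "\<sigma> i"] that H by (auto simp: rooks_def)
  have \<sigma>_inj: "inj_on \<sigma> {1..n}"
  proof (rule inj_onI)
    fix i i' assume "i \<in> {1..n}" "i' \<in> {1..n}" "\<sigma> i = \<sigma> i'"
    then show "i = i'" using rooks_unique_row[OF H, of i "\<sigma> i" i'] \<sigma>H by simp
  qed
  have "\<sigma> ` {1..n} = {1..n}" by (rule endo_inj_surj) (use \<sigma>_range \<sigma>_inj in auto)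
  then have perm: "\<sigma> permutes {1..n}"
    using \<sigma>_inj by (intro bij_imp_permutes) (auto simp: bij_betw_def \<sigma>_def)
  \<comment> \<open>A column contains at most one cell of \<open>q\<close>, so the sum is the
    exponent of that cell, or 0 for a free column.\<close>
  define \<kappa> where "\<kappa> = restrict (\<lambda>j. \<Sum>i = 1..n. Poly_Mapping.lookup q (i, j)) {1..n}"
  have \<kappa>: "\<kappa> (\<sigma> i) = Poly_Mapping.lookup q (i, \<sigma> i)" if i: "i \<in> {1..n}" for i
  proof -
    have "Poly_Mapping.lookup q (i', \<sigma> i) = 0" if "i' \<in> {1..n} - {i}" for i'
    proof (rule ccontr)
      assume "Poly_Mapping.lookup q (i', \<sigma> i) \<noteq> 0"
      then have "(i', \<sigma> i) \<in> H" by (simp add: H_def in_keys_iff)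
      moreover have "(i, \<sigma> i) \<in> H" unfolding \<sigma>H using i by simp
      ultimately have "i' = i" by (rule rooks_unique_row[OF H])
      then show False using that by simp
    qed
    then have "(\<Sum>i' = 1..n. Poly_Mapping.lookup q (i', \<sigma> i)) = (\<Sum>i'\<in>{i}. Poly_Mapping.lookup q (i', \<sigma> i))"
      by (intro sum.mono_neutral_right) (use i in auto)
    then show ?thesis using \<sigma>_range[OF i] by (simp add: \<kappa>_def)
  qed
  have "\<kappa> \<in> {1..n} \<rightarrow>\<^sub>E {0..<r}"
  proof (rule PiE_I)
    fix j assume "j \<in> {1..n}"
    then have "j \<in> \<sigma> ` {1..n}" by (simp only: \<open>\<sigma> ` {1..n} = {1..n}\<close>)
    then obtain i where i: "i \<in> {1..n}" "j = \<sigma> i" by blast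
    show "\<kappa> j \<in> {0..<r}"
      unfolding i(2) \<kappa>[OF i(1)] using sector_lookup_less[OF q, of "(i, \<sigma> i)"] by simp
  qed (auto simp: \<kappa>_def)
  then have w: "(\<sigma>, \<kappa>) \<in> colored_perms n r"
    unfolding colored_perms_def using perm by (intro SigmaI CollectI)
  have cp: "color_part n (\<sigma>, \<kappa>) = q"
  proof (rule poly_mapping_eqI)
    fix c :: "nat \<times> nat"
    obtain i j where c: "c = (i, j)" by (cases c)
    show "Poly_Mapping.lookup (color_part n (\<sigma>, \<kappa>)) c = Poly_Mapping.lookup q c"
    proof (cases "i \<in> {1..n} \<and> j = \<sigma> i")
      case True
      then show ?thesis unfolding c lookup_color_part using \<kappa> by simp
    next
      case False
      then have "(i, j) \<notin> Poly_Mapping.keys q" using \<sigma>H[of i j] by (auto simp: H_def)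
      then show ?thesis unfolding c lookup_color_part using False by (auto simp: in_keys_iff)
    qed
  qed
  have "{(i, \<sigma> i) | i. i \<in> {1..n}} = H" using \<sigma>H by auto
  then have "color_class n 0 (\<sigma>, \<kappa>) = H - Poly_Mapping.keys q"
    unfolding color_class_0_eq cp by (simp only: fst_conv)
  also have "\<dots> = G" using dis by (auto simp: H_def)
  finally have "color_class n 0 (\<sigma>, \<kappa>) = G" .
  then show ?thesis using w cp by blast
qed

section \<open>Degrees of the basis monomials and the statistic\<close>

lemma monomial_degree_color_part: "monomial_degree (color_part n w) = (\<Sum>i = 1..n. snd w (fst w i))"
proof -
  have single: "monomial_degree (Poly_Mapping.single c k) = k" for c k
    by (simp add: monomial_degree_def)
  have "monomial_degree (sum g A) = (\<Sum>a\<in>A. monomial_degree (g a))" for g :: "nat \<Rightarrow> _" and A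
    by (induction A rule: infinite_finite_induct)
      (auto simp: monomial_degree_add, auto simp: monomial_degree_def)
  then show ?thesis by (simp add: color_part_def single)
qed

lemma card_color_class: "card (color_class n l w) = card {i \<in> {1..n}. snd w (fst w i) = l}"
proof -
  have "color_class n l w = (\<lambda>i. (i, fst w i)) ` {i \<in> {1..n}. snd w (fst w i) = l}"
    by (auto simp: color_class_def)
  then show ?thesis by (simp add: card_image inj_on_def)
qed

lemma finite_color_class: "finite (color_class n l w)"
proof -
  have "color_class n l w = (\<lambda>i. (i, fst w i)) ` {i \<in> {1..n}. snd w (fst w i) = l}"
    by (auto simp: color_class_def)
  then show ?thesis by simp
qed

lemma card_residual: "finite C \<Longrightarrow> card (residual C) + lis C = card C"
  using longest_increasing[of C] lis_le_card[of C]
  by (simp add: residual_def card_Diff_subset finite_subset)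

text \<open>A row of colour \<open>l\<close> contributes \<open>r - l\<close> to the statistic, if
  the whole class of colour 0 is counted, and \<open>l\<close> to the degree. Each cell of the
  residual then moves \<open>r\<close> from the statistic to the degree.\<close>

lemma monomial_degree_perm_monom:
  assumes w: "w \<in> colored_perms n r" and r: "0 < r"
  shows "r * lis (color_class n 0 w) + (\<Sum>l = 1..r - 1. (r - l) * card (color_class n l w)) +
     monomial_degree (perm_monom n r w) = r * n"
proof -
  let ?k = "\<lambda>i. snd w (fst w i)"
  let ?C = "\<lambda>l. color_class n l w"
  have lt: "?k i < r" if "i \<in> {1..n}" for i using colored_permsD(2)[OF w that] .
  have "{..<r} = insert 0 {1..r - 1}" using r by auto
  then have "r * card (?C 0) + (\<Sum>l = 1..r - 1. (r - l) * card (?C l)) = (\<Sum>l<r. (r - l) * card (?C l))"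
    by simp
  also have "\<dots> = (\<Sum>l<r. \<Sum>i | i \<in> {1..n} \<and> ?k i = l. r - ?k i)"
    by (simp add: card_color_class mult.commute)
  also have "\<dots> = (\<Sum>i = 1..n. r - ?k i)"
    by (rule sum.group) (use lt in auto)
  finally have "r * card (?C 0) + (\<Sum>l = 1..r - 1. (r - l) * card (?C l)) + monomial_degree (color_part n w) =
      (\<Sum>i = 1..n. (r - ?k i) + ?k i)"
    unfolding monomial_degree_color_part sum.distrib by simp
  also have "\<dots> = (\<Sum>i = 1..n. r)"
    by (rule sum.cong) (use lt in \<open>auto simp: less_imp_le\<close>)
  finally have 1: "r * card (?C 0) + (\<Sum>l = 1..r - 1. (r - l) * card (?C l)) +
      monomial_degree (color_part n w) = r * n" by simp
  have "finite (residual (?C 0))" using finite_color_class by (simp add: residual_def)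
  then have 2: "monomial_degree (perm_monom n r w) = monomial_degree (color_part n w) + r * card (residual (?C 0))"
    by (simp add: perm_monom_def monomial_degree_add monomial_degree_rook_monom)
  have 3: "r * card (?C 0) = r * card (residual (?C 0)) + r * lis (?C 0)"
    by (simp flip: card_residual[OF finite_color_class] distrib_left)
  show ?thesis using 1 2 3 by simp
qed

text \<open>The reason why the Hilbert series has no term for \<open>k = 0\<close>: either the class
  of colour 0 contains a nonempty increasing subsequence, or the degree is a sum of \<open>n\<close>
  colours, each below \<open>r\<close>.\<close>

lemma monomial_degree_perm_monom_less:
  assumes w: "w \<in> colored_perms n r" and r: "0 < r" and n: "0 < n"
  shows "monomial_degree (perm_monom n r w) < r * n"
proof (cases "color_class n 0 w = {}")
  case False
  then have "0 < lis (color_class n 0 w)" by (intro lis_pos finite_color_class)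
  then have "0 < r * lis (color_class n 0 w)" using r by simp
  then show ?thesis using monomial_degree_perm_monom[OF w r] by linarith
next
  case True
  then have "residual (color_class n 0 w) = {}" by (simp add: residual_def)
  then have "monomial_degree (perm_monom n r w) = (\<Sum>i = 1..n. snd w (fst w i))"
    by (simp add: perm_monom_def rook_monom_def monomial_degree_color_part)
  also have "\<dots> < (\<Sum>i = 1..n. r)"
    by (rule sum_strict_mono) (use colored_permsD(2)[OF w] n in auto)
  finally show ?thesis by (simp add: mult.commute)
qed

definition perms_of_degree :: "nat \<Rightarrow> nat \<Rightarrow> nat \<Rightarrow> ((nat \<Rightarrow> nat) \<times> (nat \<Rightarrow> nat)) set" where
  "perms_of_degree n r d = {w \<in> colored_perms n r. monomial_degree (perm_monom n r w) = d}"

lemma finite_perms_of_degree: "finite (perms_of_degree n r d)"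
  unfolding perms_of_degree_def using finite_colored_perms by simp

lemma color_class_lis:
  assumes w: "w \<in> perms_of_degree n r d" and r: "0 < r"
    and d: "monomial_degree (color_part n w) + r * k = d"
  shows "color_class n 0 w \<in>
     perfect_rooks_lis (free_rows n (color_part n w)) (free_cols n (color_part n w)) k"
proof -
  have wc: "w \<in> colored_perms n r" and deg: "monomial_degree (perm_monom n r w) = d"
    using w by (auto simp: perms_of_degree_def)
  note G = color_class_perfect[OF wc r]
  let ?G = "color_class n 0 w"
  have "finite (residual ?G)" using finite_color_class by (simp add: residual_def)
  then have "monomial_degree (color_part n w) + r * card (residual ?G) = d"
    using deg by (simp add: perm_monom_def monomial_degree_add monomial_degree_rook_monom)
  then have "r * card (residual ?G) = r * k" using d by linarith
  then have "card (residual ?G) = k" using r by simp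
  moreover have "card ?G = card (free_rows n (color_part n w))" using G by (simp add: rooks_def)
  ultimately show ?thesis
    using G card_residual[OF finite_color_class[of n 0 w]] by (simp add: perfect_rooks_lis_def)
qed

section \<open>Independence and spanning of the basis monomials\<close>

text \<open>The functionals of the sector of \<open>w0\<close> annihilate the relation except for
  the \<open>w\<close> with the same colour part. These \<open>w\<close> correspond to perfect
  placements of the free rows and columns, where independence is known.\<close>

lemma perm_monomials_independent:
  assumes r: "0 < r"
    and rel: "(\<Sum>w\<in>perms_of_degree n r d. Poly_Mapping.single 0 (a w) * monomial (perm_monom n r w)) \<in> colored_perm_ideal n r"
    and w0: "w0 \<in> perms_of_degree n r d"
  shows "a w0 = 0"
proof -
  let ?W = "perms_of_degree n r d"
  have wc: "w0 \<in> colored_perms n r" using w0 by (simp add: perms_of_degree_def)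
  define q where "q = color_part n w0"
  define I where "I = free_rows n q"
  define J where "J = free_cols n q"
  \<comment> \<open>In a fixed degree \<open>d\<close> the sector determines the size of the
    residual through \<open>monomial_degree q + r * k = d\<close>, so one \<open>k\<close> serves
    all \<open>w\<close> of this sector.\<close>
  define k where "k = card (residual (color_class n 0 w0))"
  have q: "sector n r q" unfolding q_def by (rule sector_color_part[OF wc r])
  have fin: "finite I" "finite J" "card I = card J" using card_free(1)[OF q] by (auto simp: I_def J_def)
  have "finite (residual (color_class n 0 w0))" using finite_color_class by (simp add: residual_def)
  then have deg: "monomial_degree q + r * k = d"
    using w0 by (simp add: perms_of_degree_def perm_monom_def monomial_degree_add
        monomial_degree_rook_monom q_def k_def)
  let ?P = "perfect_rooks_lis I J k"
  let ?V = "{w \<in> ?W. color_part n w = q}"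
  have cls: "color_class n 0 w \<in> ?P" if "w \<in> ?V" for w
    using color_class_lis[OF _ r, of w n d k] that deg by (auto simp: I_def J_def)
  have bij: "bij_betw (color_class n 0) ?V ?P"
  proof (rule bij_betwI')
    show "color_class n 0 w = color_class n 0 w' \<longleftrightarrow> w = w'" if "w \<in> ?V" "w' \<in> ?V" for w w'
      using that colored_perm_unique[of w n r w'] by (auto simp: perms_of_degree_def)
    show "color_class n 0 w \<in> ?P" if "w \<in> ?V" for w using cls[OF that] .
    show "\<exists>w\<in>?V. G = color_class n 0 w" if G: "G \<in> ?P" for G
    proof -
      have Gr: "G \<in> rooks I J (card I)" and lis: "lis G + k = card I"
        using G by (auto simp: perfect_rooks_lis_def)
      obtain w where w: "w \<in> colored_perms n r" "color_part n w = q" "color_class n 0 w = G"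
        using colored_perm_exists[OF q] Gr unfolding I_def J_def by blast
      have "finite G" "card G = card I" using Gr by (auto simp: rooks_def)
      then have "card (residual G) = k" "finite (residual G)"
        using lis card_residual[of G] by (auto simp: residual_def)
      then have "monomial_degree (perm_monom n r w) = d"
        using deg w by (simp add: perm_monom_def monomial_degree_add monomial_degree_rook_monom)
      then show ?thesis using w by (intro bexI[of _ w]) (auto simp: perms_of_degree_def)
    qed
  qed
  have val: "(\<Sum>G\<in>?P. a (inv_into ?V (color_class n 0) G) * f (residual G)) = 0"
    if bal: "row_balanced I J k f" "col_balanced I J k f" for f
  proof -
    let ?\<psi> = "sector_functional n r q k f"
    have "?\<psi> (monomial (perm_monom n r w)) = (if color_part n w = q then f (residual (color_class n 0 w)) else 0)"
      if w: "w \<in> ?W" for w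
    proof (cases "color_part n w = q")
      case True
      then have wV: "w \<in> ?V" using w by simp
      have "color_class n 0 w \<in> rooks I J (card I)" "card I - lis (color_class n 0 w) = k"
        using cls[OF wV] by (auto simp: perfect_rooks_lis_def)
      then have "residual (color_class n 0 w) \<in> rooks I J k" using residual_rooks by blast
      then show ?thesis
        using True sector_functional_monomial_eq[OF r] unfolding perm_monom_def I_def J_def by simp
    next
      case False
      have wc': "w \<in> colored_perms n r" using w by (simp add: perms_of_degree_def)
      note R' = residual_rooks[OF color_class_perfect[OF wc' r]]
      have "?\<psi> (monomial (perm_monom n r w)) = 0"
      proof (rule sector_functional_monomial_eq_0)
        fix R assume R: "R \<in> rooks (free_rows n q) (free_cols n q) k"
        show "perm_monom n r w \<noteq> q + rook_monom r R"
          using sector_decomposition_unique(1)[OF sector_color_part[OF wc' r] R' q R] False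
          unfolding perm_monom_def by blast
      qed
      then show ?thesis using False by simp
    qed
    then have "?\<psi> (\<Sum>w\<in>?W. Poly_Mapping.single 0 (a w) * monomial (perm_monom n r w)) =
        (\<Sum>w\<in>?W. if color_part n w = q then a w * f (residual (color_class n 0 w)) else 0)"
      unfolding sector_functional_sum sector_functional_scale by (intro sum.cong) auto
    also have "\<dots> = (\<Sum>w\<in>?V. a w * f (residual (color_class n 0 w)))"
      using finite_perms_of_degree by (simp add: sum.inter_filter)
    also have "\<dots> = (\<Sum>w\<in>?V. a (inv_into ?V (color_class n 0) (color_class n 0 w)) * f (residual (color_class n 0 w)))"
      by (rule sum.cong) (simp_all add: inv_into_f_f[OF bij_betw_imp_inj_on[OF bij]])
    also have "\<dots> = (\<Sum>G\<in>?P. a (inv_into ?V (color_class n 0) G) * f (residual G))"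
      by (rule sum.reindex_bij_betw[OF bij])
    finally show ?thesis
      using sector_functional_ideal[OF q r _ _ rel] bal unfolding I_def J_def by simp
  qed
  have w0V: "w0 \<in> ?V" using w0 by (simp add: q_def)
  have "a (inv_into ?V (color_class n 0) (color_class n 0 w0)) = 0"
    by (rule perfect_rooks_lis_independent[OF fin val cls[OF w0V]])
  then show ?thesis by (simp add: inv_into_f_f[OF bij_betw_imp_inj_on[OF bij] w0V])
qed

text \<open>By duality: a functional vanishing on the ideal and on the proposed basis restricts in
  each sector to a balanced function that is 0 on all residuals, hence to 0. It then kills every
  monomial of \<open>p\<close>, so it cannot separate \<open>p\<close> from the span.\<close>

lemma perm_monomials_span:
  assumes r: "0 < r" and p: "p \<in> homogeneous_polys n d"
  shows "\<exists>a. \<exists>x\<in>colored_perm_ideal n r.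
    p = x + (\<Sum>w\<in>perms_of_degree n r d. Poly_Mapping.single 0 (a w) * monomial (perm_monom n r w))"
proof (rule ccontr)
  let ?W = "perms_of_degree n r d"
  let ?I = "colored_perm_ideal n r"
  let ?lin = "\<lambda>a. \<Sum>w\<in>?W. Poly_Mapping.single 0 (a w) * monomial (perm_monom n r w)"
  let ?S = "{x + ?lin a | x a. x \<in> ?I}"
  assume "\<nexists>a. \<exists>x\<in>?I. p = x + ?lin a"
  then have pS: "p \<notin> ?S" by blast
  interpret vector_space "\<lambda>(c :: complex) (p :: cpoly). Poly_Mapping.single 0 c * p"
    by (rule vector_space_poly_mapping)
  have S_mem: "x + ?lin a \<in> ?S" if "x \<in> ?I" for x a
    using that by (intro CollectI exI[of _ x] exI[of _ a]) simp
  have sub: "subspace ?S"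
  proof (rule subspaceI)
    show "0 \<in> ?S" using colored_perm_ideal_0 by (intro CollectI exI[of _ 0] exI[of _ "\<lambda>_. 0"]) simp
  next
    fix x y assume "x \<in> ?S" "y \<in> ?S"
    then obtain u a v b where u: "x = u + ?lin a" "u \<in> ?I" and v: "y = v + ?lin b" "v \<in> ?I" by blast
    have eq: "x + y = (u + v) + ?lin (\<lambda>w. a w + b w)"
      unfolding u v by (simp add: single_add distrib_right sum.distrib add_ac)
    show "x + y \<in> ?S" unfolding eq by (rule S_mem[OF colored_perm_ideal_add[OF u(2) v(2)]])
  next
    fix c :: complex and x assume "x \<in> ?S"
    then obtain u a where u: "x = u + ?lin a" "u \<in> ?I" by blast
    have eq: "Poly_Mapping.single 0 c * x = Poly_Mapping.single 0 c * u + ?lin (\<lambda>w. c * a w)"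
      unfolding u by (simp add: distrib_left sum_distrib_left mult_single mult.assoc[symmetric])
    show "Poly_Mapping.single 0 c * x \<in> ?S"
      unfolding eq by (rule S_mem[OF colored_perm_ideal_mult[OF matrix_polys_const u(2)]])
  qed
  obtain g where lin: "Vector_Spaces.linear (\<lambda>c p. Poly_Mapping.single 0 c * p) (*) g"
    and gS: "\<forall>x\<in>?S. g x = 0" and gp: "g p = 1"
    using separating_functional[OF sub pS] by blast
  interpret g: Vector_Spaces.linear "\<lambda>c p. Poly_Mapping.single 0 c * p" "(*) :: complex \<Rightarrow> complex \<Rightarrow> complex" g
    by (rule lin)
  have gI: "g x = 0" if "x \<in> ?I" for x
  proof -
    have "x + ?lin (\<lambda>_. 0) \<in> ?S" by (rule S_mem[OF that])
    then have "g (x + ?lin (\<lambda>_. 0)) = 0" using gS by blast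
    then show ?thesis by simp
  qed
  have gW: "g (monomial (perm_monom n r v)) = 0" if v: "v \<in> ?W" for v
  proof -
    have "?lin (\<lambda>w. if w = v then 1 else 0) =
        (\<Sum>w\<in>?W. if w = v then monomial (perm_monom n r v) else 0)"
      by (rule sum.cong) auto
    also have "\<dots> = monomial (perm_monom n r v)" using v finite_perms_of_degree by (simp add: sum.delta)
    finally have eq: "0 + ?lin (\<lambda>w. if w = v then 1 else 0) = monomial (perm_monom n r v)" by simp
    have "0 + ?lin (\<lambda>w. if w = v then 1 else 0) \<in> ?S" by (rule S_mem[OF colored_perm_ideal_0])
    then have "monomial (perm_monom n r v) \<in> ?S" unfolding eq .
    then show ?thesis using gS by blast
  qed
  have zero: "g (monomial (q + rook_monom r R)) = 0"
    if q: "sector n r q" and R: "R \<in> rooks (free_rows n q) (free_cols n q) (card R)"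
      and deg: "monomial_degree (q + rook_monom r R) = d" for q R
  proof -
    let ?I' = "free_rows n q" and ?J' = "free_cols n q" and ?k = "card R"
    define f where "f = (\<lambda>R. g (monomial (q + rook_monom r R)))"
    have fR: "finite R" using R by (simp add: rooks_def)
    have fin: "finite ?I'" "finite ?J'" "card ?I' = card ?J'" using card_free(1)[OF q] by auto
    have deg': "monomial_degree q + r * ?k = d"
      using deg fR by (simp add: monomial_degree_add monomial_degree_rook_monom)
    \<comment> \<open>The line sum times the monomial of \<open>T\<close> lies in the ideal. Its
      terms for cells that share a row or column with another occupied cell lie in the ideal as
      well, and those that remain give the balancing relation of \<open>f\<close> at
      \<open>T\<close>.\<close>
    have line: "(\<Sum>c\<in>B. f (insert c T)) = 0"
      if T: "T \<in> rooks ?I' ?J' t" and A: "finite A" "A \<subseteq> {1..n} \<times> {1..n}" "B \<subseteq> A" "B \<inter> T = {}"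
        and gen: "(\<Sum>c\<in>A. xvar (fst c) (snd c) ^ r) \<in> ?I"
        and bad: "\<And>c. c \<in> A - B \<Longrightarrow> \<exists>d\<in>Poly_Mapping.keys q \<union> T. d \<noteq> c \<and> (fst d = fst c \<or> snd d = snd c)"
      for t T A B
    proof -
      have fT: "finite T" using T by (simp add: rooks_def)
      let ?m = "q + rook_monom r T"
      have U: "Poly_Mapping.keys q \<union> T \<in> rooks {1..n} {1..n} (card (Poly_Mapping.keys q) + t)"
        by (rule sector_rooks_union(1)[OF q T])
      have Km: "Poly_Mapping.keys ?m = Poly_Mapping.keys q \<union> T"
        unfolding keys_add_nat keys_rook_monom[OF fT r] ..
      have m: "monomial ?m \<in> matrix_polys n"
        unfolding monomial_matrix_polys Km using U by (simp add: rooks_def)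
      have badI: "monomial (?m + Poly_Mapping.single c r) \<in> ?I" if c: "c \<in> A - B" for c
      proof (rule ccontr)
        assume not: "monomial (?m + Poly_Mapping.single c r) \<notin> ?I"
        have Kc: "Poly_Mapping.keys (?m + Poly_Mapping.single c r) = insert c (Poly_Mapping.keys q \<union> T)"
          unfolding keys_add_nat[of ?m] Km using r by simp
        have "Poly_Mapping.keys (?m + Poly_Mapping.single c r) \<subseteq> {1..n} \<times> {1..n}"
          unfolding Kc using c A(2) U by (auto simp: rooks_def)
        from monomial_ideal_cases[OF this r not] obtain q' R' where
          q': "sector n r q'" "R' \<in> rooks (free_rows n q') (free_cols n q') (card R')"
            "?m + Poly_Mapping.single c r = q' + rook_monom r R'" .
        obtain e where e: "e \<in> Poly_Mapping.keys q \<union> T" "e \<noteq> c" "fst e = fst c \<or> snd e = snd c"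
          using bad[OF c] by blast
        have ec: "(fst e, snd e) \<in> Poly_Mapping.keys (?m + Poly_Mapping.single c r)"
          "(fst c, snd c) \<in> Poly_Mapping.keys (?m + Poly_Mapping.single c r)"
          unfolding Kc using e by auto
        from e(3) show False
        proof
          assume eq: "fst e = fst c"
          have "snd e = snd c"
            using sector_monomial_not_multiple(2)[OF q'] ec unfolding eq by blast
          then show False using eq e(2) by (simp add: prod_eq_iff)
        next
          assume eq: "snd e = snd c"
          have "fst e = fst c"
            using sector_monomial_not_multiple(3)[OF q'] ec unfolding eq by blast
          then show False using eq e(2) by (simp add: prod_eq_iff)
        qed
      qed
      have "monomial ?m * (\<Sum>c\<in>A. xvar (fst c) (snd c) ^ r) = (\<Sum>c\<in>A. monomial (?m + Poly_Mapping.single c r))"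
        by (simp add: xvar_power sum_distrib_left monomial_mult)
      then have "0 = g (\<Sum>c\<in>A. monomial (?m + Poly_Mapping.single c r))"
        using gI[OF colored_perm_ideal_mult[OF m gen]] by simp
      also have "\<dots> = (\<Sum>c\<in>A. g (monomial (?m + Poly_Mapping.single c r)))" by (rule g.sum)
      also have "\<dots> = (\<Sum>c\<in>B. g (monomial (?m + Poly_Mapping.single c r)))"
        by (rule sum.mono_neutral_right) (use A badI gI in auto)
      also have "\<dots> = (\<Sum>c\<in>B. f (insert c T))"
      proof (rule sum.cong[OF refl])
        fix c assume "c \<in> B"
        then have "c \<notin> T" using A(4) by blast
        then show "g (monomial (?m + Poly_Mapping.single c r)) = f (insert c T)"
          by (simp add: f_def rook_monom_insert[OF fT] add.assoc)
      qed
      finally show ?thesis by simp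
    qed
    have row: "row_balanced ?I' ?J' ?k f"
      unfolding row_balanced_def
    proof (intro allI impI)
      fix t T i assume T: "T \<in> rooks ?I' ?J' t" "Suc t = ?k" "i \<in> ?I' - fst ` T"
      have i: "i \<in> {1..n}" using T(3) by (auto simp: free_rows_def)
      have iU: "i \<notin> fst ` (Poly_Mapping.keys q \<union> T)" using T(3) by (auto simp: free_rows_def)
      have "(\<Sum>c\<in>Pair i ` (?J' - snd ` T). f (insert c T)) = 0"
      proof (rule line[OF T(1), of "Pair i ` {1..n}"])
        show "(\<Sum>c\<in>Pair i ` {1..n}. xvar (fst c) (snd c) ^ r) \<in> ?I"
          using colored_perm_ideal_gens[OF colored_perm_gensI(4)[OF i i]]
          by (simp add: sum.reindex inj_on_def)
        show "Pair i ` (?J' - snd ` T) \<subseteq> Pair i ` {1..n}" by (auto simp: free_cols_def)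
        show "Pair i ` (?J' - snd ` T) \<inter> T = {}" by force
        fix c assume "c \<in> Pair i ` {1..n} - Pair i ` (?J' - snd ` T)"
        then obtain j where c: "c = (i, j)" "j \<in> {1..n}" "j \<notin> ?J' - snd ` T" by blast
        then have "j \<in> snd ` (Poly_Mapping.keys q \<union> T)" by (auto simp: free_cols_def image_Un)
        then obtain e where e: "e \<in> Poly_Mapping.keys q \<union> T" "snd e = j" by auto
        have "e \<noteq> c" using imageI[OF e(1), of fst] iU c(1) by (metis fst_conv)
        moreover have "snd e = snd c" using e(2) c(1) by simp
        ultimately show "\<exists>d\<in>Poly_Mapping.keys q \<union> T. d \<noteq> c \<and> (fst d = fst c \<or> snd d = snd c)"
          using e(1) by blast
      qed (use i in auto)
      then show "(\<Sum>j\<in>?J' - snd ` T. f (insert (i, j) T)) = 0"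
        by (simp add: sum.reindex inj_on_def)
    qed
    have col: "col_balanced ?I' ?J' ?k f"
      unfolding col_balanced_def
    proof (intro allI impI)
      fix t T j assume T: "T \<in> rooks ?I' ?J' t" "Suc t = ?k" "j \<in> ?J' - snd ` T"
      have j: "j \<in> {1..n}" using T(3) by (auto simp: free_cols_def)
      have jU: "j \<notin> snd ` (Poly_Mapping.keys q \<union> T)" using T(3) by (auto simp: free_cols_def)
      let ?p = "\<lambda>i. (i, j)"
      have "(\<Sum>c\<in>?p ` (?I' - fst ` T). f (insert c T)) = 0"
      proof (rule line[OF T(1), of "?p ` {1..n}"])
        show "(\<Sum>c\<in>?p ` {1..n}. xvar (fst c) (snd c) ^ r) \<in> ?I"
          using colored_perm_ideal_gens[OF colored_perm_gensI(5)[OF j j]]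
          by (simp add: sum.reindex inj_on_def)
        show "?p ` (?I' - fst ` T) \<subseteq> ?p ` {1..n}" by (auto simp: free_rows_def)
        show "?p ` (?I' - fst ` T) \<inter> T = {}" by force
        fix c assume "c \<in> ?p ` {1..n} - ?p ` (?I' - fst ` T)"
        then obtain i where c: "c = (i, j)" "i \<in> {1..n}" "i \<notin> ?I' - fst ` T" by blast
        then have "i \<in> fst ` (Poly_Mapping.keys q \<union> T)" by (auto simp: free_rows_def image_Un)
        then obtain e where e: "e \<in> Poly_Mapping.keys q \<union> T" "fst e = i" by auto
        have "e \<noteq> c" using imageI[OF e(1), of snd] jU c(1) by (metis snd_conv)
        moreover have "fst e = fst c" using e(2) c(1) by simp
        ultimately show "\<exists>d\<in>Poly_Mapping.keys q \<union> T. d \<noteq> c \<and> (fst d = fst c \<or> snd d = snd c)"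
          using e(1) by blast
      qed (use j in auto)
      then show "(\<Sum>i\<in>?I' - fst ` T. f (insert (i, j) T)) = 0"
        by (simp add: sum.reindex inj_on_def)
    qed
    have "f R = 0"
    proof (rule balanced_eq_0_of_residuals[OF fin row col _ R])
      fix G assume "G \<in> perfect_rooks_lis ?I' ?J' ?k"
      then have G: "G \<in> rooks ?I' ?J' (card ?I')" "lis G + ?k = card ?I'"
        by (auto simp: perfect_rooks_lis_def)
      obtain w where w: "w \<in> colored_perms n r" "color_part n w = q" "color_class n 0 w = G"
        using colored_perm_exists[OF q G(1)] by blast
      have mon: "perm_monom n r w = q + rook_monom r (residual G)" by (simp add: perm_monom_def w)
      have "finite G" "card G = card ?I'" using G(1) by (auto simp: rooks_def)
      then have "card (residual G) = ?k" "finite (residual G)"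
        using G(2) card_residual[of G] by (auto simp: residual_def)
      then have "w \<in> ?W"
        using w(1) deg' by (simp add: perms_of_degree_def mon monomial_degree_add monomial_degree_rook_monom)
      from gW[OF this] show "f (residual G) = 0" by (simp add: f_def mon)
    qed
    then show ?thesis by (simp add: f_def)
  qed
  have "g (monomial m) = 0" if m: "m \<in> Poly_Mapping.keys p" for m
  proof (cases "monomial m \<in> ?I")
    case True
    then show ?thesis by (rule gI)
  next
    case False
    have K: "Poly_Mapping.keys m \<subseteq> {1..n} \<times> {1..n}" and deg: "monomial_degree m = d"
      using p m by (auto simp: homogeneous_polys_def matrix_polys_def)
    from monomial_ideal_cases[OF K r False] obtain q R where
      "sector n r q" "R \<in> rooks (free_rows n q) (free_cols n q) (card R)" "m = q + rook_monom r R" .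
    then show ?thesis using zero deg by blast
  qed
  then have "g (\<Sum>m\<in>Poly_Mapping.keys p. Poly_Mapping.single 0 (Poly_Mapping.lookup p m) * monomial m) = 0"
    unfolding g.sum g.scale by (intro sum.neutral) simp
  then have "g p = 0" using poly_mapping_sum_monomials[of p] by simp
  then show False using gp by simp
qed

section \<open>From the basis to the Hilbert series\<close>

lemma dim_colored_perm_quotient:
  assumes r: "0 < r"
  shows "ring.dim (matrix_poly_ring n Quot colored_perm_ideal n r)
     (quot_image n (colored_perm_ideal n r) constant_polys)
     (quot_image n (colored_perm_ideal n r) (homogeneous_polys n d)) = card (perms_of_degree n r d)"
proof (rule dim_quot_image[where b = "\<lambda>w. monomial (perm_monom n r w)"])
  let ?I = "colored_perm_ideal n r"
  have b: "monomial (perm_monom n r w) \<in> matrix_polys n" if w: "w \<in> perms_of_degree n r d" for w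
  proof -
    have wc: "w \<in> colored_perms n r" using w by (simp add: perms_of_degree_def)
    have R: "residual (color_class n 0 w) \<in> rooks (free_rows n (color_part n w)) (free_cols n (color_part n w))
        (card (free_rows n (color_part n w)) - lis (color_class n 0 w))"
      by (rule residual_rooks[OF color_class_perfect[OF wc r]])
    have fin: "finite (residual (color_class n 0 w))" using finite_color_class by (simp add: residual_def)
    show ?thesis
      unfolding monomial_matrix_polys perm_monom_def keys_add_nat keys_rook_monom[OF fin r]
      using sector_rooks_union(1)[OF sector_color_part[OF wc r] R] by (simp add: rooks_def)
  qed
  then show "\<And>w. w \<in> perms_of_degree n r d \<Longrightarrow> monomial (perm_monom n r w) \<in> matrix_polys n" .
  show "ideal ?I (matrix_poly_ring n)" by (rule ideal_colored_perm_ideal)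
  show "1 \<notin> ?I" by (rule colored_perm_ideal_proper[OF r])
  show "finite (perms_of_degree n r d)" by (rule finite_perms_of_degree)
  show "a w = 0"
    if "(\<Sum>w\<in>perms_of_degree n r d. Poly_Mapping.single 0 (a w) * monomial (perm_monom n r w)) \<in> ?I"
      "w \<in> perms_of_degree n r d" for a w
    by (rule perm_monomials_independent[OF r that])
  show "\<exists>a. \<exists>x\<in>?I. p = x + (\<Sum>w\<in>perms_of_degree n r d. Poly_Mapping.single 0 (a w) * monomial (perm_monom n r w))"
    if "p \<in> homogeneous_polys n d" for p
    by (rule perm_monomials_span[OF r that])
  show "(\<Sum>w\<in>perms_of_degree n r d. Poly_Mapping.single 0 (a w) * monomial (perm_monom n r w)) \<in> homogeneous_polys n d"
    (is "?s \<in> _") for a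
  proof -
    have "?s \<in> matrix_polys n" by (intro matrix_polys_sum matrix_polys_mult matrix_polys_const b)
    moreover have "monomial_degree m = d" if m: "m \<in> Poly_Mapping.keys ?s" for m
    proof -
      have "Poly_Mapping.lookup ?s m \<noteq> 0" using m by (simp add: in_keys_iff)
      then obtain w where "w \<in> perms_of_degree n r d"
        "Poly_Mapping.lookup (Poly_Mapping.single 0 (a w) * monomial (perm_monom n r w)) m \<noteq> 0"
        unfolding lookup_sum by (meson sum.neutral)
      then show ?thesis by (auto simp: lookup_single when_def perms_of_degree_def split: if_splits)
    qed
    ultimately show ?thesis by (simp add: homogeneous_polys_def)
  qed
qed

lemma card_perms_of_degree:
  assumes "0 < r" "0 < n"
  shows "card (perms_of_degree n r d) = (if d < r * n then perm_count n r (r * n - d) else 0)"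
proof (cases "d < r * n")
  case True
  have "perms_of_degree n r d = {w \<in> colored_perms n r.
      r * lis (color_class n 0 w) + (\<Sum>i = 1..r - 1. (r - i) * card (color_class n i w)) = r * n - d}"
    unfolding perms_of_degree_def
  proof (rule Collect_cong, rule conj_cong[OF refl])
    fix w assume "w \<in> colored_perms n r"
    from monomial_degree_perm_monom[OF this assms(1)] True
    show "monomial_degree (perm_monom n r w) = d \<longleftrightarrow>
        r * lis (color_class n 0 w) + (\<Sum>i = 1..r - 1. (r - i) * card (color_class n i w)) = r * n - d"
      by linarith
  qed
  then show ?thesis using True by (simp add: perm_count_def)
next
  case False
  then have "perms_of_degree n r d = {}"
    using monomial_degree_perm_monom_less[OF _ assms] by (force simp: perms_of_degree_def)
  then show ?thesis using False by simp
qed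

theorem theorem3p23:
  fixes n r :: nat
  assumes "n \<ge> 1" and "r \<ge> 1"
  shows "quot_hilbert_series n (colored_perm_ideal n r) =
    (\<Sum>k = 1..r * n. of_nat (perm_count n r k) * fps_X ^ (r * n - k))"
proof (rule fps_ext)
  fix d
  have pos: "0 < r" "0 < n" using assms by auto
  have "fps_nth (\<Sum>k = 1..r * n. of_nat (perm_count n r k) * fps_X ^ (r * n - k)) d =
      (\<Sum>k = 1..r * n. if d = r * n - k then int (perm_count n r k) else 0)"
    unfolding fps_sum_nth
  proof (rule sum.cong[OF refl])
    fix k
    have "of_nat (perm_count n r k) = fps_const (int (perm_count n r k))" by (simp add: fps_of_nat)
    then show "fps_nth (of_nat (perm_count n r k) * fps_X ^ (r * n - k)) d =
        (if d = r * n - k then int (perm_count n r k) else 0)"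
      by (simp add: fps_X_power_nth)
  qed
  \<comment> \<open>For \<open>1 \<le> k \<le> r * n\<close> the equation
    \<open>d = r * n - k\<close> is solved for \<open>k\<close>; it forces \<open>d < r * n\<close>,
    which becomes the inner condition.\<close>
  also have "\<dots> = (\<Sum>k = 1..r * n. if k = r * n - d then (if d < r * n then int (perm_count n r k) else 0) else 0)"
    by (rule sum.cong[OF refl]) auto
  also have "\<dots> = int (card (perms_of_degree n r d))"
    unfolding card_perms_of_degree[OF pos] by (auto simp: sum.delta)
  finally show "fps_nth (quot_hilbert_series n (colored_perm_ideal n r)) d =
      fps_nth (\<Sum>k = 1..r * n. of_nat (perm_count n r k) * fps_X ^ (r * n - k)) d"
    by (simp add: quot_hilbert_series_def dim_colored_perm_quotient[OF pos(1)])
qed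

end
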